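(* Let $1<p<\infty$. Define, for $F\in H^p(\Omega_+)$, \[TF(z)=F\big(\Phi(z)\big)\cdot\big(\Phi'(z)\big)^{\frac1p},\qquad z\in\mathbb{C}_+.\] Then $T$ maps $H^p(\Omega_+)$ into $H^p(\mathbb{C}_+)$, and $T\colon H^p(\Omega_+)\to H^p(\mathbb{C}_+)$ is linear, one-to-one, onto and bounded. Its inverse $T^{-1}\colon H^p(\mathbb{C}_+)\to H^p(\Omega_+)$ is also bounded.
   Context: Let $a\colon\mathbb{R}\to\mathbb{R}$ satisfy $|a(u_1)-a(u_2)|\le M|u_1-u_2|$ for all $u_1,u_2\in\mathbb{R}$, with a fixed $M>0$. Let $\Gamma=\{\zeta(u)=u+\mathrm{i}a(u)\colon u\in\mathbb{R}\}\subset\mathbb{C}$, with arc length measure $\mathrm{d}s=|\mathrm{d}\zeta|=(1+a'(u)^2)^{1/2}\,\mathrm{d}u$, and let $\Omega_+=\{u+\mathrm{i}v\colon v>a(u)\}$. For $1<p<\infty$, $H^p(\Omega_+)$ is the space of holomorphic $F$ on $\Omega_+$ with \[\|F\|_{H^p(\Omega_+)}=\sup_{\tau>0}\Big(\int_{\Gamma}|F(\zeta+\mathrm{i}\tau)|^p\,|\mathrm{d}\zeta|\Big)^{1/p}<\infty.\] $\mathbb{C}_+$ is the upper half plane, and $H^p(\mathbb{C}_+)$ is the space of holomorphic $f$ on $\mathbb{C}_+$ with $\|f\|_{H^p(\mathbb{C}_+)}=\sup_{y>0}\big(\int_{\mathbb{R}}|f(x+\mathrm{i}y)|^p\,\mathrm{d}x\big)^{1/p}<\infty$.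 $\Phi$ is a conformal map of $\mathbb{C}_+$ onto $\Omega_+$ which extends to a homeomorphism of $\overline{\mathbb{C}_+}$ onto $\overline{\Omega_+}$ (closures in $\mathbb{C}$) mapping $\mathbb{R}$ increasingly onto $\Gamma$ (i.e. $x\mapsto\mathrm{Re}\,\Phi(x)$ is increasing on $\mathbb{R}$). It is known that $\mathrm{Re}\,\Phi'>0$ on $\mathbb{C}_+$, so powers of $\Phi'$ are taken with the principal branch. *)

theory Defs
  imports "HOL-Complex_Analysis.Complex_Analysis"
begin

definition upper_half_plane :: "complex set" where
  "upper_half_plane = {z. 0 < Im z}"

definition graph_curve :: "(real \<Rightarrow> real) \<Rightarrow> complex set" where
  "graph_curve a = range (\<lambda>u. Complex u (a u))"

definition region_above :: "(real \<Rightarrow> real) \<Rightarrow> complex set" where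
  "region_above a = {z. a (Re z) < Im z}"

text \<open>
  Arc length on the graph of \<open>a\<close>: the image of the measure \<open>sqrt (1 + a'(u)\<^sup>2) du\<close> under
  \<open>u \<mapsto> u + \<i> a(u)\<close>.  A Lipschitz function \<open>a\<close> is differentiable almost everywhere, so the
  unspecified value of \<open>deriv a u\<close> at the remaining points does not affect the measure.
  The space of the measure is the curve itself.
\<close>
definition arc_length_measure :: "(real \<Rightarrow> real) \<Rightarrow> complex measure" where
  "arc_length_measure a =
     distr (density lborel (\<lambda>u. ennreal (sqrt (1 + (deriv a u)\<^sup>2))))
       (restrict_space borel (graph_curve a)) (\<lambda>u. Complex u (a u))"

definition ennreal_root :: "real \<Rightarrow> ennreal \<Rightarrow> ennreal" where
  "ennreal_root p x = (if x = \<infinity> then \<infinity> else ennreal (enn2real x powr (1 / p)))"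

text \<open>
  The Hardy norms take values in \<open>[0, \<infinity>]\<close> and are defined for all functions.
\<close>
definition hardy_norm_above :: "real \<Rightarrow> (real \<Rightarrow> real) \<Rightarrow> (complex \<Rightarrow> complex) \<Rightarrow> ennreal" where
  "hardy_norm_above p a F =
     (SUP \<tau>\<in>{0<..}. ennreal_root p
        (\<integral>\<^sup>+ \<zeta>. ennreal (norm (F (\<zeta> + \<i> * complex_of_real \<tau>)) powr p) \<partial>arc_length_measure a))"

definition hardy_norm_uhp :: "real \<Rightarrow> (complex \<Rightarrow> complex) \<Rightarrow> ennreal" where
  "hardy_norm_uhp p f =
     (SUP y\<in>{0<..}. ennreal_root p
        (\<integral>\<^sup>+ x. ennreal (norm (f (Complex x y)) powr p) \<partial>lborel))"

text \<open>
  A function on a domain is represented by its extension by \<open>0\<close> to the whole plane; thus two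
  elements of a Hardy space are equal iff they agree on the domain, and the vector space
  operations are pointwise.
\<close>
definition hardy_above :: "real \<Rightarrow> (real \<Rightarrow> real) \<Rightarrow> (complex \<Rightarrow> complex) set" where
  "hardy_above p a =
     {F. F holomorphic_on region_above a \<and> (\<forall>z. z \<notin> region_above a \<longrightarrow> F z = 0) \<and>
         hardy_norm_above p a F < \<infinity>}"

definition hardy_uhp :: "real \<Rightarrow> (complex \<Rightarrow> complex) set" where
  "hardy_uhp p =
     {f. f holomorphic_on upper_half_plane \<and> (\<forall>z. z \<notin> upper_half_plane \<longrightarrow> f z = 0) \<and>
         hardy_norm_uhp p f < \<infinity>}"

text \<open>On complex numbers, \<open>powr\<close> is the principal branch.\<close>
definition hardy_transfer ::
    "real \<Rightarrow> (complex \<Rightarrow> complex) \<Rightarrow> (complex \<Rightarrow> complex) \<Rightarrow> complex \<Rightarrow> complex" where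
  "hardy_transfer p \<Phi> F =
     (\<lambda>z. if z \<in> upper_half_plane
          then F (\<Phi> z) * deriv \<Phi> z powr complex_of_real (1 / p) else 0)"

definition function_subspace :: "(complex \<Rightarrow> complex) set \<Rightarrow> bool" where
  "function_subspace V \<longleftrightarrow>
     (\<lambda>z. 0) \<in> V \<and> (\<forall>F\<in>V. \<forall>G\<in>V. (\<lambda>z. F z + G z) \<in> V) \<and>
     (\<forall>c. \<forall>F\<in>V. (\<lambda>z. c * F z) \<in> V)"

definition linear_between ::
    "(complex \<Rightarrow> complex) set \<Rightarrow> (complex \<Rightarrow> complex) set \<Rightarrow>
     ((complex \<Rightarrow> complex) \<Rightarrow> complex \<Rightarrow> complex) \<Rightarrow> bool" where
  "linear_between V W T \<longleftrightarrow>
     function_subspace V \<and> function_subspace W \<and> T ` V \<subseteq> W \<and>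
     (\<forall>F\<in>V. \<forall>G\<in>V. T (\<lambda>z. F z + G z) = (\<lambda>z. T F z + T G z)) \<and>
     (\<forall>c. \<forall>F\<in>V. T (\<lambda>z. c * F z) = (\<lambda>z. c * T F z))"

definition bounded_between ::
    "(complex \<Rightarrow> complex) set \<Rightarrow> ((complex \<Rightarrow> complex) \<Rightarrow> ennreal) \<Rightarrow> ((complex \<Rightarrow> complex) \<Rightarrow> ennreal) \<Rightarrow>
     ((complex \<Rightarrow> complex) \<Rightarrow> complex \<Rightarrow> complex) \<Rightarrow> bool" where
  "bounded_between V normV normW T \<longleftrightarrow>
     (\<exists>C\<ge>0. \<forall>F\<in>V. normW (T F) \<le> ennreal C * normV F)"

end

theory Submission
  imports Defs
begin

text \<open>
  Let \<open>\<Omega>\<close> be the region above the graph, \<open>\<Psi>\<close> the inverse of \<open>\<Phi>\<close> and \<open>h = Im \<Psi>\<close>.  Up to a bounded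
  factor arc length on the graph is \<open>du\<close> (\<open>arc_length_comparable\<close>), so \<open>du\<close> is used throughout.

  \<^emph>\<open>Geometry.\<close>  \<open>\<Omega>\<close> is mapped into itself by every translation \<open>w \<mapsto> w + e\<close> with
  \<open>M \<bar>Re e\<bar> \<le> Im e\<close>.  In the half-plane this translation becomes a holomorphic self-map that is
  asymptotic to the identity along a sequence tending to infinity, and the Schwarz-Pick lemma then
  says that it does not lower imaginary parts (\<open>Im_\<Psi>_mono\<close>).  Differentiating in \<open>e\<close> gives
  \<open>\<bar>Im \<Phi>'\<bar> \<le> M Re \<Phi>'\<close>: the principal branch of \<open>(\<Phi>')\<^sup>1\<^sup>/\<^sup>p\<close> is holomorphic, and each level curve of \<open>h\<close>
  is a graph along which arc length is comparable to \<open>du\<close>.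

  \<^emph>\<open>The operator is bounded.\<close>  Since \<open>\<bar>TF\<bar>\<^sup>p = \<bar>F \<circ> \<Phi>\<bar>\<^sup>p \<bar>\<Phi>'\<bar>\<close>, the integral of \<open>\<bar>TF\<bar>\<^sup>p\<close> over the line
  \<open>Im z = y\<close> is the arc length integral of \<open>\<bar>F\<bar>\<^sup>p\<close> over the level curve \<open>h = y\<close>.  By Poisson's formula
  such line integrals decrease in \<open>y\<close> (\<open>hardy_line_integral_antimono\<close>), so only the limit \<open>y \<rightarrow> 0\<close>
  matters, where the level curves descend to the boundary.  If \<open>F\<close> is continuous up to the boundary
  and decays, dominated convergence applies (\<open>hardy_transfer_bound_decaying\<close>); a general \<open>F\<close> is
  shifted upwards, damped at infinity, and recovered by Fatou's lemma (\<open>hardy_transfer_bound\<close>).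

  \<^emph>\<open>The inverse is bounded.\<close>  Bound \<open>\<bar>f\<bar>\<^sup>p\<close> by its Poisson integral and interchange the integrations;
  what remains is a bound, uniform in \<open>t\<close> and \<open>\<tau>\<close>, for the integral of \<open>P(\<Psi>(w), t) \<bar>\<Psi>'(w)\<bar>\<close>, \<open>P\<close> the Poisson kernel, over the
  translate of the graph by \<open>\<tau>\<close> (\<open>poisson_pullback_integral_bound\<close>).  Schwarz-Pick bounds \<open>\<bar>\<Psi>'\<bar>\<close> by
  \<open>2 (1 + M) h / \<tau>\<close> there, so the integrand is at most a multiple of \<open>(sin \<theta>)\<^sup>2 / \<tau>\<close>, where \<open>\<theta>\<close> is the
  argument of \<open>\<Psi>(w) - t\<close>.  The angle \<open>\<theta>\<close> is harmonic and equals \<open>0\<close> or \<open>\<pi>\<close> on either side of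
  \<open>\<Phi>(t) = u\<^sub>0 + i a(u\<^sub>0)\<close>; comparison with a power \<open>q\<^sup>\<beta>\<close> in the cone of opening
  \<open>\<pi> + 2 arctan M\<close> that contains \<open>\<Omega>\<close> gives \<open>sin \<theta> \<le> C (\<tau> / \<bar>u - u\<^sub>0\<bar>)\<^sup>\<beta>\<close> (\<open>sin_angle_le\<close>).  The opening
  is less than \<open>2 \<pi>\<close>, hence \<open>\<beta> > 1/2\<close> is possible and the square of this bound is integrable.
\<close>

section \<open>The Schwarz-Pick lemma and horocycles\<close>

lemma norm_diff_less_norm_diff_cnj:
  assumes "0 < Im z" "0 < Im w"
  shows "norm (z - w) < norm (z - cnj w)"
proof -
  have "(Im z - Im w)\<^sup>2 < (Im z + Im w)\<^sup>2"
    using mult_pos_pos[OF assms] by (simp add: power2_eq_square algebra_simps)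
  then show ?thesis
    by (simp add: cmod_def)
qed

text \<open>
  The Cayley transform that sends \<open>q w0\<close> to \<open>0\<close> turns \<open>q\<close> into a self-map of the unit disc that
  fixes \<open>0\<close>, to which the Schwarz lemma applies.
\<close>
lemma schwarz_pick_disc:
  assumes q: "q holomorphic_on ball w0 r" and r: "0 < r"
    and pos: "\<And>w. w \<in> ball w0 r \<Longrightarrow> 0 < Im (q w)"
    and w: "w \<in> ball w0 r"
  shows "norm (q w - q w0) * r \<le> norm (w - w0) * norm (q w - cnj (q w0))"
proof -
  define c where "c = q w0"
  have c: "0 < Im c" using pos r by (auto simp: c_def)
  have ne: "v - cnj c \<noteq> 0" if "0 < Im v" for v
    using that c by (auto simp: complex_eq_iff)
  define f where "f = (\<lambda>\<xi>. (q (w0 + of_real r * \<xi>) - c) / (q (w0 + of_real r * \<xi>) - cnj c))"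
  have inb: "w0 + of_real r * \<xi> \<in> ball w0 r" if "norm \<xi> < 1" for \<xi>
    using that r by (simp add: dist_norm norm_mult)
  have qh: "(\<lambda>\<xi>. q (w0 + of_real r * \<xi>)) holomorphic_on ball 0 1"
    by (rule holomorphic_on_compose_gen[of "\<lambda>\<xi>. w0 + of_real r * \<xi>", OF _ q, unfolded o_def])
      (use inb in \<open>auto intro!: holomorphic_intros\<close>)
  have hol: "f holomorphic_on ball 0 1"
    unfolding f_def by (intro holomorphic_intros qh) (use ne pos inb in auto)
  have f0: "f 0 = 0" by (simp add: f_def c_def)
  have f1: "norm (f \<xi>) < 1" if "norm \<xi> < 1" for \<xi>
    using norm_diff_less_norm_diff_cnj[OF pos[OF inb[OF that]] c] ne[OF pos[OF inb[OF that]]]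
    by (simp add: f_def norm_divide divide_less_eq)
  define \<xi> where "\<xi> = (w - w0) / of_real r"
  have \<xi>: "norm \<xi> < 1" using w r by (simp add: \<xi>_def norm_divide dist_norm norm_minus_commute)
  have wx: "w0 + of_real r * \<xi> = w" using r by (simp add: \<xi>_def)
  have "norm (f \<xi>) \<le> norm \<xi>"
    using Schwarz_Lemma(1)[OF hol f0 f1 \<xi>] .
  then show ?thesis
    using r ne[OF pos[OF w]]
    by (simp add: f_def wx norm_divide \<xi>_def field_simps c_def)
qed

text \<open>
  The difference quotients of the previous lemma at the centre of the disc.
\<close>
lemma schwarz_pick_deriv:
  assumes q: "q holomorphic_on ball w0 r" and r: "0 < r"
    and pos: "\<And>w. w \<in> ball w0 r \<Longrightarrow> 0 < Im (q w)"
  shows "norm (deriv q w0) * r \<le> 2 * Im (q w0)"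
proof -
  have w0: "w0 \<in> ball w0 r" using r by simp
  have d: "(q has_field_derivative deriv q w0) (at w0)"
    using holomorphic_derivI[OF q _ w0] by simp
  then have lim: "((\<lambda>w. (q w - q w0) / (w - w0)) \<longlongrightarrow> deriv q w0) (at w0)"
    by (simp add: has_field_derivative_iff)
  have cont: "(q \<longlongrightarrow> q w0) (at w0)"
    using DERIV_isCont[OF d] by (simp add: isCont_def)
  have "norm (deriv q w0) * r \<le> norm (q w0 - cnj (q w0))"
  proof (rule tendsto_le)
    show "((\<lambda>w. norm (q w - cnj (q w0))) \<longlongrightarrow> norm (q w0 - cnj (q w0))) (at w0)"
      by (intro tendsto_intros cont)
    show "((\<lambda>w. norm ((q w - q w0) / (w - w0)) * r) \<longlongrightarrow> norm (deriv q w0) * r) (at w0)"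
      by (intro tendsto_intros lim)
    have "eventually (\<lambda>w. w \<in> ball w0 r) (at w0)"
      using w0 by (meson eventually_at_topological open_ball)
    moreover have "eventually (\<lambda>w. w \<noteq> w0) (at w0)" by (simp add: eventually_at_filter)
    ultimately
    show "\<forall>\<^sub>F w in at w0. norm ((q w - q w0) / (w - w0)) * r \<le> norm (q w - cnj (q w0))"
    proof eventually_elim
      case (elim w)
      then show ?case using schwarz_pick_disc[OF q r pos, of w]
        by (simp add: norm_divide field_simps)
    qed
  qed simp
  also have "norm (q w0 - cnj (q w0)) = 2 * Im (q w0)"
    using pos[OF w0] by (simp add: complex_diff_cnj norm_mult)
  finally show ?thesis .
qed

lemma norm_diff_cnj_power2:
  "(norm (z - cnj w))\<^sup>2 = (norm (z - w))\<^sup>2 + 4 * Im z * Im w"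
  by (simp add: cmod_power2) (simp add: power2_eq_square algebra_simps)

lemma schwarz_pick_half_plane:
  assumes g: "g holomorphic_on upper_half_plane"
    and pos: "\<And>z. 0 < Im z \<Longrightarrow> 0 < Im (g z)"
    and z: "0 < Im z" and w: "0 < Im w"
  shows "(norm (g z - g w))\<^sup>2 * (Im z * Im w) \<le> (norm (z - w))\<^sup>2 * (Im (g z) * Im (g w))"
proof -
  \<comment> \<open>the inverse Cayley transform, from the unit disc onto the half-plane with \<open>0 \<mapsto> w\<close>\<close>
  define C where "C = (\<lambda>\<xi>. (w - cnj w * \<xi>) / (1 - \<xi>))"
  have imC: "0 < Im (C \<xi>)" if "norm \<xi> < 1" for \<xi>
  proof -
    have ne: "\<xi> \<noteq> 1" using that by auto
    define q where "q = \<xi> / (1 - \<xi>)"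
    have "C \<xi> = w + (w - cnj w) * q"
      using ne by (simp add: C_def q_def field_simps)
    then have "C \<xi> = w + 2 * \<i> * of_real (Im w) * q"
      by (simp add: complex_diff_cnj mult.commute mult.left_commute)
    then have "Im (C \<xi>) = Im w * (1 + 2 * Re q)"
      by (simp add: algebra_simps)
    moreover have "1 + 2 * Re q > 0"
    proof -
      have p: "(norm (1-\<xi>))\<^sup>2 > 0" using ne by simp
      have "(Re \<xi>)\<^sup>2 + (Im \<xi>)\<^sup>2 < 1"
        using that by (simp add: cmod_def real_less_rsqrt)
      then have *: "(norm (1-\<xi>))\<^sup>2 < 2 * (1 - Re \<xi>)"
        by (simp add: cmod_power2) (simp add: power2_eq_square algebra_simps)
      have "q = (1 / (1 - \<xi>)) - 1" using ne by (simp add: q_def field_simps)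
      then have "Re q = (1 - Re \<xi>) / (norm (1-\<xi>))\<^sup>2 - 1"
        by (simp add: Re_divide cmod_power2)
      moreover have "1 / 2 < (1 - Re \<xi>) / (norm (1-\<xi>))\<^sup>2"
        using * p by (simp only: less_divide_eq) simp
      ultimately show ?thesis by linarith
    qed
    ultimately show ?thesis using w by simp
  qed
  have Ch: "C holomorphic_on ball 0 1"
    unfolding C_def by (intro holomorphic_intros) auto
  have gC: "(\<lambda>\<xi>. g (C \<xi>)) holomorphic_on ball 0 1"
    by (rule holomorphic_on_compose_gen[OF Ch g, unfolded o_def]) (auto simp: upper_half_plane_def imC)
  define \<xi> where "\<xi> = (z - w) / (z - cnj w)"
  have ne: "z - cnj w \<noteq> 0" "w - cnj w \<noteq> 0" using z w by (auto simp: complex_eq_iff)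
  have \<xi>: "norm \<xi> < 1"
    using norm_diff_less_norm_diff_cnj[OF z w] ne by (simp add: \<xi>_def norm_divide)
  have C0: "C 0 = w" by (simp add: C_def)
  have "1 - \<xi> = (w - cnj w) / (z - cnj w)" "w - cnj w * \<xi> = (w - cnj w) * z / (z - cnj w)"
    using ne by (simp_all add: \<xi>_def field_simps)
  then have C\<xi>: "C \<xi> = z" using ne by (simp add: C_def)
  have "norm (g (C \<xi>) - g (C 0)) * 1 \<le> norm (\<xi> - 0) * norm (g (C \<xi>) - cnj (g (C 0)))"
    by (rule schwarz_pick_disc[OF gC]) (use pos imC \<xi> in auto)
  then have "norm (g z - g w) * norm (z - cnj w) \<le> norm (z - w) * norm (g z - cnj (g w))"
    using ne unfolding C0 C\<xi> by (simp add: \<xi>_def norm_divide field_simps)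
  then have "(norm (g z - g w) * norm (z - cnj w))\<^sup>2 \<le> (norm (z - w) * norm (g z - cnj (g w)))\<^sup>2"
    by (rule power_mono) simp
  then have "(norm (g z - g w))\<^sup>2 * (4 * (Im z * Im w)) \<le> (norm (z - w))\<^sup>2 * (4 * (Im (g z) * Im (g w)))"
    by (simp add: power_mult_distrib norm_diff_cnj_power2) (simp add: algebra_simps)
  then show ?thesis by simp
qed

text \<open>
  A form of Julia's lemma at infinity.  Divide the Schwarz-Pick inequality for the pair \<open>z\<close>,
  \<open>zs n\<close> by \<open>\<bar>zs n\<bar>\<^sup>2 Im (zs n)\<close>.  Both quotients \<open>\<bar>g z - g (zs n)\<bar> / \<bar>zs n\<bar>\<close> and
  \<open>\<bar>z - zs n\<bar> / \<bar>zs n\<bar>\<close> tend to \<open>1\<close>, and the limit is the claim: \<open>g\<close> maps every horocycle at infinity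
  into itself.  The sequence may approach infinity tangentially.
\<close>
lemma Im_le_Im_if_asymptotic_identity:
  fixes zs :: "nat \<Rightarrow> complex"
  assumes g: "g holomorphic_on upper_half_plane"
    and pos: "\<And>z. 0 < Im z \<Longrightarrow> 0 < Im (g z)"
    and zs: "\<And>n. 0 < Im (zs n)" and inf: "filterlim zs at_infinity sequentially"
    and lim: "(\<lambda>n. norm (g (zs n) - zs n) / Im (zs n)) \<longlonglongrightarrow> 0"
    and z: "0 < Im z"
  shows "Im z \<le> Im (g z)"
proof -
  have inv0: "(\<lambda>n. c / zs n) \<longlonglongrightarrow> 0" for c
    by (rule tendsto_divide_0[OF tendsto_const inf])
  have nz: "zs n \<noteq> 0" for n using zs[of n] by auto
  have l1: "(\<lambda>n. (g (zs n) - zs n) / zs n) \<longlonglongrightarrow> 0"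
  proof (rule Lim_null_comparison[OF _ lim], rule always_eventually, rule allI)
    fix n
    have "norm ((g (zs n) - zs n) / zs n) = norm (g (zs n) - zs n) / norm (zs n)"
      by (simp add: norm_divide)
    also have "\<dots> \<le> norm (g (zs n) - zs n) / Im (zs n)"
      by (rule divide_left_mono) (use zs[of n] abs_Im_le_cmod[of "zs n"] nz[of n] in auto)
    finally show "norm ((g (zs n) - zs n) / zs n) \<le> norm (g (zs n) - zs n) / Im (zs n)" .
  qed
  have l2: "(\<lambda>n. Im (g (zs n)) / Im (zs n)) \<longlonglongrightarrow> 1"
  proof -
    have "(\<lambda>n. Im (g (zs n)) / Im (zs n) - 1) \<longlonglongrightarrow> 0"
    proof (rule Lim_null_comparison[OF _ lim], rule always_eventually, rule allI)
      fix n
      have "norm (Im (g (zs n)) / Im (zs n) - 1) = \<bar>Im (g (zs n) - zs n)\<bar> / Im (zs n)"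
        using zs[of n] by (simp add: field_simps abs_if)
      also have "\<dots> \<le> norm (g (zs n) - zs n) / Im (zs n)"
        by (rule divide_right_mono) (use zs[of n] abs_Im_le_cmod[of "g (zs n) - zs n"] in auto)
      finally show "norm (Im (g (zs n)) / Im (zs n) - 1) \<le> norm (g (zs n) - zs n) / Im (zs n)" .
    qed
    then show ?thesis by (simp add: LIM_zero_cancel)
  qed
  have "Im z * (norm (0 - (0 + 1)::complex))\<^sup>2 \<le> (norm (0 - 1::complex))\<^sup>2 * Im (g z) * 1"
  proof (rule LIMSEQ_le)
    show "(\<lambda>n. Im z * (norm (g z / zs n - ((g (zs n) - zs n) / zs n + 1)))\<^sup>2) \<longlonglongrightarrow>
        Im z * (norm (0 - (0 + 1)::complex))\<^sup>2"
      by (intro tendsto_intros inv0 l1)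
    show "(\<lambda>n. (norm (z / zs n - 1))\<^sup>2 * Im (g z) * (Im (g (zs n)) / Im (zs n))) \<longlonglongrightarrow>
        (norm (0 - 1::complex))\<^sup>2 * Im (g z) * 1"
      by (intro tendsto_intros inv0 l2)
    have "Im z * (norm (g z / zs n - ((g (zs n) - zs n) / zs n + 1)))\<^sup>2 \<le>
        (norm (z / zs n - 1))\<^sup>2 * Im (g z) * (Im (g (zs n)) / Im (zs n))" for n
    proof -
      have e1: "g z / zs n - ((g (zs n) - zs n) / zs n + 1) = (g z - g (zs n)) / zs n"
        using nz[of n] by (simp add: field_simps)
      have e2: "z / zs n - 1 = (z - zs n) / zs n"
        using nz[of n] by (simp add: field_simps)
      show ?thesis
        using schwarz_pick_half_plane[OF g pos z zs[of n]] nz[of n] zs[of n]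
        unfolding e1 e2 by (simp add: norm_divide power_divide field_simps)
    qed
    then show "\<exists>N. \<forall>n\<ge>N. Im z * (norm (g z / zs n - ((g (zs n) - zs n) / zs n + 1)))\<^sup>2 \<le>
        (norm (z / zs n - 1))\<^sup>2 * Im (g z) * (Im (g (zs n)) / Im (zs n))" by blast
  qed
  then show ?thesis by simp
qed

section \<open>The region above a Lipschitz graph and its conformal map\<close>

locale lipschitz_graph =
  fixes a :: "real \<Rightarrow> real" and M :: real
  assumes M_pos: "0 < M"
    and lipschitz: "\<And>u1 u2. \<bar>a u1 - a u2\<bar> \<le> M * \<bar>u1 - u2\<bar>"
begin

lemma mem_region: "w \<in> region_above a \<longleftrightarrow> a (Re w) < Im w"
  by (simp add: region_above_def)

lemma continuous_on_a [continuous_intros]: "continuous_on S f \<Longrightarrow> continuous_on S (\<lambda>x. a (f x))"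
proof (rule continuous_on_compose2[of UNIV a])
  have "M-lipschitz_on UNIV a"
    using M_pos lipschitz by (intro lipschitz_onI) (auto simp: dist_real_def)
  then show "continuous_on UNIV a" by (rule lipschitz_on_continuous_on)
qed auto

lemma borel_measurable_a [measurable]: "a \<in> borel_measurable borel"
  by (rule borel_measurable_continuous_onI) (intro continuous_intros)

lemma open_region: "open (region_above a)"
  unfolding region_above_def by (intro open_Collect_less continuous_intros)

lemma closure_region: "closure (region_above a) = {w. a (Re w) \<le> Im w}"
proof
  have "closed {w. a (Re w) \<le> Im w}"
    by (intro closed_Collect_le continuous_intros)
  then show "closure (region_above a) \<subseteq> {w. a (Re w) \<le> Im w}"
    by (rule closure_minimal[rotated]) (auto simp: region_above_def)
  show "{w. a (Re w) \<le> Im w} \<subseteq> closure (region_above a)"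
  proof
    fix w assume w: "w \<in> {w. a (Re w) \<le> Im w}"
    show "w \<in> closure (region_above a)"
      unfolding closure_approachable
    proof (intro allI impI)
      fix e :: real assume "0 < e"
      then show "\<exists>y\<in>region_above a. dist y w < e"
        using w by (intro bexI[of _ "w + \<i> * of_real (e/2)"]) (auto simp: dist_norm norm_mult region_above_def)
    qed
  qed
qed

lemma region_add_cone:
  assumes "a (Re w) < Im w" "M * \<bar>Re e\<bar> \<le> Im e"
  shows "a (Re (w + e)) < Im (w + e)"
  using assms lipschitz[of "Re (w + e)" "Re w"] by auto

lemma ball_subset_region:
  assumes "r * (1 + M) \<le> Im w - a (Re w)"
  shows "ball w r \<subseteq> region_above a"
proof
  fix v assume "v \<in> ball w r"
  then have d: "norm (v - w) < r" by (simp add: dist_norm norm_minus_commute)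
  have "\<bar>Re v - Re w\<bar> \<le> norm (v - w)" "\<bar>Im v - Im w\<bar> \<le> norm (v - w)"
    using abs_Re_le_cmod[of "v - w"] abs_Im_le_cmod[of "v - w"] by auto
  moreover have "\<bar>a (Re v) - a (Re w)\<bar> \<le> M * norm (v - w)"
    using lipschitz[of "Re v" "Re w"] calculation(1) M_pos
    by (meson mult_left_mono order_trans less_imp_le)
  moreover have "norm (v - w) * (1 + M) < r * (1 + M)"
    using d M_pos by simp
  ultimately have "a (Re v) < Im v"
    using assms by (simp add: algebra_simps)
  then show "v \<in> region_above a" by (simp add: mem_region)
qed

end

lemma upper_half_plane_eq: "upper_half_plane = region_above (\<lambda>_. 0)"
  by (simp add: upper_half_plane_def region_above_def)

interpretation flat: lipschitz_graph "\<lambda>_. 0" 1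
  by unfold_locales auto

lemma open_upper_half_plane: "open upper_half_plane"
  unfolding upper_half_plane_eq by (rule flat.open_region)

lemma closure_upper_half_plane: "closure upper_half_plane = {z. 0 \<le> Im z}"
  unfolding upper_half_plane_eq by (rule flat.closure_region)

lemma mem_upper_half_plane: "z \<in> upper_half_plane \<longleftrightarrow> 0 < Im z"
  by (simp add: upper_half_plane_def)

locale graph_conformal = lipschitz_graph +
  fixes \<Phi> :: "complex \<Rightarrow> complex"
  assumes holo: "\<Phi> holomorphic_on upper_half_plane"
    and conformal: "bij_betw \<Phi> upper_half_plane (region_above a)"
    and homeo: "\<exists>\<Psi>. homeomorphism (closure upper_half_plane) (closure (region_above a)) \<Phi> \<Psi>"
    and boundary: "(\<lambda>x. \<Phi> (complex_of_real x)) ` UNIV = graph_curve a"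
    and increasing: "strict_mono (\<lambda>x. Re (\<Phi> (complex_of_real x)))"
begin

definition \<Psi> :: "complex \<Rightarrow> complex" where
  "\<Psi> = (SOME \<Psi>. homeomorphism (closure upper_half_plane) (closure (region_above a)) \<Phi> \<Psi>)"

lemma homeomorphism_\<Psi>:
  "homeomorphism {z. 0 \<le> Im z} {w. a (Re w) \<le> Im w} \<Phi> \<Psi>"
  using someI_ex[OF homeo] unfolding \<Psi>_def closure_region closure_upper_half_plane .

lemma \<Psi>_\<Phi>: "0 \<le> Im z \<Longrightarrow> \<Psi> (\<Phi> z) = z"
  using homeomorphism_\<Psi> by (auto simp: homeomorphism_def)

lemma \<Phi>_\<Psi>: "a (Re w) \<le> Im w \<Longrightarrow> \<Phi> (\<Psi> w) = w"
  using homeomorphism_\<Psi> by (auto simp: homeomorphism_def)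

lemma continuous_on_\<Psi>: "continuous_on {w. a (Re w) \<le> Im w} \<Psi>"
  using homeomorphism_\<Psi> by (auto simp: homeomorphism_def)

lemma continuous_on_\<Phi>: "continuous_on {z. 0 \<le> Im z} \<Phi>"
  using homeomorphism_\<Psi> by (auto simp: homeomorphism_def)

lemma \<Phi>_region: "0 < Im z \<Longrightarrow> a (Re (\<Phi> z)) < Im (\<Phi> z)"
  using conformal by (auto simp: bij_betw_def upper_half_plane_def region_above_def)

lemma Im_\<Psi>_pos: 
  assumes "a (Re w) < Im w" shows "0 < Im (\<Psi> w)"
proof -
  have "w \<in> \<Phi> ` upper_half_plane"
    using conformal assms by (auto simp: bij_betw_def region_above_def)
  then show ?thesis using \<Psi>_\<Phi> by (auto simp: upper_half_plane_def)
qed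

lemma \<Phi>_of_real: "\<Phi> (of_real x) = Complex (Re (\<Phi> (of_real x))) (a (Re (\<Phi> (of_real x))))"
proof -
  have "\<Phi> (of_real x) \<in> graph_curve a" using boundary by auto
  then show ?thesis by (auto simp: graph_curve_def)
qed

lemma \<Psi>_graph:
  obtains x where "\<Psi> (Complex u (a u)) = of_real x" "\<Phi> (of_real x) = Complex u (a u)"
proof -
  have "Complex u (a u) \<in> range (\<lambda>x. \<Phi> (complex_of_real x))"
    unfolding boundary by (auto simp: graph_curve_def)
  then obtain x where "\<Phi> (of_real x) = Complex u (a u)" by auto
  moreover from this have "\<Psi> (Complex u (a u)) = of_real x"
    using \<Psi>_\<Phi>[of "of_real x"] by simp
  ultimately show ?thesis using that by blast
qed

lemma \<Psi>_holomorphic: "\<Psi> holomorphic_on region_above a"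
  and deriv_\<Psi>_mult: "\<And>z. 0 < Im z \<Longrightarrow> deriv \<Phi> z * deriv \<Psi> (\<Phi> z) = 1"
proof -
  have inj: "inj_on \<Phi> upper_half_plane" and im: "\<Phi> ` upper_half_plane = region_above a"
    using conformal by (auto simp: bij_betw_def)
  obtain g where g: "g holomorphic_on \<Phi> ` upper_half_plane"
      "\<And>z. z \<in> upper_half_plane \<Longrightarrow> deriv \<Phi> z * deriv g (\<Phi> z) = 1"
      "\<And>z. z \<in> upper_half_plane \<Longrightarrow> g (\<Phi> z) = z"
    using holomorphic_has_inverse[OF holo open_upper_half_plane inj] by blast
  have eq: "g w = \<Psi> w" if wr: "w \<in> region_above a" for w
  proof -
    obtain z where "z \<in> upper_half_plane" "w = \<Phi> z" using wr unfolding im[symmetric] by blast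
    then show ?thesis using g(3)[of z] \<Psi>_\<Phi>[of z] by (auto simp: upper_half_plane_def)
  qed
  show "\<Psi> holomorphic_on region_above a"
    using g(1) eq unfolding im by (simp cong: holomorphic_cong)
  show "deriv \<Phi> z * deriv \<Psi> (\<Phi> z) = 1" if "0 < Im z" for z
  proof -
    have z: "z \<in> upper_half_plane" using that by (simp add: upper_half_plane_def)
    then have "\<Phi> z \<in> region_above a" using im by auto
    then have "eventually (\<lambda>w. g w = \<Psi> w) (nhds (\<Phi> z))"
      using eq open_region by (auto simp: eventually_nhds)
    then have "deriv g (\<Phi> z) = deriv \<Psi> (\<Phi> z)" by (rule deriv_cong_ev) simp
    then show ?thesis using g(2)[OF z] by simp
  qed
qed

lemma deriv_\<Phi>_\<Psi>: "a (Re w) < Im w \<Longrightarrow> deriv \<Phi> (\<Psi> w) * deriv \<Psi> w = 1"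
  using deriv_\<Psi>_mult[OF Im_\<Psi>_pos] \<Phi>_\<Psi> by simp

text \<open>
  A bounded part of the closed half-plane is compact, so its image under \<open>\<Phi>\<close> is bounded.
\<close>
lemma \<Psi>_tends_to_infinity:
  assumes "filterlim ws at_infinity sequentially" and ws: "\<And>n. a (Re (ws n)) < Im (ws n)"
  shows "filterlim (\<lambda>n. \<Psi> (ws n)) at_infinity sequentially"
  unfolding filterlim_at_infinity[OF order_refl]
proof (intro allI impI)
  fix r :: real assume "0 < r"
  define K where "K = {z. 0 \<le> Im z} \<inter> cball (0::complex) r"
  have "closed {z. 0 \<le> Im z}" by (intro closed_Collect_le continuous_intros)
  then have "compact K"
    unfolding K_def by (simp add: closed_Int_compact)
  moreover have "continuous_on K \<Phi>"
    by (rule continuous_on_subset[OF continuous_on_\<Phi>]) (auto simp: K_def)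
  ultimately have "bounded (\<Phi> ` K)"
    by (simp add: compact_continuous_image compact_imp_bounded)
  then obtain B where B: "\<And>z. z \<in> K \<Longrightarrow> norm (\<Phi> z) \<le> B"
    by (auto simp: bounded_iff)
  have "eventually (\<lambda>n. max 1 (B + 1) \<le> norm (ws n)) sequentially"
    using assms(1) unfolding filterlim_at_infinity[OF order_refl] by (auto simp del: max.bounded_iff)
  then show "eventually (\<lambda>n. r \<le> norm (\<Psi> (ws n))) sequentially"
  proof eventually_elim
    case (elim n)
    show ?case
    proof (rule ccontr)
      assume "\<not> r \<le> norm (\<Psi> (ws n))"
      then have "\<Psi> (ws n) \<in> K" using Im_\<Psi>_pos[OF ws[of n]] by (auto simp: K_def)
      from B[OF this] show False using elim \<Phi>_\<Psi>[of "ws n"] ws[of n] by simp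
    qed
  qed
qed

text \<open>
  The monotonicity of \<open>h = Im \<Psi>\<close> in all directions of the cone.  The translation by \<open>e\<close> moves the
  points \<open>ws n\<close>, which run up the imaginary axis, by a distance that is negligible against their
  distance to the boundary; by Schwarz-Pick on large discs the conjugated map \<open>g\<close> is therefore
  asymptotic to the identity along \<open>zs\<close>, and the horocycle lemma applies.
\<close>
lemma Im_\<Psi>_mono:
  assumes w: "a (Re w) < Im w" and e: "M * \<bar>Re e\<bar> \<le> Im e"
  shows "Im (\<Psi> w) \<le> Im (\<Psi> (w + e))"
proof -
  define g where "g = (\<lambda>z. \<Psi> (\<Phi> z + e))"
  have region: "a (Re (\<Phi> z + e)) < Im (\<Phi> z + e)" if "0 < Im z" for z
    using region_add_cone[OF \<Phi>_region[OF that] e] .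
  have gh: "g holomorphic_on upper_half_plane"
    unfolding g_def
    by (rule holomorphic_on_compose_gen[OF _ \<Psi>_holomorphic, unfolded o_def])
      (auto intro!: holomorphic_intros holo region simp: mem_region mem_upper_half_plane simp del: plus_complex.sel)
  have gpos: "0 < Im (g z)" if "0 < Im z" for z
    unfolding g_def using Im_\<Psi>_pos[OF region[OF that]] .
  define ws where "ws = (\<lambda>n. Complex 0 (a 0 + 1 + real n))"
  have wsr: "a (Re (ws n)) < Im (ws n)" for n by (simp add: ws_def)
  have inf: "filterlim ws at_infinity sequentially"
    unfolding filterlim_at_infinity[OF order_refl]
  proof (intro allI impI)
    fix r :: real
    obtain N where N: "r + \<bar>a 0\<bar> \<le> real N" using real_arch_simple by blast
    have "r \<le> norm (ws n)" if "N \<le> n" for n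
    proof -
      have "r \<le> Im (ws n)" using N that by (simp add: ws_def)
      also have "\<dots> \<le> norm (ws n)" by (rule order_trans[OF abs_ge_self abs_Im_le_cmod])
      finally show ?thesis .
    qed
    then show "\<forall>\<^sub>F n in sequentially. r \<le> norm (ws n)" by (auto simp: eventually_sequentially)
  qed
  define zs where "zs = (\<lambda>n. \<Psi> (ws n))"
  have zs_inf: "filterlim zs at_infinity sequentially"
    unfolding zs_def by (rule \<Psi>_tends_to_infinity[OF inf wsr])
  have zs_pos: "0 < Im (zs n)" for n unfolding zs_def using Im_\<Psi>_pos[OF wsr] .
  have lim: "(\<lambda>n. norm (g (zs n) - zs n) / Im (zs n)) \<longlonglongrightarrow> 0"
  proof (rule Lim_null_comparison)
    show "(\<lambda>n. 4 * norm e * (1 + M) * inverse (real (Suc n))) \<longlonglongrightarrow> 0"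
      by (rule tendsto_mult_right_zero[OF LIMSEQ_inverse_real_of_nat])
    obtain N where N: "2 * norm e * (1 + M) \<le> real N" using real_arch_simple by blast
    have "eventually (\<lambda>n. 2 * norm e * (1 + M) < real (Suc n)) sequentially"
      using N by (auto simp: eventually_sequentially intro!: exI[of _ N])
    then show "\<forall>\<^sub>F n in sequentially. norm (norm (g (zs n) - zs n) / Im (zs n))
        \<le> 4 * norm e * (1 + M) * inverse (real (Suc n))"
    proof eventually_elim
      case (elim n)
      define r where "r = real (Suc n) / (1 + M)"
      have r: "0 < r" "2 * norm e < r" using elim M_pos by (simp_all add: r_def field_simps)
      have sub: "ball (ws n) r \<subseteq> region_above a"
        by (rule ball_subset_region) (use M_pos in \<open>simp add: r_def ws_def\<close>)
      have "norm (\<Psi> (ws n + e) - \<Psi> (ws n)) * r \<le> norm (ws n + e - ws n) * norm (\<Psi> (ws n + e) - cnj (\<Psi> (ws n)))"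
      proof (rule schwarz_pick_disc)
        show "\<Psi> holomorphic_on ball (ws n) r" using holomorphic_on_subset[OF \<Psi>_holomorphic sub] .
        show "0 < Im (\<Psi> w)" if "w \<in> ball (ws n) r" for w
          using sub that Im_\<Psi>_pos by (auto simp: mem_region)
        show "ws n + e \<in> ball (ws n) r"
          using r(2) norm_ge_zero[of e] by (simp add: dist_norm del: norm_ge_zero)
      qed (use r in auto)
      moreover have "\<Psi> (ws n + e) = g (zs n)"
        using wsr[of n] by (simp add: g_def zs_def \<Phi>_\<Psi>)
      ultimately have 1: "norm (g (zs n) - zs n) * r \<le> norm e * norm (g (zs n) - cnj (zs n))"
        by (simp add: zs_def)
      have "norm (g (zs n) - cnj (zs n)) \<le> norm (g (zs n) - zs n) + norm (zs n - cnj (zs n))"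
        using norm_triangle_ineq[of "g (zs n) - zs n" "zs n - cnj (zs n)"] by simp
      also have "norm (zs n - cnj (zs n)) = 2 * Im (zs n)"
        using zs_pos[of n] by (simp add: complex_diff_cnj norm_mult)
      finally have "norm (g (zs n) - zs n) * r \<le> norm e * (norm (g (zs n) - zs n) + 2 * Im (zs n))"
        using 1 by (meson mult_left_mono norm_ge_zero order_trans)
      moreover have "norm (g (zs n) - zs n) * (2 * norm e) \<le> norm (g (zs n) - zs n) * r"
        using r by (intro mult_left_mono) auto
      ultimately have "norm (g (zs n) - zs n) * r \<le> 4 * norm e * Im (zs n)"
        by (simp add: algebra_simps)
      then show ?case
        using zs_pos[of n] r M_pos by (simp add: r_def field_simps del: of_nat_Suc)
    qed
  qed
  have "Im (\<Psi> w) \<le> Im (g (\<Psi> w))"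
    by (rule Im_le_Im_if_asymptotic_identity[OF gh gpos zs_pos zs_inf lim Im_\<Psi>_pos[OF w]])
  then show ?thesis using w by (simp add: g_def \<Phi>_\<Psi>)
qed

text \<open>
  The derivative of \<open>Im \<Psi>\<close> in the two extreme directions \<open>\<plusminus>1 + i M\<close> of the cone is nonnegative.
\<close>
lemma deriv_\<Psi>_cone:
  assumes w: "a (Re w) < Im w"
  shows "\<bar>Im (deriv \<Psi> w)\<bar> \<le> M * Re (deriv \<Psi> w)"
proof -
  define D where "D = deriv \<Psi> w"
  have D: "(\<Psi> has_field_derivative D) (at w)"
    unfolding D_def using holomorphic_derivI[OF \<Psi>_holomorphic open_region] w by (simp add: mem_region)
  have pos: "0 \<le> Im (D * e)" if e: "M * \<bar>Re e\<bar> \<le> Im e" for e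
  proof (rule ccontr)
    assume neg: "\<not> 0 \<le> Im (D * e)"
    have "((\<lambda>t::real. \<Psi> (w + of_real t * e)) has_vector_derivative (e * D)) (at 0)"
    proof (rule field_vector_diff_chain_at[of "\<lambda>t. w + of_real t * e" e 0 \<Psi> D, unfolded o_def])
      show "((\<lambda>t. w + of_real t * e) has_vector_derivative e) (at 0)"
        by (auto intro!: derivative_eq_intros)
    qed (use D in simp)
    then have "((\<lambda>t. Im (\<Psi> (w + of_real t * e))) has_vector_derivative Im (e * D)) (at 0)"
      by (rule bounded_linear.has_vector_derivative[OF bounded_linear_Im])
    then have "((\<lambda>t. Im (\<Psi> (w + of_real t * e))) has_real_derivative Im (D * e)) (at 0)"
      by (simp add: has_real_derivative_iff_has_vector_derivative mult.commute)
    from DERIV_neg_dec_right[OF this] neg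
    obtain d where d: "d > 0" "\<And>h. 0 < h \<Longrightarrow> h < d \<Longrightarrow> Im (\<Psi> (w + of_real h * e)) < Im (\<Psi> w)"
      by auto
    have "M * \<bar>Re (of_real (d/2) * e)\<bar> \<le> Im (of_real (d/2) * e)"
      using e d(1) by (simp add: abs_mult field_simps)
    from Im_\<Psi>_mono[OF w this] d(2)[of "d/2"] d(1) show False by auto
  qed
  have "0 \<le> Im (D * Complex 1 M)" "0 \<le> Im (D * Complex (-1) M)"
    by (rule pos; simp)+
  then show ?thesis unfolding D_def[symmetric] by (simp add: mult.commute abs_le_iff)
qed

lemma Re_deriv_\<Psi>_pos:
  assumes w: "a (Re w) < Im w"
  shows "0 < Re (deriv \<Psi> w)"
proof (rule ccontr)
  assume "\<not> 0 < Re (deriv \<Psi> w)"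
  moreover have "0 \<le> M * Re (deriv \<Psi> w)" using deriv_\<Psi>_cone[OF w] by linarith
  ultimately have "Re (deriv \<Psi> w) = 0" using M_pos by (simp add: zero_le_mult_iff)
  moreover from this have "Im (deriv \<Psi> w) = 0" using deriv_\<Psi>_cone[OF w] by simp
  ultimately have "deriv \<Psi> w = 0" by (simp add: complex_eq_iff)
  then show False using deriv_\<Phi>_\<Psi>[OF w] by simp
qed

lemma deriv_\<Phi>_eq: "0 < Im z \<Longrightarrow> deriv \<Phi> z = inverse (deriv \<Psi> (\<Phi> z))"
  using deriv_\<Psi>_mult[of z] by (metis inverse_unique mult.commute)

lemma Re_deriv_\<Phi>_pos:
  assumes "0 < Im z"
  shows "0 < Re (deriv \<Phi> z)"
  using Re_deriv_\<Psi>_pos[OF \<Phi>_region[OF assms]] deriv_\<Phi>_eq[OF assms]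
  by (simp add: add_pos_nonneg)

lemma deriv_\<Phi>_cone:
  assumes "0 < Im z"
  shows "\<bar>Im (deriv \<Phi> z)\<bar> \<le> M * Re (deriv \<Phi> z)"
  using deriv_\<Psi>_cone[OF \<Phi>_region[OF assms]] deriv_\<Phi>_eq[OF assms]
  by (simp add: divide_right_mono)

lemma norm_deriv_\<Phi>_le:
  assumes "0 < Im z"
  shows "norm (deriv \<Phi> z) \<le> (1 + M) * Re (deriv \<Phi> z)"
  using cmod_le[of "deriv \<Phi> z"] deriv_\<Phi>_cone[OF assms] Re_deriv_\<Phi>_pos[OF assms]
  by (simp add: algebra_simps)

end

section \<open>Measurability and integration on the line\<close>

abbreviation line_integral :: "real \<Rightarrow> (complex \<Rightarrow> complex) \<Rightarrow> real \<Rightarrow> ennreal" where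
  "line_integral p f y \<equiv> (\<integral>\<^sup>+x. ennreal (norm (f (Complex x y)) powr p) \<partial>lborel)"

text \<open>
  The measure is \<open>du\<close>, not arc length: on a Lipschitz graph the two are comparable, and \<open>du\<close> is
  the more convenient one in every estimate.
\<close>
abbreviation graph_integral ::
    "real \<Rightarrow> (real \<Rightarrow> real) \<Rightarrow> (complex \<Rightarrow> complex) \<Rightarrow> real \<Rightarrow> ennreal" where
  "graph_integral p a F \<tau> \<equiv> (\<integral>\<^sup>+u. ennreal (norm (F (Complex u (a u + \<tau>))) powr p) \<partial>lborel)"

abbreviation arc_integral ::
    "real \<Rightarrow> (real \<Rightarrow> real) \<Rightarrow> (complex \<Rightarrow> complex) \<Rightarrow> real \<Rightarrow> ennreal" where
  "arc_integral p a F \<tau> \<equiv>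
    (\<integral>\<^sup>+\<zeta>. ennreal (norm (F (\<zeta> + \<i> * of_real \<tau>)) powr p) \<partial>arc_length_measure a)"

lemma norm_powr_of_real:
  fixes z :: complex
  assumes "z \<noteq> 0"
  shows "norm (z powr of_real r) = norm z powr r"
  using assms by (simp add: powr_def norm_exp_eq_Re)

lemma borel_measurable_holomorphic_zero_outside:
  fixes F :: "complex \<Rightarrow> complex"
  assumes "F holomorphic_on S" "open S" "\<And>z. z \<notin> S \<Longrightarrow> F z = 0"
  shows "F \<in> borel_measurable borel"
proof -
  have "(\<lambda>z. indicator S z *\<^sub>R F z) \<in> borel_measurable borel"
    by (rule borel_measurable_continuous_on_indicator)
      (use assms in \<open>auto intro: holomorphic_on_imp_continuous_on\<close>)
  also have "(\<lambda>z. indicator S z *\<^sub>R F z) = F"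
    using assms(3) by (auto simp: indicator_def fun_eq_iff)
  finally show ?thesis .
qed

lemma borel_measurable_Complex [measurable (raw)]:
  assumes [measurable]: "f \<in> borel_measurable N" "g \<in> borel_measurable N"
  shows "(\<lambda>x. Complex (f x) (g x)) \<in> borel_measurable N"
  unfolding Complex_eq by measurable

lemma nn_integral_continuous_interval:
  fixes f :: "real \<Rightarrow> real"
  assumes "continuous_on {a..b} f" and nn: "\<And>x. x \<in> {a..b} \<Longrightarrow> 0 \<le> f x"
  shows "(\<integral>\<^sup>+x. ennreal (f x) * indicator {a..b} x \<partial>lborel) = ennreal (integral {a..b} f)"
proof -
  have si: "set_integrable lborel {a..b} f"
    by (rule borel_integrable_atLeastAtMost'[OF assms(1)])
  have "(\<integral>\<^sup>+x. ennreal (f x) * indicator {a..b} x \<partial>lborel) =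
      (\<integral>\<^sup>+x. ennreal (indicator {a..b} x *\<^sub>R f x) \<partial>lborel)"
    by (intro nn_integral_cong) (auto simp: indicator_def)
  also have "\<dots> = ennreal (\<integral>x. indicator {a..b} x *\<^sub>R f x \<partial>lborel)"
    by (rule nn_integral_eq_integral)
      (use si nn in \<open>auto simp: set_integrable_def indicator_def\<close>)
  also have "\<dots> = ennreal (integral {a..b} f)"
    using set_borel_integral_eq_integral(2)[OF si] by (simp add: set_lebesgue_integral_def)
  finally show ?thesis .
qed

lemma nn_integral_intervals_LIMSEQ:
  fixes h :: "real \<Rightarrow> ennreal"
  assumes [measurable]: "h \<in> borel_measurable borel"
  shows "(\<lambda>n. \<integral>\<^sup>+t. h t * indicator {-real n..real n} t \<partial>lborel) \<longlonglongrightarrow> (\<integral>\<^sup>+t. h t \<partial>lborel)"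
proof (rule nn_integral_LIMSEQ)
  show "mono (\<lambda>n t. h t * indicator {-real n..real n} t)"
    by (auto simp: mono_def le_fun_def indicator_def)
  show "(\<lambda>n. h t * indicator {-real n..real n} t) \<longlonglongrightarrow> h t" for t
  proof (rule tendsto_eventually)
    obtain n0 where "\<bar>t\<bar> \<le> real n0" using real_arch_simple by blast
    then show "\<forall>\<^sub>F n in sequentially. h t * indicator {-real n..real n} t = h t"
      by (auto simp: eventually_sequentially indicator_def intro!: exI[of _ n0])
  qed
qed simp

lemma nn_integral_le_of_intervals:
  fixes h :: "real \<Rightarrow> ennreal"
  assumes "h \<in> borel_measurable borel"
    and "\<And>n::nat. (\<integral>\<^sup>+x. h x * indicator {-real n..real n} x \<partial>lborel) \<le> C"
  shows "(\<integral>\<^sup>+x. h x \<partial>lborel) \<le> C"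
  using nn_integral_intervals_LIMSEQ[OF assms(1)] assms(2) by (meson LIMSEQ_le_const2)

lemma nn_integral_le_if_tendsto:
  fixes f :: "nat \<Rightarrow> 'a \<Rightarrow> ennreal"
  assumes [measurable]: "\<And>n. f n \<in> borel_measurable N"
    and lim: "\<And>x. x \<in> space N \<Longrightarrow> (\<lambda>n. f n x) \<longlonglongrightarrow> g x"
    and le: "\<And>n. (\<integral>\<^sup>+x. f n x \<partial>N) \<le> C"
  shows "(\<integral>\<^sup>+x. g x \<partial>N) \<le> C"
proof -
  have "(\<integral>\<^sup>+x. g x \<partial>N) = (\<integral>\<^sup>+x. liminf (\<lambda>n. f n x) \<partial>N)"
    by (intro nn_integral_cong) (metis lim lim_imp_Liminf sequentially_bot)
  also have "\<dots> \<le> liminf (\<lambda>n. \<integral>\<^sup>+x. f n x \<partial>N)"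
    by (rule nn_integral_liminf) measurable
  also have "\<dots> \<le> C"
    by (rule Liminf_le[OF _ always_eventually]) (use le in auto)
  finally show ?thesis .
qed

section \<open>The mean value inequality over squares\<close>

lemma contour_integral_rectpath:
  fixes f :: "complex \<Rightarrow> complex"
  assumes "continuous_on (path_image (rectpath a1 a3)) f"
  shows "contour_integral (rectpath a1 a3) f =
    contour_integral (linepath a1 (Complex (Re a3) (Im a1))) f +
    contour_integral (linepath (Complex (Re a3) (Im a1)) a3) f +
    contour_integral (linepath a3 (Complex (Re a1) (Im a3))) f +
    contour_integral (linepath (Complex (Re a1) (Im a3)) a1) f"
proof -
  have sub: "closed_segment a1 (Complex (Re a3) (Im a1)) \<subseteq> path_image (rectpath a1 a3)"
    "closed_segment (Complex (Re a3) (Im a1)) a3 \<subseteq> path_image (rectpath a1 a3)"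
    "closed_segment a3 (Complex (Re a1) (Im a3)) \<subseteq> path_image (rectpath a1 a3)"
    "closed_segment (Complex (Re a1) (Im a3)) a1 \<subseteq> path_image (rectpath a1 a3)"
    by (auto simp: rectpath_def Let_def path_image_join)
  note [simp] = sub[THEN continuous_on_subset[OF assms], THEN contour_integrable_continuous_linepath]
  show ?thesis
    unfolding rectpath_def Let_def
    by (simp add: contour_integrable_joinI)
qed

lemma contour_integral_linepath_same_Im:
  assumes "x1 < x2"
  shows "contour_integral (linepath (Complex x1 y) (Complex x2 y)) f = integral {x1..x2} (\<lambda>x. f (Complex x y))"
proof -
  have "contour_integral (linepath (Complex x1 y) (Complex x2 y)) f =
      contour_integral (linepath (of_real x1) (of_real x2)) (\<lambda>z. f (z + \<i> * of_real y))"
    by (simp add: contour_integral_integral linepath_def Complex_eq scaleR_conv_of_real algebra_simps)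
  also have "\<dots> = integral {x1..x2} (\<lambda>x. f (of_real x + \<i> * of_real y))"
    using assms by (subst contour_integral_linepath_Reals_eq) auto
  finally show ?thesis by (simp add: Complex_eq)
qed

lemma norm_contour_integral_horizontal:
  fixes f :: "complex \<Rightarrow> complex"
  assumes "x1 < x2" "continuous_on {x1..x2} (\<lambda>x. f (Complex x y))"
    and "\<And>x. x \<in> {x1..x2} \<Longrightarrow> norm (f (Complex x y)) \<le> g x" "continuous_on {x1..x2} g"
  shows "norm (contour_integral (linepath (Complex x1 y) (Complex x2 y)) f) \<le> integral {x1..x2} g"
    and "norm (contour_integral (linepath (Complex x2 y) (Complex x1 y)) f) \<le> integral {x1..x2} g"
proof -
  have "contour_integral (linepath (Complex x1 y) (Complex x2 y)) f = integral {x1..x2} (\<lambda>x. f (Complex x y))"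
    by (rule contour_integral_linepath_same_Im[OF assms(1)])
  moreover have "norm (integral {x1..x2} (\<lambda>x. f (Complex x y))) \<le> integral {x1..x2} g"
    by (rule integral_norm_bound_integral) (use assms in \<open>auto intro: integrable_continuous_real\<close>)
  ultimately show 1: "norm (contour_integral (linepath (Complex x1 y) (Complex x2 y)) f) \<le> integral {x1..x2} g"
    by simp
  then show "norm (contour_integral (linepath (Complex x2 y) (Complex x1 y)) f) \<le> integral {x1..x2} g"
    using contour_integral_reversepath[of "linepath (Complex x1 y) (Complex x2 y)" f] by simp
qed

lemma norm_contour_integral_vertical:
  fixes f :: "complex \<Rightarrow> complex"
  assumes "y1 < y2" "continuous_on {y1..y2} (\<lambda>y. f (Complex x y))"
    and "\<And>y. y \<in> {y1..y2} \<Longrightarrow> norm (f (Complex x y)) \<le> g y" "continuous_on {y1..y2} g"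
  shows "norm (contour_integral (linepath (Complex x y1) (Complex x y2)) f) \<le> integral {y1..y2} g"
    and "norm (contour_integral (linepath (Complex x y2) (Complex x y1)) f) \<le> integral {y1..y2} g"
proof -
  have "contour_integral (linepath (Complex x y1) (Complex x y2)) f = \<i> * integral {y1..y2} (\<lambda>y. f (Complex x y))"
    by (rule contour_integral_linepath_same_Re) (use assms in auto)
  moreover have "norm (integral {y1..y2} (\<lambda>y. f (Complex x y))) \<le> integral {y1..y2} g"
    by (rule integral_norm_bound_integral) (use assms in \<open>auto intro: integrable_continuous_real\<close>)
  ultimately show 1: "norm (contour_integral (linepath (Complex x y1) (Complex x y2)) f) \<le> integral {y1..y2} g"
    by (simp add: norm_mult)
  then show "norm (contour_integral (linepath (Complex x y2) (Complex x y1)) f) \<le> integral {y1..y2} g"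
    using contour_integral_reversepath[of "linepath (Complex x y1) (Complex x y2)" f] by simp
qed

text \<open>
  For every half side \<open>s \<in> [r, 2 r]\<close>, Cauchy's formula on the boundary of the square with centre \<open>w\<close>
  bounds \<open>\<bar>F w\<bar>\<close> by the integral of \<open>\<bar>F\<bar> / s\<close> over the four sides.  Integration over \<open>s\<close> turns each side
  into a part of the area integral, by Fubini's theorem in Cartesian coordinates.
\<close>
lemma norm_le_square_mean:
  fixes F :: "complex \<Rightarrow> complex"
  assumes F: "F holomorphic_on {z. \<bar>Re z - Re w\<bar> \<le> 2 * r \<and> \<bar>Im z - Im w\<bar> \<le> 2 * r}" and r: "0 < r"
    and [measurable]: "F \<in> borel_measurable borel"
  shows "ennreal (2 * pi * r * r * norm (F w)) \<le>
    4 * (\<integral>\<^sup>+y. (\<integral>\<^sup>+x. ennreal (norm (F (Complex x y)))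
        * indicator {Re w - 2 * r..Re w + 2 * r} x \<partial>lborel) * indicator {Im w - 2 * r..Im w + 2 * r} y \<partial>lborel)"
proof -
  define u v where "u = Re w" and "v = Im w"
  define Q where "Q = {z. \<bar>Re z - u\<bar> \<le> 2 * r \<and> \<bar>Im z - v\<bar> \<le> 2 * r}"
  have Qbox: "Q = cbox (Complex (u - 2*r) (v - 2*r)) (Complex (u + 2*r) (v + 2*r))"
    by (auto simp: Q_def in_cbox_complex_iff)
  have FQ: "F holomorphic_on Q" using F by (simp add: Q_def u_def v_def)
  have contF: "continuous_on Q F" by (rule holomorphic_on_imp_continuous_on[OF FQ])
  have cH: "continuous_on A (\<lambda>x. F (Complex x y))" if "\<forall>x\<in>A. \<bar>x - u\<bar> \<le> 2*r" "\<bar>y - v\<bar> \<le> 2*r" for A y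
    by (rule continuous_on_compose2[OF contF]) (use that in \<open>auto simp: Q_def Complex_eq intro!: continuous_intros\<close>)
  have cV: "continuous_on A (\<lambda>y. F (Complex x y))" if "\<forall>y\<in>A. \<bar>y - v\<bar> \<le> 2*r" "\<bar>x - u\<bar> \<le> 2*r" for A x
    by (rule continuous_on_compose2[OF contF]) (use that in \<open>auto simp: Q_def Complex_eq intro!: continuous_intros\<close>)
  have cC: "continuous_on A (\<lambda>x. Complex x y)" "continuous_on A (\<lambda>x. Complex y x)" for A y
    unfolding Complex_eq by (intro continuous_intros)+
  define H where "H = (\<lambda>y. \<integral>\<^sup>+x. ennreal (norm (F (Complex x y))) * indicator {u-2*r..u+2*r} x \<partial>lborel)"
  define V where "V = (\<lambda>x. \<integral>\<^sup>+y. ennreal (norm (F (Complex x y))) * indicator {v-2*r..v+2*r} y \<partial>lborel)"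
  have [measurable]: "(\<lambda>(x,y). Complex x y) \<in> borel_measurable (borel \<Otimes>\<^sub>M borel)"
    unfolding borel_prod Complex_eq split_beta
    by (intro borel_measurable_continuous_onI continuous_intros)
  have [measurable]: "H \<in> borel_measurable borel" unfolding H_def by measurable
  have [measurable]: "V \<in> borel_measurable borel" unfolding V_def by measurable
  have main: "ennreal (2 * pi * r * norm (F w)) \<le> H (v - s) + V (u + s) + H (v + s) + V (u - s)"
    if s: "r \<le> s" "s \<le> 2 * r" for s
  proof -
    have s0: "0 < s" using s r by simp
    define a1 a3 where "a1 = Complex (u - s) (v - s)" and "a3 = Complex (u + s) (v + s)"
    define f where "f = (\<lambda>z. F z / (z - w))"
    define path where "path = rectpath a1 a3"
    have wbox: "w \<in> box a1 a3" using s0 by (simp add: a1_def a3_def in_box_complex_iff u_def v_def)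
    have sub: "path_image path \<subseteq> Q - {w}"
    proof -
      have "path_image path \<subseteq> cbox a1 a3 - box a1 a3"
        unfolding path_def using path_image_rectpath_cbox_minus_box[of a1 a3] s0
        by (simp add: a1_def a3_def)
      moreover have "cbox a1 a3 \<subseteq> Q"
        using s by (auto simp: a1_def a3_def Q_def in_cbox_complex_iff)
      ultimately show ?thesis using wbox by auto
    qed
    have "(f has_contour_integral (2*pi * \<i> * winding_number path w * F w)) path"
      unfolding f_def
    proof (rule Cauchy_integral_formula_convex_simple[OF _ FQ _ _ sub])
      show "convex Q" unfolding Qbox by (rule convex_box)
      show "w \<in> interior Q" using r unfolding Qbox interior_cbox by (simp add: in_box_complex_iff u_def v_def)
    qed (auto simp: path_def)
    then have ci: "contour_integral path f = 2*pi * \<i> * F w"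
      using contour_integral_unique winding_number_rectpath[OF wbox] by (simp add: path_def)
    have cf: "continuous_on (Q - {w}) f"
      unfolding f_def by (intro continuous_intros continuous_on_subset[OF contF]) auto
    let ?sw = "Complex (u-s) (v-s)" and ?se = "Complex (u+s) (v-s)"
      and ?ne = "Complex (u+s) (v+s)" and ?nw = "Complex (u-s) (v+s)"
    have split: "contour_integral path f =
        contour_integral (linepath ?sw ?se) f +
        contour_integral (linepath ?se ?ne) f +
        contour_integral (linepath ?ne ?nw) f +
        contour_integral (linepath ?nw ?sw) f"
      unfolding path_def
      by (subst contour_integral_rectpath[OF continuous_on_subset[OF cf sub[unfolded path_def]]])
        (simp add: a1_def a3_def)
    have wuv: "w = Complex u v" by (simp add: u_def v_def)
    have bound: "norm (f z) \<le> norm (F z) / s" if "s \<le> \<bar>Re z - u\<bar> \<or> s \<le> \<bar>Im z - v\<bar>" for z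
    proof -
      have "s \<le> norm (z - w)"
        using that abs_Re_le_cmod[of "z - w"] abs_Im_le_cmod[of "z - w"] by (auto simp: u_def v_def)
      then show ?thesis unfolding f_def norm_divide
        using s0 by (intro divide_left_mono mult_pos_pos) auto
    qed
    have fH: "continuous_on {u-s..u+s} (\<lambda>x. f (Complex x y))" "continuous_on {u-s..u+s} (\<lambda>x. norm (F (Complex x y)) / s)"
      if "y = v - s \<or> y = v + s" for y
      using that s s0 unfolding f_def wuv
      by (auto intro!: continuous_intros cC cH simp: complex_eq_iff)
    have fV: "continuous_on {v-s..v+s} (\<lambda>y. f (Complex x y))" "continuous_on {v-s..v+s} (\<lambda>y. norm (F (Complex x y)) / s)"
      if "x = u - s \<or> x = u + s" for x
      using that s s0 unfolding f_def wuv
      by (auto intro!: continuous_intros cC cV simp: complex_eq_iff)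
    have lt: "u - s < u + s" "v - s < v + s" using s0 by auto
    have b1: "norm (contour_integral (linepath ?sw ?se) f)
        \<le> integral {u-s..u+s} (\<lambda>x. norm (F (Complex x (v-s))) / s)"
      by (rule norm_contour_integral_horizontal(1)[OF lt(1) fH(1) bound fH(2)]) (use s0 in auto)
    have b2: "norm (contour_integral (linepath ?se ?ne) f)
        \<le> integral {v-s..v+s} (\<lambda>y. norm (F (Complex (u+s) y)) / s)"
      by (rule norm_contour_integral_vertical(1)[OF lt(2) fV(1) bound fV(2)]) (use s0 in auto)
    have b3: "norm (contour_integral (linepath ?ne ?nw) f)
        \<le> integral {u-s..u+s} (\<lambda>x. norm (F (Complex x (v+s))) / s)"
      by (rule norm_contour_integral_horizontal(2)[OF lt(1) fH(1) bound fH(2)]) (use s0 in auto)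
    have b4: "norm (contour_integral (linepath ?nw ?sw) f)
        \<le> integral {v-s..v+s} (\<lambda>y. norm (F (Complex (u-s) y)) / s)"
      by (rule norm_contour_integral_vertical(2)[OF lt(2) fV(1) bound fV(2)]) (use s0 in auto)
    have iH: "ennreal (integral {u-s..u+s} (\<lambda>x. norm (F (Complex x y)) / s) * s) \<le> H y"
      if "y = v - s \<or> y = v + s" for y
    proof -
      have "ennreal (integral {u-s..u+s} (\<lambda>x. norm (F (Complex x y)) / s) * s) =
          ennreal (integral {u-s..u+s} (\<lambda>x. norm (F (Complex x y))))"
        using s0 by simp
      also have "\<dots> = (\<integral>\<^sup>+x. ennreal (norm (F (Complex x y))) * indicator {u-s..u+s} x \<partial>lborel)"
        by (rule nn_integral_continuous_interval[symmetric])
          (use that s in \<open>auto intro!: continuous_intros cH\<close>)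
      also have "\<dots> \<le> H y"
        unfolding H_def using s by (intro nn_integral_mono) (auto simp: indicator_def)
      finally show ?thesis .
    qed
    have iV: "ennreal (integral {v-s..v+s} (\<lambda>y. norm (F (Complex x y)) / s) * s) \<le> V x"
      if "x = u - s \<or> x = u + s" for x
    proof -
      have "ennreal (integral {v-s..v+s} (\<lambda>y. norm (F (Complex x y)) / s) * s) =
          ennreal (integral {v-s..v+s} (\<lambda>y. norm (F (Complex x y))))"
        using s0 by simp
      also have "\<dots> = (\<integral>\<^sup>+y. ennreal (norm (F (Complex x y))) * indicator {v-s..v+s} y \<partial>lborel)"
        by (rule nn_integral_continuous_interval[symmetric])
          (use that s in \<open>auto intro!: continuous_intros cV\<close>)
      also have "\<dots> \<le> V x"
        unfolding V_def using s by (intro nn_integral_mono) (auto simp: indicator_def)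
      finally show ?thesis .
    qed
    define A1 where "A1 = integral {u-s..u+s} (\<lambda>x. norm (F (Complex x (v-s))) / s)"
    define A2 where "A2 = integral {v-s..v+s} (\<lambda>y. norm (F (Complex (u+s) y)) / s)"
    define A3 where "A3 = integral {u-s..u+s} (\<lambda>x. norm (F (Complex x (v+s))) / s)"
    define A4 where "A4 = integral {v-s..v+s} (\<lambda>y. norm (F (Complex (u-s) y)) / s)"
    have Apos: "0 \<le> A1" "0 \<le> A2" "0 \<le> A3" "0 \<le> A4"
      using norm_ge_zero order_trans b1 b2 b3 b4 unfolding A1_def A2_def A3_def A4_def by blast+
    have "2 * pi * norm (F w) = norm (contour_integral path f)"
      unfolding ci by (simp add: norm_mult)
    also have "\<dots> \<le> A1 + A2 + A3 + A4"
      unfolding split A1_def A2_def A3_def A4_def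
      by (intro order_trans[OF norm_triangle_ineq] add_mono b1 b2 b3 b4)
    finally have "2 * pi * norm (F w) * s \<le> (A1 + A2 + A3 + A4) * s"
      using s0 by (intro mult_right_mono) auto
    moreover have "2 * pi * r * norm (F w) \<le> 2 * pi * norm (F w) * s"
      using s(1) mult_left_mono[OF s(1), of "2 * pi * norm (F w)"] by (simp add: mult_ac)
    ultimately have "2 * pi * r * norm (F w) \<le> (A1 + A2 + A3 + A4) * s"
      by (rule order_trans[rotated])
    then have "2 * pi * r * norm (F w) \<le> A1 * s + A2 * s + A3 * s + A4 * s"
      by (simp only: distrib_right)
    then have "ennreal (2 * pi * r * norm (F w)) \<le> ennreal (A1 * s + A2 * s + A3 * s + A4 * s)"
      by (rule ennreal_leI)
    also have "\<dots> = ennreal (A1 * s) + ennreal (A2 * s) + ennreal (A3 * s) + ennreal (A4 * s)"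
      using Apos s0 by (simp add: ennreal_plus)
    also have "\<dots> \<le> H (v - s) + V (u + s) + H (v + s) + V (u - s)"
      unfolding A1_def A2_def A3_def A4_def by (intro add_mono iH iV) auto
    finally show ?thesis .
  qed
  have shift: "(\<integral>\<^sup>+s. g (c + k * s) * indicator {r..2*r} s \<partial>lborel) \<le> (\<integral>\<^sup>+y. g y * indicator {c-2*r..c+2*r} y \<partial>lborel)"
    if [measurable]: "g \<in> borel_measurable borel" and k: "k = 1 \<or> k = -1" for g :: "real \<Rightarrow> ennreal" and c k :: real
  proof -
    have "(\<integral>\<^sup>+y. g y * indicator {c-2*r..c+2*r} y \<partial>lborel) =
        \<bar>k\<bar> * (\<integral>\<^sup>+s. g (c + k * s) * indicator {c-2*r..c+2*r} (c + k * s) \<partial>lborel)"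
      by (rule nn_integral_real_affine) (use k in auto)
    moreover have "(\<integral>\<^sup>+s. g (c + k * s) * indicator {r..2*r} s \<partial>lborel) \<le> (\<integral>\<^sup>+s. g (c + k * s) * indicator {c-2*r..c+2*r} (c + k * s) \<partial>lborel)"
      using k r by (intro nn_integral_mono) (auto simp: indicator_def)
    ultimately show ?thesis using k by auto
  qed
  define JH where "JH = (\<integral>\<^sup>+y. H y * indicator {v-2*r..v+2*r} y \<partial>lborel)"
  define JV where "JV = (\<integral>\<^sup>+x. V x * indicator {u-2*r..u+2*r} x \<partial>lborel)"
  have "JH = (\<integral>\<^sup>+y. \<integral>\<^sup>+x. ennreal (norm (F (Complex x y))) * indicator {u-2*r..u+2*r} x * indicator {v-2*r..v+2*r} y \<partial>lborel \<partial>lborel)"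
    unfolding JH_def H_def by (simp add: nn_integral_multc)
  also have "\<dots> = (\<integral>\<^sup>+x. \<integral>\<^sup>+y. ennreal (norm (F (Complex x y))) * indicator {u-2*r..u+2*r} x * indicator {v-2*r..v+2*r} y \<partial>lborel \<partial>lborel)"
    by (rule lborel_pair.Fubini') measurable
  also have "\<dots> = (\<integral>\<^sup>+x. \<integral>\<^sup>+y. ennreal (norm (F (Complex x y))) * indicator {v-2*r..v+2*r} y * indicator {u-2*r..u+2*r} x \<partial>lborel \<partial>lborel)"
    by (simp add: mult_ac)
  also have "\<dots> = JV"
    unfolding JV_def V_def by (simp add: nn_integral_multc)
  finally have JHV: "JH = JV" .
  have "ennreal (2 * pi * r * r * norm (F w)) = (\<integral>\<^sup>+s. ennreal (2 * pi * r * norm (F w)) * indicator {r..2*r} s \<partial>lborel)"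
    using r by (subst nn_integral_cmult_indicator) (auto simp: mult_ac simp flip: ennreal_mult)
  also have "\<dots> \<le> (\<integral>\<^sup>+s. (H (v + (-1) * s) * indicator {r..2*r} s + V (u + 1 * s) * indicator {r..2*r} s)
      + (H (v + 1 * s) * indicator {r..2*r} s + V (u + (-1) * s) * indicator {r..2*r} s) \<partial>lborel)"
    by (rule nn_integral_mono) (use main in \<open>auto simp: indicator_def add_ac\<close>)
  also have "\<dots> = ((\<integral>\<^sup>+s. H (v + (-1) * s) * indicator {r..2*r} s \<partial>lborel) + (\<integral>\<^sup>+s. V (u + 1 * s) * indicator {r..2*r} s \<partial>lborel))
      + ((\<integral>\<^sup>+s. H (v + 1 * s) * indicator {r..2*r} s \<partial>lborel) + (\<integral>\<^sup>+s. V (u + (-1) * s) * indicator {r..2*r} s \<partial>lborel))"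
    by (simp add: nn_integral_add)
  also have "\<dots> \<le> (JH + JV) + (JH + JV)"
    unfolding JH_def JV_def by (intro add_mono shift) auto
  also have "\<dots> = 4 * JH"
  proof -
    have "(4::ennreal) = 1 + 1 + 1 + 1" by simp
    then show ?thesis unfolding JHV by (simp only: distrib_right mult_1 add.assoc)
  qed
  finally show ?thesis by (simp add: JH_def H_def u_def v_def)
qed

lemma norm_le_1_plus_powr:
  fixes x p :: real assumes "0 \<le> x" "1 < p" shows "x \<le> 1 + x powr p"
proof (cases "x \<le> 1")
  case False
  then have "x powr 1 \<le> x powr p" using assms by (intro powr_mono) auto
  then show ?thesis using False by simp
qed (use powr_ge_zero[of x p] in linarith)

text \<open>
  The square mean value inequality together with \<open>\<bar>F\<bar> \<le> 1 + \<bar>F\<bar>\<^sup>p\<close>: a square around \<open>w\<close> lies in a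
  strip parallel to the graph, and the area integral of \<open>\<bar>F\<bar>\<^sup>p\<close> over that strip is at most its height
  times \<open>K\<close>.
\<close>
lemma (in lipschitz_graph) bounded_away_from_boundary:
  fixes F :: "complex \<Rightarrow> complex"
  assumes F: "F holomorphic_on region_above a" and [measurable]: "F \<in> borel_measurable borel"
    and p: "1 < p" and K: "\<And>\<tau>. 0 < \<tau> \<Longrightarrow> graph_integral p a F \<tau> \<le> ennreal K"
    and K0: "0 \<le> K" and \<tau>: "0 < \<tau>0"
  obtains B where "\<And>w. a (Re w) + \<tau>0 \<le> Im w \<Longrightarrow> norm (F w) \<le> B"
proof -
  \<comment> \<open>a square of half side \<open>2 r\<close> then stays at height at least \<open>\<tau>0 / 2\<close> above the graph\<close>
  define r where "r = \<tau>0 / (4 * (1 + M))"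
  have r: "0 < r" "2 * r * (1 + M) = \<tau>0 / 2" using \<tau> M_pos by (simp_all add: r_def field_simps)
  define C where "C = 4 * (16 * r * r + K * (4 * r * (1 + M))) / (2 * pi * r * r)"
  have "norm (F w) \<le> C" if w: "a (Re w) + \<tau>0 \<le> Im w" for w
  proof -
    define u v where "u = Re w" and "v = Im w"
    define d where "d = v - a u"
    have d: "\<tau>0 \<le> d" using w by (simp add: d_def u_def v_def)
    define X where "X = {u - 2 * r..u + 2 * r}"
    define Y where "Y = {v - 2 * r..v + 2 * r}"
    define I where "I = {d - 2 * r * (1 + M)..d + 2 * r * (1 + M)}"
    have [measurable]: "X \<in> sets borel" "Y \<in> sets borel" "I \<in> sets borel" by (auto simp: X_def Y_def I_def)
    have lip: "\<bar>a x - a u\<bar> \<le> M * (2 * r)" if "x \<in> X" for x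
    proof -
      have "\<bar>x - u\<bar> \<le> 2 * r" using that by (auto simp: X_def)
      then show ?thesis using lipschitz[of x u] M_pos by (meson mult_left_mono order_trans less_imp_le)
    qed
    define J where "J = (\<integral>\<^sup>+y. (\<integral>\<^sup>+x. ennreal (norm (F (Complex x y))) * indicator X x \<partial>lborel) * indicator Y y \<partial>lborel)"
    have "ennreal (2 * pi * r * r * norm (F w)) \<le> 4 * J"
      unfolding J_def X_def Y_def u_def v_def
    proof (rule norm_le_square_mean[OF holomorphic_on_subset[OF F] r(1)])
      show "{z. \<bar>Re z - Re w\<bar> \<le> 2 * r \<and> \<bar>Im z - Im w\<bar> \<le> 2 * r} \<subseteq> region_above a"
      proof
        fix z assume z: "z \<in> {z. \<bar>Re z - Re w\<bar> \<le> 2 * r \<and> \<bar>Im z - Im w\<bar> \<le> 2 * r}"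
        have "\<bar>a (Re z) - a u\<bar> \<le> M * (2 * r)" by (rule lip) (use z in \<open>auto simp: X_def u_def\<close>)
        then have "a (Re z) < Im z" using z d r \<tau> by (auto simp: d_def u_def v_def algebra_simps)
        then show "z \<in> region_above a" by (simp add: mem_region)
      qed
    qed measurable
    also have "J \<le> (\<integral>\<^sup>+y. (\<integral>\<^sup>+x. (indicator X x + ennreal (norm (F (Complex x y)) powr p) * indicator X x) \<partial>lborel) * indicator Y y \<partial>lborel)"
      unfolding J_def
    proof (intro nn_integral_mono mult_right_mono)
      fix x y
      have "ennreal (norm (F (Complex x y))) \<le> ennreal (1 + norm (F (Complex x y)) powr p)"
        by (intro ennreal_leI norm_le_1_plus_powr p) auto
      then show "ennreal (norm (F (Complex x y))) * indicator X x \<le> indicator X x + ennreal (norm (F (Complex x y)) powr p) * indicator X x"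
        by (auto simp: indicator_def)
    qed auto
    also have "\<dots> = (\<integral>\<^sup>+y. ennreal (4 * r) * indicator Y y + (\<integral>\<^sup>+x. ennreal (norm (F (Complex x y)) powr p) * indicator X x * indicator Y y \<partial>lborel) \<partial>lborel)"
      using r by (simp add: nn_integral_add nn_integral_multc distrib_right X_def)
    also have "\<dots> = ennreal (4 * r) * ennreal (4 * r)
        + (\<integral>\<^sup>+y. \<integral>\<^sup>+x. ennreal (norm (F (Complex x y)) powr p) * indicator X x * indicator Y y \<partial>lborel \<partial>lborel)"
      using r by (subst nn_integral_add) (simp_all add: nn_integral_cmult Y_def)
    also have "(\<integral>\<^sup>+y. \<integral>\<^sup>+x. ennreal (norm (F (Complex x y)) powr p) * indicator X x * indicator Y y \<partial>lborel \<partial>lborel)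
        = (\<integral>\<^sup>+x. \<integral>\<^sup>+y. ennreal (norm (F (Complex x y)) powr p) * indicator X x * indicator Y y \<partial>lborel \<partial>lborel)"
      by (rule lborel_pair.Fubini') measurable
    also have "\<dots> \<le> (\<integral>\<^sup>+x. \<integral>\<^sup>+s. ennreal (norm (F (Complex x (a x + s))) powr p) * indicator I s \<partial>lborel \<partial>lborel)"
    proof (rule nn_integral_mono)
      fix x
      have "(\<integral>\<^sup>+y. ennreal (norm (F (Complex x y)) powr p) * indicator X x * indicator Y y \<partial>lborel)
          = ennreal \<bar>1\<bar> * (\<integral>\<^sup>+s. ennreal (norm (F (Complex x (a x + 1 * s))) powr p) * indicator X x * indicator Y (a x + 1 * s) \<partial>lborel)"
        by (rule nn_integral_real_affine[where f = "\<lambda>y. ennreal (norm (F (Complex x y)) powr p) * indicator X x * indicator Y y"]) auto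
      also have "\<dots> \<le> (\<integral>\<^sup>+s. ennreal (norm (F (Complex x (a x + s))) powr p) * indicator I s \<partial>lborel)"
        using lip[of x] by (auto intro!: nn_integral_mono simp: indicator_def I_def Y_def d_def algebra_simps)
      finally show "(\<integral>\<^sup>+y. ennreal (norm (F (Complex x y)) powr p) * indicator X x * indicator Y y \<partial>lborel)
          \<le> (\<integral>\<^sup>+s. ennreal (norm (F (Complex x (a x + s))) powr p) * indicator I s \<partial>lborel)" .
    qed
    also have "\<dots> = (\<integral>\<^sup>+s. \<integral>\<^sup>+x. ennreal (norm (F (Complex x (a x + s))) powr p) * indicator I s \<partial>lborel \<partial>lborel)"
      by (rule lborel_pair.Fubini') measurable
    also have "\<dots> \<le> (\<integral>\<^sup>+s. ennreal K * indicator I s \<partial>lborel)"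
    proof (rule nn_integral_mono)
      fix s
      show "(\<integral>\<^sup>+x. ennreal (norm (F (Complex x (a x + s))) powr p) * indicator I s \<partial>lborel) \<le> ennreal K * indicator I s"
      proof (cases "s \<in> I")
        case True
        then have "0 < s" using d r \<tau> by (auto simp: I_def)
        then show ?thesis using True K by simp
      qed simp
    qed
    also have "\<dots> = ennreal K * ennreal (4 * r * (1 + M))"
      using r(1) M_pos by (simp add: nn_integral_cmult I_def mult.assoc)
    finally have "ennreal (2 * pi * r * r * norm (F w)) \<le> 4 * (ennreal (4 * r) * ennreal (4 * r) + ennreal K * ennreal (4 * r * (1 + M)))"
      by (simp add: mult_left_mono add_left_mono)
    also have "\<dots> = ennreal (4 * (16 * r * r + K * (4 * r * (1 + M))))"
    proof -
      have c: "0 \<le> 4 * r" "0 \<le> 4 * r * (1 + M)" using r(1) M_pos by auto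
      have "4 * (ennreal (4 * r) * ennreal (4 * r) + ennreal K * ennreal (4 * r * (1 + M)))
          = ennreal 4 * (ennreal ((4 * r) * (4 * r)) + ennreal (K * (4 * r * (1 + M))))"
        by (simp only: ennreal_mult[OF c(1) c(1)] ennreal_mult[OF K0 c(2)]) simp
      also have "\<dots> = ennreal 4 * ennreal ((4 * r) * (4 * r) + K * (4 * r * (1 + M)))"
        by (subst ennreal_plus) (use c K0 in \<open>auto intro!: mult_nonneg_nonneg\<close>)
      also have "\<dots> = ennreal (4 * ((4 * r) * (4 * r) + K * (4 * r * (1 + M))))"
        by (rule ennreal_mult'[symmetric]) simp
      finally show ?thesis by (simp add: mult_ac)
    qed
    finally have "2 * pi * r * r * norm (F w) \<le> 4 * (16 * r * r + K * (4 * r * (1 + M)))"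
      using r K0 M_pos by (subst (asm) ennreal_le_iff) auto
    then show ?thesis using r(1) by (simp add: C_def field_simps)
  qed
  then show ?thesis by (rule that)
qed

section \<open>The Poisson kernel of the half-plane\<close>

definition poisson_kernel :: "complex \<Rightarrow> real \<Rightarrow> real" where
  "poisson_kernel z t = Im z / (pi * (norm (of_real t - z))\<^sup>2)"

lemma poisson_kernel_nonneg: "0 \<le> Im z \<Longrightarrow> 0 \<le> poisson_kernel z t"
  by (simp add: poisson_kernel_def)

lemma poisson_kernel_measurable [measurable]: "poisson_kernel z \<in> borel_measurable borel"
  unfolding poisson_kernel_def by measurable

text \<open>
  The difference of Cauchy's formula at \<open>z\<close> and Cauchy's theorem at \<open>cnj z\<close> on a large rectangle.
  The difference of the two kernels decays quadratically, so boundedness of \<open>f\<close> suffices to make the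
  upper three sides vanish in the limit.
\<close>
lemma poisson_limit:
  assumes f: "f holomorphic_on {z. - \<epsilon> < Im z}" and \<epsilon>: "0 < \<epsilon>"
    and B: "\<And>z. - \<epsilon> < Im z \<Longrightarrow> norm (f z) \<le> B" and z: "0 < Im z"
  shows "(\<lambda>n. integral {-real n..real n} (\<lambda>t. of_real (poisson_kernel z t) * f (of_real t))) \<longlonglongrightarrow> f z"
proof -
  \<comment> \<open>in the half-plane \<open>S\<close> the function is holomorphic, and \<open>cnj z\<close> lies outside of it\<close>
  define \<delta> where "\<delta> = min \<epsilon> (Im z)"
  define S where "S = {z. - \<delta> < Im z}"
  have \<delta>: "0 < \<delta>" using \<epsilon> z by (simp add: \<delta>_def)
  have fS: "f holomorphic_on S"
    by (rule holomorphic_on_subset[OF f]) (auto simp: S_def \<delta>_def)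
  have oS: "open S" unfolding S_def by (intro open_Collect_less continuous_intros)
  have cS: "convex S" unfolding S_def by (rule convex_halfspace_Im_gt)
  have B0: "0 \<le> B" using B[of 0] \<epsilon> norm_ge_zero[of "f 0"] by (simp del: norm_ge_zero)
  define K where "K = (\<lambda>\<zeta>. f \<zeta> / (\<zeta> - z) - f \<zeta> / (\<zeta> - cnj z))"
  have cnjz: "cnj z \<notin> S" using z by (simp add: S_def \<delta>_def)
  have Keq: "K \<zeta> = f \<zeta> * (z - cnj z) / ((\<zeta> - z) * (\<zeta> - cnj z))" if "\<zeta> \<noteq> z" "\<zeta> \<noteq> cnj z" for \<zeta>
    using that by (simp add: K_def field_simps)
  have cK: "continuous_on (S - {z}) K"
    unfolding K_def
    using cnjz by (intro continuous_intros continuous_on_subset[OF holomorphic_on_imp_continuous_on[OF fS]]) auto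
  have est: "norm (f z - integral {-real n..real n} (\<lambda>t. of_real (poisson_kernel z t) * f (of_real t)))
      \<le> (16 * B * Im z / pi) * inverse (real n)" if n: "n \<ge> 1" "2 * norm z \<le> real n" for n
  proof -
    define N where "N = real n"
    have N: "1 \<le> N" "2 * norm z \<le> N" using n by (auto simp: N_def)
    have nz: "norm z > 0" using z by auto
    define a1 a3 where "a1 = Complex (-N) 0" and "a3 = Complex N N"
    have zbox: "z \<in> box a1 a3"
      using N z nz abs_Re_le_cmod[of z] abs_Im_le_cmod[of z] by (auto simp: a1_def a3_def in_box_complex_iff)
    have sub: "path_image (rectpath a1 a3) \<subseteq> S - {z}"
    proof -
      have "path_image (rectpath a1 a3) \<subseteq> cbox a1 a3 - box a1 a3"
        using path_image_rectpath_cbox_minus_box[of a1 a3] N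
        by (simp add: a1_def a3_def)
      moreover have "cbox a1 a3 \<subseteq> S"
        using \<delta> by (auto simp: a1_def a3_def S_def in_cbox_complex_iff)
      ultimately show ?thesis using zbox by auto
    qed
    have "((\<lambda>\<zeta>. f \<zeta> / (\<zeta> - z)) has_contour_integral (2*pi * \<i> * winding_number (rectpath a1 a3) z * f z)) (rectpath a1 a3)"
      by (rule Cauchy_integral_formula_convex_simple[OF cS fS _ _ sub])
        (use oS z \<delta> in \<open>auto simp: interior_open S_def\<close>)
    moreover have "((\<lambda>\<zeta>. f \<zeta> / (\<zeta> - cnj z)) has_contour_integral 0) (rectpath a1 a3)"
    proof (rule Cauchy_theorem_convex_simple[OF _ cS])
      show "(\<lambda>\<zeta>. f \<zeta> / (\<zeta> - cnj z)) holomorphic_on S"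
        using cnjz by (intro holomorphic_intros fS) auto
    qed (use sub in auto)
    ultimately have "(K has_contour_integral (2*pi * \<i> * f z)) (rectpath a1 a3)"
      unfolding K_def using has_contour_integral_diff winding_number_rectpath[OF zbox] by fastforce
    then have ci: "contour_integral (rectpath a1 a3) K = 2*pi * \<i> * f z"
      by (rule contour_integral_unique)
    have split: "contour_integral (rectpath a1 a3) K =
        contour_integral (linepath (Complex (-N) 0) (Complex N 0)) K +
        contour_integral (linepath (Complex N 0) (Complex N N)) K +
        contour_integral (linepath (Complex N N) (Complex (-N) N)) K +
        contour_integral (linepath (Complex (-N) N) (Complex (-N) 0)) K"
      by (subst contour_integral_rectpath[OF continuous_on_subset[OF cK sub]])
        (simp add: a1_def a3_def)
    have bottom: "contour_integral (linepath (Complex (-N) 0) (Complex N 0)) K =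
        2*pi * \<i> * integral {-N..N} (\<lambda>t. of_real (poisson_kernel z t) * f (of_real t))"
    proof -
      have "contour_integral (linepath (Complex (-N) 0) (Complex N 0)) K = integral {-N..N} (\<lambda>x. K (Complex x 0))"
        by (rule contour_integral_linepath_same_Im) (use N in auto)
      also have "\<dots> = integral {-N..N} (\<lambda>t. 2*pi * \<i> * (of_real (poisson_kernel z t) * f (of_real t)))"
      proof (rule integral_cong)
        fix t
        have ne: "of_real t \<noteq> z" "of_real t \<noteq> cnj z" using z by (auto simp: complex_eq_iff)
        have "K (Complex t 0) = f (of_real t) * (z - cnj z) / ((of_real t - z) * cnj (of_real t - z))"
          unfolding complex_of_real_def[symmetric] using Keq[OF ne] by simp
        also have "(of_real t - z) * cnj (of_real t - z) = of_real ((norm (of_real t - z))\<^sup>2)"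
          by (rule complex_norm_square[symmetric])
        also have "z - cnj z = 2 * \<i> * of_real (Im z)"
          by (simp add: complex_diff_cnj)
        finally show "K (Complex t 0) = 2*pi * \<i> * (of_real (poisson_kernel z t) * f (of_real t))"
          by (simp add: poisson_kernel_def)
      qed
      finally show ?thesis by simp
    qed
    have bound: "norm (K \<zeta>) \<le> 8 * B * Im z / N\<^sup>2" if "0 \<le> Im \<zeta>" "N \<le> norm \<zeta>" for \<zeta>
    proof -
      have 1: "N / 2 \<le> norm (\<zeta> - z)"
        using norm_triangle_ineq2[of \<zeta> z] that N by simp
      have 2: "N / 2 \<le> norm (\<zeta> - cnj z)"
        using norm_triangle_ineq2[of \<zeta> "cnj z"] that N by simp
      have "\<zeta> \<noteq> z" "\<zeta> \<noteq> cnj z" using 1 2 N by auto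
      then have "norm (K \<zeta>) = norm (f \<zeta>) * (2 * Im z) / (norm (\<zeta> - z) * norm (\<zeta> - cnj z))"
        using z by (simp add: Keq norm_mult norm_divide complex_diff_cnj)
      also have "\<dots> \<le> B * (2 * Im z) / ((N/2) * (N/2))"
        by (intro frac_le mult_mono mult_nonneg_nonneg 1 2 B mult_pos_pos) (use that \<epsilon> z N B0 in auto)
      also have "\<dots> = 8 * B * Im z / N\<^sup>2" by (simp add: power2_eq_square)
      finally show ?thesis .
    qed
    have far: "N \<le> norm (Complex N y)" "N \<le> norm (Complex (-N) y)" "N \<le> norm (Complex x N)" for x y
      using abs_Re_le_cmod[of "Complex N y"] abs_Re_le_cmod[of "Complex (-N) y"] abs_Im_le_cmod[of "Complex x N"] by auto
    have cC: "continuous_on A (\<lambda>x. Complex x y)" "continuous_on A (\<lambda>x. Complex y x)" for A y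
      unfolding Complex_eq by (intro continuous_intros)+
    have nz': "z \<noteq> \<zeta>" if "N \<le> norm \<zeta>" for \<zeta> using that N nz by auto
    have b2: "norm (contour_integral (linepath (Complex N 0) (Complex N N)) K) \<le> integral {0..N} (\<lambda>_. 8 * B * Im z / N\<^sup>2)"
      by (rule norm_contour_integral_vertical(1))
        (use N \<delta> far nz' in \<open>auto intro!: bound continuous_on_compose2[OF cK cC(2)] simp: S_def\<close>)
    have b3: "norm (contour_integral (linepath (Complex N N) (Complex (-N) N)) K) \<le> integral {-N..N} (\<lambda>_. 8 * B * Im z / N\<^sup>2)"
      by (rule norm_contour_integral_horizontal(2))
        (use N \<delta> far nz' in \<open>auto intro!: bound continuous_on_compose2[OF cK cC(1)] simp: S_def\<close>)
    have b4: "norm (contour_integral (linepath (Complex (-N) N) (Complex (-N) 0)) K) \<le> integral {0..N} (\<lambda>_. 8 * B * Im z / N\<^sup>2)"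
      by (rule norm_contour_integral_vertical(2))
        (use N \<delta> far nz' in \<open>auto intro!: bound continuous_on_compose2[OF cK cC(2)] simp: S_def\<close>)
    define I where "I = integral {-N..N} (\<lambda>t. of_real (poisson_kernel z t) * f (of_real t))"
    have "2 * pi * norm (f z - I) = norm (2*pi * \<i> * (f z - I))" by (simp add: norm_mult)
    also have "2*pi * \<i> * (f z - I) =
        contour_integral (linepath (Complex N 0) (Complex N N)) K +
        contour_integral (linepath (Complex N N) (Complex (-N) N)) K +
        contour_integral (linepath (Complex (-N) N) (Complex (-N) 0)) K"
      using ci split bottom by (simp add: I_def algebra_simps)
    also have "norm \<dots> \<le> integral {0..N} (\<lambda>_. 8 * B * Im z / N\<^sup>2) + integral {-N..N} (\<lambda>_. 8 * B * Im z / N\<^sup>2)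
        + integral {0..N} (\<lambda>_. 8 * B * Im z / N\<^sup>2)"
      by (intro order_trans[OF norm_triangle_ineq] add_mono b2 b3 b4)
    also have "\<dots> = 32 * B * Im z * inverse N"
      using N by (simp add: power2_eq_square field_simps)
    finally have "norm (f z - I) \<le> (16 * B * Im z / pi) * inverse N"
      using N(1) by (simp add: field_simps less_le_trans[OF zero_less_one])
    then show ?thesis by (simp add: I_def N_def)
  qed
  have "(\<lambda>n. f z - integral {-real n..real n} (\<lambda>t. of_real (poisson_kernel z t) * f (of_real t))) \<longlonglongrightarrow> 0"
  proof (rule Lim_null_comparison)
    show "(\<lambda>n. (16 * B * Im z / pi) * inverse (real n)) \<longlonglongrightarrow> 0"
      by (rule tendsto_mult_right_zero[OF lim_inverse_n])
    obtain n0 where "2 * norm z \<le> real n0" using real_arch_simple by blast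
    then show "\<forall>\<^sub>F n in sequentially. norm (f z - integral {-real n..real n} (\<lambda>t. of_real (poisson_kernel z t) * f (of_real t)))
        \<le> (16 * B * Im z / pi) * inverse (real n)"
      using est by (auto simp: eventually_sequentially intro!: exI[of _ "max 1 n0"])
  qed
  from tendsto_diff[OF tendsto_const[of "f z"] this] show ?thesis by simp
qed

text \<open>
  Poisson's formula for the constant function \<open>1\<close>.
\<close>
lemma nn_integral_poisson_kernel:
  assumes z: "0 < Im z"
  shows "(\<integral>\<^sup>+t. ennreal (poisson_kernel z t) \<partial>lborel) = 1"
proof -
  have cont: "continuous_on A (poisson_kernel z)" for A
    using z unfolding poisson_kernel_def by (auto intro!: continuous_intros simp: complex_eq_iff)
  have "(\<lambda>n. integral {-real n..real n} (\<lambda>t. of_real (poisson_kernel z t) * (1::complex))) \<longlonglongrightarrow> 1"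
    by (rule poisson_limit[of "\<lambda>_. 1" 1 1]) (use z in auto)
  then have "(\<lambda>n. complex_of_real (integral {-real n..real n} (poisson_kernel z))) \<longlonglongrightarrow> of_real 1"
    using integral_linear[OF integrable_continuous_real[OF cont] bounded_linear_of_real[where 'a=complex]]
    by (simp add: o_def)
  then have "(\<lambda>n. integral {-real n..real n} (poisson_kernel z)) \<longlonglongrightarrow> 1"
    by (simp only: tendsto_of_real_iff)
  then have l1: "(\<lambda>n. ennreal (integral {-real n..real n} (poisson_kernel z))) \<longlonglongrightarrow> ennreal 1"
    by (rule tendsto_ennrealI)
  have "(\<lambda>n. \<integral>\<^sup>+t. ennreal (poisson_kernel z t) * indicator {-real n..real n} t \<partial>lborel)
      \<longlonglongrightarrow> (\<integral>\<^sup>+t. ennreal (poisson_kernel z t) \<partial>lborel)"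
    by (rule nn_integral_intervals_LIMSEQ) measurable
  also have "(\<lambda>n. \<integral>\<^sup>+t. ennreal (poisson_kernel z t) * indicator {-real n..real n} t \<partial>lborel) =
      (\<lambda>n. ennreal (integral {-real n..real n} (poisson_kernel z)))"
    using z by (intro ext nn_integral_continuous_interval cont poisson_kernel_nonneg) auto
  finally show ?thesis using l1 LIMSEQ_unique by fastforce
qed

lemma nn_integral_poisson_kernel_translate:
  assumes y: "0 < y"
  shows "(\<integral>\<^sup>+x. ennreal (poisson_kernel (Complex x y) t) \<partial>lborel) = 1"
proof -
  have "poisson_kernel (Complex x y) t = poisson_kernel (Complex t y) x" for x
    by (simp add: poisson_kernel_def cmod_power2 power2_commute)
  then show ?thesis using nn_integral_poisson_kernel[of "Complex t y"] y by simp
qed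

lemma norm_le_poisson_integral:
  assumes f: "f holomorphic_on {z. - \<epsilon> < Im z}" and \<epsilon>: "0 < \<epsilon>"
    and B: "\<And>z. - \<epsilon> < Im z \<Longrightarrow> norm (f z) \<le> B" and z: "0 < Im z"
  shows "ennreal (norm (f z)) \<le> (\<integral>\<^sup>+t. ennreal (poisson_kernel z t * norm (f (of_real t))) \<partial>lborel)"
proof -
  have "continuous_on UNIV (\<lambda>t::real. f (of_real t))"
    by (rule continuous_on_compose2[OF holomorphic_on_imp_continuous_on[OF f]])
      (use \<epsilon> in \<open>auto intro!: continuous_intros\<close>)
  then have cf: "continuous_on A (\<lambda>t::real. f (of_real t))" for A
    by (rule continuous_on_subset) simp
  have cP: "continuous_on A (poisson_kernel z)" for A
    using z unfolding poisson_kernel_def by (auto intro!: continuous_intros simp: complex_eq_iff)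
  have "(\<lambda>n. ennreal (norm (integral {-real n..real n} (\<lambda>t. of_real (poisson_kernel z t) * f (of_real t))))) \<longlonglongrightarrow> ennreal (norm (f z))"
    by (intro tendsto_ennrealI tendsto_norm poisson_limit[OF f \<epsilon> B z])
  then show ?thesis
  proof (rule LIMSEQ_le_const2, intro exI allI impI)
    fix n :: nat
    have "norm (integral {-real n..real n} (\<lambda>t. of_real (poisson_kernel z t) * f (of_real t)))
        \<le> integral {-real n..real n} (\<lambda>t. poisson_kernel z t * norm (f (of_real t)))"
      by (rule integral_norm_bound_integral)
        (use z in \<open>auto intro!: integrable_continuous_real continuous_intros cf cP simp: norm_mult poisson_kernel_nonneg\<close>)
    then have "ennreal (norm (integral {-real n..real n} (\<lambda>t. of_real (poisson_kernel z t) * f (of_real t))))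
        \<le> ennreal (integral {-real n..real n} (\<lambda>t. poisson_kernel z t * norm (f (of_real t))))"
      by (rule ennreal_leI)
    also have "\<dots> = (\<integral>\<^sup>+t. ennreal (poisson_kernel z t * norm (f (of_real t))) * indicator {-real n..real n} t \<partial>lborel)"
      by (rule nn_integral_continuous_interval[symmetric])
        (use z in \<open>auto intro!: continuous_intros cf cP simp: poisson_kernel_nonneg\<close>)
    also have "\<dots> \<le> (\<integral>\<^sup>+t. ennreal (poisson_kernel z t * norm (f (of_real t))) \<partial>lborel)"
      by (intro nn_integral_mono) (auto simp: indicator_def)
    finally show "ennreal (norm (integral {-real n..real n} (\<lambda>t. of_real (poisson_kernel z t) * f (of_real t))))
        \<le> (\<integral>\<^sup>+t. ennreal (poisson_kernel z t * norm (f (of_real t))) \<partial>lborel)" .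
  qed
qed

text \<open>
  Jensen's inequality for the probability density \<open>poisson_kernel z\<close>.  With \<open>A = \<bar>f z\<bar>\<close>, integrating
  Young's inequality \<open>\<bar>f\<bar> A\<^sup>p\<^sup>-\<^sup>1 \<le> \<bar>f\<bar>\<^sup>p / p + A\<^sup>p / q\<close> against the kernel gives
  \<open>A\<^sup>p \<le> J / p + A\<^sup>p / q\<close>, that is \<open>A\<^sup>p \<le> J\<close>.
\<close>
lemma norm_powr_le_poisson_integral:
  assumes f: "f holomorphic_on {z. - \<epsilon> < Im z}" and \<epsilon>: "0 < \<epsilon>"
    and B: "\<And>z. - \<epsilon> < Im z \<Longrightarrow> norm (f z) \<le> B" and z: "0 < Im z" and p: "1 < p"
  shows "ennreal (norm (f z) powr p) \<le> (\<integral>\<^sup>+t. ennreal (poisson_kernel z t * norm (f (of_real t)) powr p) \<partial>lborel)"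
proof (cases "f z = 0 \<or> (\<integral>\<^sup>+t. ennreal (poisson_kernel z t * norm (f (of_real t)) powr p) \<partial>lborel) = \<infinity>")
  case False
  define A where "A = norm (f z)"
  define q where "q = p / (p - 1)"
  have q: "1 < q" "1 / p + 1 / q = 1" "(p - 1) * q = p" using p by (auto simp: q_def field_simps)
  have A: "0 < A" using False by (simp add: A_def)
  define c where "c = A powr (p - 1)"
  have c: "0 < c" "c powr q = A powr p" "A * c = A powr p"
    using A q p by (simp_all add: c_def powr_powr powr_mult_base)
  have "continuous_on UNIV (\<lambda>t::real. f (of_real t))"
    by (rule continuous_on_compose2[OF holomorphic_on_imp_continuous_on[OF f]])
      (use \<epsilon> in \<open>auto intro!: continuous_intros\<close>)
  then have [measurable]: "(\<lambda>t::real. f (of_real t)) \<in> borel_measurable borel"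
    by (rule borel_measurable_continuous_onI)
  define J where "J = (\<integral>\<^sup>+t. ennreal (poisson_kernel z t * norm (f (of_real t)) powr p) \<partial>lborel)"
  obtain j where j: "J = ennreal j" "0 \<le> j"
    using False by (cases J) (auto simp: J_def)
  have Pn: "0 \<le> poisson_kernel z t" for t using z by (simp add: poisson_kernel_nonneg)
  have "ennreal (A powr p) = ennreal c * ennreal A"
    using c A by (simp add: mult.commute flip: ennreal_mult)
  also have "\<dots> \<le> ennreal c * (\<integral>\<^sup>+t. ennreal (poisson_kernel z t * norm (f (of_real t))) \<partial>lborel)"
    unfolding A_def by (intro mult_left_mono norm_le_poisson_integral[OF f \<epsilon> B z]) auto
  also have "\<dots> = (\<integral>\<^sup>+t. ennreal c * ennreal (poisson_kernel z t * norm (f (of_real t))) \<partial>lborel)"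
    by (rule nn_integral_cmult[symmetric]) measurable
  also have "\<dots> \<le> (\<integral>\<^sup>+t. ennreal (1 / p) * ennreal (poisson_kernel z t * norm (f (of_real t)) powr p)
      + ennreal (A powr p / q) * ennreal (poisson_kernel z t) \<partial>lborel)"
  proof (rule nn_integral_mono)
    fix t
    have "norm (f (of_real t)) * c \<le> norm (f (of_real t)) powr p / p + c powr q / q"
      by (rule Youngs_inequality) (use p q c in auto)
    then have "poisson_kernel z t * (norm (f (of_real t)) * c) \<le>
        poisson_kernel z t * (norm (f (of_real t)) powr p / p + A powr p / q)"
      unfolding c(2) by (rule mult_left_mono[OF _ Pn])
    then have "c * (poisson_kernel z t * norm (f (of_real t))) \<le>
        1 / p * (poisson_kernel z t * norm (f (of_real t)) powr p) + A powr p / q * poisson_kernel z t"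
      by (simp add: algebra_simps)
    then show "ennreal c * ennreal (poisson_kernel z t * norm (f (of_real t))) \<le>
        ennreal (1 / p) * ennreal (poisson_kernel z t * norm (f (of_real t)) powr p) +
        ennreal (A powr p / q) * ennreal (poisson_kernel z t)"
      using p q c Pn by (simp add: ennreal_leI flip: ennreal_mult ennreal_plus)
  qed
  also have "\<dots> = ennreal (1 / p) * J + ennreal (A powr p / q) * (\<integral>\<^sup>+t. ennreal (poisson_kernel z t) \<partial>lborel)"
    unfolding J_def by (subst nn_integral_add, measurable) (simp add: nn_integral_cmult)
  also have "\<dots> = ennreal (j / p + A powr p / q)"
    using p q j by (simp add: nn_integral_poisson_kernel[OF z] j flip: ennreal_mult ennreal_plus)
  finally have "A powr p \<le> j / p + A powr p / q"
    using j p q by (subst (asm) ennreal_le_iff) auto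
  also have "1 / q = 1 - 1 / p" using q by simp
  then have "A powr p / q = A powr p - A powr p / p" by (metis mult.right_neutral right_diff_distrib times_divide_eq_right)
  finally have "A powr p \<le> j" using p by (simp add: field_simps)
  then show ?thesis
    unfolding J_def[symmetric] j A_def[symmetric] by (rule ennreal_leI)
qed (use p in auto)

text \<open>
  The integrand is a multiple of the Poisson kernel at \<open>\<i>\<close>.
\<close>
lemma nn_integral_inverse_1_plus_square_finite:
  "(\<integral>\<^sup>+u. ennreal (c / (1 + u\<^sup>2)) \<partial>lborel) < \<infinity>" if "0 \<le> c"
proof -
  have "(\<integral>\<^sup>+u. ennreal (c / (1 + u\<^sup>2)) \<partial>lborel) = (\<integral>\<^sup>+u. ennreal (c * pi) * ennreal (poisson_kernel \<i> u) \<partial>lborel)"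
  proof (rule nn_integral_cong)
    fix u :: real
    have "c / (1 + u\<^sup>2) = (c * pi) * poisson_kernel \<i> u"
      by (simp add: poisson_kernel_def cmod_power2 add.commute)
    then show "ennreal (c / (1 + u\<^sup>2)) = ennreal (c * pi) * ennreal (poisson_kernel \<i> u)"
      using that by (simp add: ennreal_mult poisson_kernel_nonneg)
  qed
  also have "\<dots> = ennreal (c * pi)"
    by (simp add: nn_integral_cmult nn_integral_poisson_kernel)
  finally show ?thesis by simp
qed

section \<open>Integrals over horizontal lines\<close>

context
  fixes f :: "complex \<Rightarrow> complex" and p K :: real
  assumes f: "f holomorphic_on upper_half_plane" and f_meas [measurable]: "f \<in> borel_measurable borel"
    and p: "1 < p" and K0: "0 \<le> K"
    and K: "\<And>y. 0 < y \<Longrightarrow> line_integral p f y \<le> ennreal K"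
begin

lemma hardy_le_poisson_integral:
  assumes \<epsilon>: "0 < \<epsilon>" and z: "0 < Im z"
  shows "ennreal (norm (f (z + \<i> * of_real \<epsilon>)) powr p)
    \<le> (\<integral>\<^sup>+t. ennreal (poisson_kernel z t * norm (f (Complex t \<epsilon>)) powr p) \<partial>lborel)"
proof -
  obtain B where B: "\<And>w. \<epsilon> / 2 \<le> Im w \<Longrightarrow> norm (f w) \<le> B"
  proof (rule flat.bounded_away_from_boundary[of f p K "\<epsilon>/2"])
    show "f holomorphic_on region_above (\<lambda>_. 0)" using f unfolding upper_half_plane_eq .
  qed (use p K0 K \<epsilon> in auto)
  have "ennreal (norm (f (z + \<i> * of_real \<epsilon>)) powr p)
      \<le> (\<integral>\<^sup>+t. ennreal (poisson_kernel z t * norm (f (of_real t + \<i> * of_real \<epsilon>)) powr p) \<partial>lborel)"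
  proof (rule norm_powr_le_poisson_integral[of "\<lambda>z. f (z + \<i> * of_real \<epsilon>)" "\<epsilon> / 2" B z p])
    show "(\<lambda>z. f (z + \<i> * of_real \<epsilon>)) holomorphic_on {z. - (\<epsilon> / 2) < Im z}"
      by (rule holomorphic_on_compose_gen[OF _ f, unfolded o_def])
        (use \<epsilon> in \<open>auto intro!: holomorphic_intros simp: upper_half_plane_def\<close>)
    show "norm (f (z + \<i> * of_real \<epsilon>)) \<le> B" if "- (\<epsilon> / 2) < Im z" for z
      by (rule B) (use that in simp)
  qed (use \<epsilon> z p in auto)
  then show ?thesis by (simp add: Complex_eq)
qed

text \<open>
  Integrate the Poisson bound over the upper line: the kernel has integral \<open>1\<close> also in its other
  variable.
\<close>
lemma hardy_line_integral_antimono: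
  assumes y: "0 < y'" "y' \<le> y"
  shows "line_integral p f y
    \<le> line_integral p f y'"
proof (cases "y' = y")
  case False
  then have d: "0 < y - y'" using y by simp
  have [measurable]: "(\<lambda>(x, t). poisson_kernel (Complex x (y - y')) t) \<in> borel_measurable (borel \<Otimes>\<^sub>M borel)"
    unfolding poisson_kernel_def by measurable
  have "line_integral p f y
      \<le> (\<integral>\<^sup>+x. \<integral>\<^sup>+t. ennreal (poisson_kernel (Complex x (y - y')) t * norm (f (Complex t y')) powr p) \<partial>lborel \<partial>lborel)"
  proof (rule nn_integral_mono)
    fix x
    have "Complex x (y - y') + \<i> * of_real y' = Complex x y" by (simp add: complex_eq_iff)
    then show "ennreal (norm (f (Complex x y)) powr p)
      \<le> (\<integral>\<^sup>+t. ennreal (poisson_kernel (Complex x (y - y')) t * norm (f (Complex t y')) powr p) \<partial>lborel)"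
      using hardy_le_poisson_integral[OF y(1), of "Complex x (y - y')"] d by simp
  qed
  also have "\<dots> = (\<integral>\<^sup>+t. \<integral>\<^sup>+x. ennreal (poisson_kernel (Complex x (y - y')) t * norm (f (Complex t y')) powr p) \<partial>lborel \<partial>lborel)"
    by (rule lborel_pair.Fubini'[symmetric]) measurable
  also have "\<dots> = (\<integral>\<^sup>+t. (\<integral>\<^sup>+x. ennreal (poisson_kernel (Complex x (y - y')) t) \<partial>lborel) * ennreal (norm (f (Complex t y')) powr p) \<partial>lborel)"
    using d by (intro nn_integral_cong, subst nn_integral_multc[symmetric])
      (auto intro!: nn_integral_cong simp: ennreal_mult poisson_kernel_nonneg)
  also have "\<dots> = (\<integral>\<^sup>+t. ennreal (norm (f (Complex t y')) powr p) \<partial>lborel)"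
    using nn_integral_poisson_kernel_translate[OF d] by simp
  finally show ?thesis .
qed simp

end

section \<open>Boundedness of the transfer operator\<close>

context graph_conformal
begin

lemma hardy_transfer_holomorphic:
  assumes "G holomorphic_on region_above a"
  shows "hardy_transfer p \<Phi> G holomorphic_on upper_half_plane"
proof -
  have 1: "(\<lambda>z. G (\<Phi> z)) holomorphic_on upper_half_plane"
    by (rule holomorphic_on_compose_gen[OF holo assms, unfolded o_def])
      (use conformal in \<open>auto simp: bij_betw_def\<close>)
  have 2: "(\<lambda>z. Ln (deriv \<Phi> z)) holomorphic_on upper_half_plane"
    by (rule holomorphic_on_Ln')
      (use Re_deriv_\<Phi>_pos holomorphic_deriv[OF holo open_upper_half_plane]
        in \<open>force simp: upper_half_plane_def complex_nonpos_Reals_iff\<close>)+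
  have "(\<lambda>z. G (\<Phi> z) * exp (of_real (1/p) * Ln (deriv \<Phi> z))) holomorphic_on upper_half_plane"
    by (intro holomorphic_on_mult 1 holomorphic_on_compose[OF _ holomorphic_on_exp, unfolded o_def] holomorphic_on_const 2)
  then show ?thesis
  proof (rule holomorphic_transform)
    fix z assume z: "z \<in> upper_half_plane"
    then have "deriv \<Phi> z \<noteq> 0" using Re_deriv_\<Phi>_pos[of z] by (auto simp: upper_half_plane_def)
    then show "G (\<Phi> z) * exp (of_real (1/p) * Ln (deriv \<Phi> z)) = hardy_transfer p \<Phi> G z"
      using z by (simp add: hardy_transfer_def powr_def)
  qed
qed

lemma hardy_transfer_measurable:
  assumes "G holomorphic_on region_above a"
  shows "hardy_transfer p \<Phi> G \<in> borel_measurable borel"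
  by (rule borel_measurable_holomorphic_zero_outside[OF hardy_transfer_holomorphic[OF assms] open_upper_half_plane])
    (simp add: hardy_transfer_def)

lemma norm_hardy_transfer:
  assumes "0 < Im z" "0 < p"
  shows "norm (hardy_transfer p \<Phi> G z) powr p = norm (G (\<Phi> z)) powr p * norm (deriv \<Phi> z)"
proof -
  have "deriv \<Phi> z \<noteq> 0" using Re_deriv_\<Phi>_pos[OF assms(1)] by auto
  then have "norm (deriv \<Phi> z powr of_real (1/p)) = norm (deriv \<Phi> z) powr (1/p)"
    by (rule norm_powr_of_real)
  then show ?thesis
    using assms by (simp add: hardy_transfer_def mem_upper_half_plane norm_mult powr_mult powr_powr)
qed

text \<open>
  The function \<open>h\<close> is \<open>H\<close> on the level curve \<open>Im \<Psi> = y\<close>, written in terms of \<open>u = Re w\<close>.  It is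
  extended by \<open>0\<close> off the projection of the curve.  The inequality is the substitution \<open>u = Re (\<Phi> (x + i y))\<close>, whose derivative is comparable to
  \<open>\<bar>\<Phi>'\<bar>\<close>.
\<close>
lemma level_curve_substitution:
  fixes H :: "complex \<Rightarrow> real"
  assumes y: "0 < y" and H: "continuous_on (region_above a) H" and H0: "\<And>w. 0 \<le> H w"
  obtains h where "h \<in> borel_measurable borel"
    "\<And>x. h (Re (\<Phi> (Complex x y))) = H (\<Phi> (Complex x y))"
    "\<And>u. u \<notin> range (\<lambda>x. Re (\<Phi> (Complex x y))) \<Longrightarrow> h u = 0"
    "(\<integral>\<^sup>+x. ennreal (H (\<Phi> (Complex x y)) * norm (deriv \<Phi> (Complex x y))) \<partial>lborel)
      \<le> ennreal (1 + M) * (\<integral>\<^sup>+u. ennreal (h u) \<partial>lborel)"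
proof -
  define g where "g = (\<lambda>x. Re (\<Phi> (Complex x y)))"
  define g' where "g' = (\<lambda>x. Re (deriv \<Phi> (Complex x y)))"
  have Cy: "continuous_on A (\<lambda>x. Complex x y)" for A
    unfolding Complex_eq by (intro continuous_intros)
  have gd: "(g has_real_derivative g' x) (at x)" for x
  proof -
    have d: "(\<Phi> has_field_derivative deriv \<Phi> (Complex x y)) (at (Complex x y))"
      using holomorphic_derivI[OF holo open_upper_half_plane] y by (simp add: mem_upper_half_plane)
    have "((\<lambda>x. \<Phi> (Complex x y)) has_vector_derivative (1 * deriv \<Phi> (Complex x y))) (at x)"
      by (rule field_vector_diff_chain_at[of "\<lambda>x. Complex x y" 1 x \<Phi>, unfolded o_def])
        (use d in \<open>auto simp: Complex_eq intro!: derivative_eq_intros\<close>)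
    then have "(g has_vector_derivative g' x) (at x)"
      unfolding g_def g'_def
      using bounded_linear.has_vector_derivative[OF bounded_linear_Re] by fastforce
    then show ?thesis by (simp add: has_real_derivative_iff_has_vector_derivative)
  qed
  have g'pos: "0 < g' x" for x unfolding g'_def by (rule Re_deriv_\<Phi>_pos) (use y in simp)
  have sm: "strict_mono g"
    by (rule strict_monoI, rule DERIV_pos_imp_increasing) (use gd g'pos in auto)
  have inj: "inj g" using strict_mono_imp_inj_on[OF sm] .
  have cg: "continuous_on A g" for A
    using gd by (meson DERIV_continuous_on DERIV_subset top_greatest)
  have cg': "continuous_on A g'" for A
    unfolding g'_def
    by (intro continuous_intros continuous_on_compose2[OF holomorphic_on_imp_continuous_on[OF holomorphic_deriv[OF holo open_upper_half_plane]] Cy])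
      (use y in \<open>auto simp: mem_upper_half_plane\<close>)
  define J where "J = range g"
  have om: "open (g ` U)" if "open U" for U
    by (rule injective_into_1d_imp_open_map_UNIV[OF that cg inj]) simp
  have oJ: "open J" unfolding J_def by (rule om) simp
  define k where "k = inv g"
  have kg: "k (g x) = x" for x unfolding k_def by (rule inv_f_f[OF inj])
  have ck: "continuous_on J k"
    by (rule continuous_on_inverse_open_map[of UNIV g])
      (use kg om oJ cg in \<open>auto simp: J_def openin_open_eq intro!: open_openin_trans\<close>)
  define h where "h = (\<lambda>u. indicator J u *\<^sub>R H (\<Phi> (Complex (k u) y)))"
  have cHx: "continuous_on A (\<lambda>x. H (\<Phi> (Complex x y)))" for A
    by (rule continuous_on_compose2[OF H continuous_on_compose2[OF continuous_on_\<Phi> Cy]])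
      (use y \<Phi>_region in \<open>auto simp: mem_region\<close>)
  have hm: "h \<in> borel_measurable borel"
    unfolding h_def
    by (rule borel_measurable_continuous_on_indicator)
      (use oJ in \<open>auto intro!: continuous_on_compose2[OF cHx[of UNIV] ck]\<close>)
  have hg: "h (g x) = H (\<Phi> (Complex x y))" for x
    by (simp add: h_def kg J_def)
  have h0: "0 \<le> h u" for u using H0 by (simp add: h_def)
  have [measurable]: "(\<lambda>x. H (\<Phi> (Complex x y))) \<in> borel_measurable borel" "g' \<in> borel_measurable borel"
    using cHx cg' by (auto intro: borel_measurable_continuous_onI)
  have "(\<integral>\<^sup>+x. ennreal (H (\<Phi> (Complex x y)) * g' x) \<partial>lborel) \<le> (\<integral>\<^sup>+u. ennreal (h u) \<partial>lborel)"
  proof (rule nn_integral_le_of_intervals)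
    fix n :: nat
    have "(\<integral>\<^sup>+x. ennreal (H (\<Phi> (Complex x y)) * g' x) * indicator {-real n..real n} x \<partial>lborel)
        = (\<integral>\<^sup>+x. ennreal (h (g x) * g' x * indicator {-real n..real n} x) \<partial>lborel)"
      by (intro nn_integral_cong) (simp add: hg indicator_def)
    also have "\<dots> = (\<integral>\<^sup>+u. ennreal (h u * indicator {g (-real n)..g (real n)} u) \<partial>lborel)"
      by (rule nn_integral_substitution[symmetric])
        (use hm gd g'pos cg' in \<open>auto simp: set_borel_measurable_def less_imp_le\<close>)
    also have "\<dots> \<le> (\<integral>\<^sup>+u. ennreal (h u) \<partial>lborel)"
      using h0 by (intro nn_integral_mono ennreal_leI) (auto simp: indicator_def)
    finally show "(\<integral>\<^sup>+x. ennreal (H (\<Phi> (Complex x y)) * g' x) * indicator {-real n..real n} x \<partial>lborel)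
        \<le> (\<integral>\<^sup>+u. ennreal (h u) \<partial>lborel)" .
  qed measurable
  then have "ennreal (1 + M) * (\<integral>\<^sup>+x. ennreal (H (\<Phi> (Complex x y)) * g' x) \<partial>lborel)
      \<le> ennreal (1 + M) * (\<integral>\<^sup>+u. ennreal (h u) \<partial>lborel)"
    by (rule mult_left_mono) simp
  moreover have "(\<integral>\<^sup>+x. ennreal (H (\<Phi> (Complex x y)) * norm (deriv \<Phi> (Complex x y))) \<partial>lborel)
      \<le> (\<integral>\<^sup>+x. ennreal (1 + M) * ennreal (H (\<Phi> (Complex x y)) * g' x) \<partial>lborel)"
  proof (rule nn_integral_mono)
    fix x
    have "H (\<Phi> (Complex x y)) * norm (deriv \<Phi> (Complex x y)) \<le> H (\<Phi> (Complex x y)) * ((1 + M) * g' x)"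
      unfolding g'_def by (intro mult_left_mono norm_deriv_\<Phi>_le H0) (use y in simp)
    also have "\<dots> = (1 + M) * (H (\<Phi> (Complex x y)) * g' x)" by simp
    finally show "ennreal (H (\<Phi> (Complex x y)) * norm (deriv \<Phi> (Complex x y)))
        \<le> ennreal (1 + M) * ennreal (H (\<Phi> (Complex x y)) * g' x)"
      using M_pos H0 less_imp_le[OF g'pos[of x]]
      by (subst ennreal_mult[symmetric]) (auto intro!: ennreal_leI mult_nonneg_nonneg)
  qed
  moreover have "\<dots> = ennreal (1 + M) * (\<integral>\<^sup>+x. ennreal (H (\<Phi> (Complex x y)) * g' x) \<partial>lborel)"
    by (rule nn_integral_cmult) measurable
  ultimately have "(\<integral>\<^sup>+x. ennreal (H (\<Phi> (Complex x y)) * norm (deriv \<Phi> (Complex x y))) \<partial>lborel)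
      \<le> ennreal (1 + M) * (\<integral>\<^sup>+u. ennreal (h u) \<partial>lborel)" by simp
  then show ?thesis
    by (intro that[of h] hm) (use hg in \<open>auto simp: h_def J_def g_def\<close>)
qed

text \<open>
  On the vertical segment of length \<open>e\<close> above the boundary point, \<open>Im \<Psi>\<close> increases continuously from
  \<open>0\<close> to a positive value, and takes all values in between.
\<close>
lemma level_curve_near_boundary:
  assumes e: "0 < e"
  obtains y0 where "0 < y0"
    "\<And>y. 0 < y \<Longrightarrow> y < y0 \<Longrightarrow> \<exists>x. Re (\<Phi> (Complex x y)) = u \<and> a u \<le> Im (\<Phi> (Complex x y)) \<and> Im (\<Phi> (Complex x y)) \<le> a u + e"
proof -
  define y0 where "y0 = Im (\<Psi> (Complex u (a u + e)))"
  have "0 < y0" unfolding y0_def by (rule Im_\<Psi>_pos) (use e in simp)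
  moreover have "\<exists>x. Re (\<Phi> (Complex x y)) = u \<and> a u \<le> Im (\<Phi> (Complex x y)) \<and> Im (\<Phi> (Complex x y)) \<le> a u + e"
    if y: "0 < y" "y < y0" for y
  proof -
    have "\<exists>v\<ge>a u. v \<le> a u + e \<and> Im (\<Psi> (Complex u v)) = y"
    proof (rule IVT')
      obtain x where "\<Psi> (Complex u (a u)) = of_real x" by (rule \<Psi>_graph)
      then show "Im (\<Psi> (Complex u (a u))) \<le> y" using y by simp
      show "y \<le> Im (\<Psi> (Complex u (a u + e)))" using y by (simp add: y0_def)
      show "continuous_on {a u..a u + e} (\<lambda>v. Im (\<Psi> (Complex u v)))"
        by (intro continuous_intros continuous_on_compose2[OF continuous_on_\<Psi>])
          (auto simp: Complex_eq intro!: continuous_intros)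
    qed (use e in simp)
    then obtain v where v: "a u \<le> v" "v \<le> a u + e" "Im (\<Psi> (Complex u v)) = y" by blast
    have "\<Phi> (Complex (Re (\<Psi> (Complex u v))) y) = Complex u v"
      using \<Phi>_\<Psi>[of "Complex u v"] v by (simp flip: v(3))
    then show ?thesis using v by (intro exI[of _ "Re (\<Psi> (Complex u v))"]) simp
  qed
  ultimately show ?thesis by (rule that)
qed

text \<open>
  By monotonicity the integral over the line at height \<open>y\<close> is at most the limit of those at heights
  tending to \<open>0\<close>; there the level curves converge to the boundary, and the decay of \<open>G\<close> provides the
  dominating function.
\<close>
lemma hardy_transfer_bound_decaying:
  assumes G: "G holomorphic_on region_above a" and Gc: "continuous_on {w. a (Re w) \<le> Im w} G"
    and p: "1 < p"
    and decay: "\<And>w. a (Re w) \<le> Im w \<Longrightarrow> norm (G w) powr p \<le> B / (1 + (Re w)\<^sup>2)" and B: "0 \<le> B"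
    and y: "0 < y"
  shows "line_integral p (hardy_transfer p \<Phi> G) y
    \<le> ennreal (1 + M) * (\<integral>\<^sup>+u. ennreal (norm (G (Complex u (a u))) powr p) \<partial>lborel)"
proof -
  define H where "H = (\<lambda>w. norm (G w) powr p)"
  have Hc: "continuous_on {w. a (Re w) \<le> Im w} H"
    unfolding H_def using p by (intro continuous_on_powr' continuous_intros Gc) auto
  have Hr: "continuous_on (region_above a) H"
    by (rule continuous_on_subset[OF Hc]) (auto simp: mem_region)
  have H0: "0 \<le> H w" for w by (simp add: H_def)
  define Q where "Q = (\<lambda>y h. h \<in> borel_measurable borel \<and>
    (\<forall>x. h (Re (\<Phi> (Complex x y))) = H (\<Phi> (Complex x y))) \<and>
    (\<forall>u. u \<notin> range (\<lambda>x. Re (\<Phi> (Complex x y))) \<longrightarrow> h u = 0) \<and>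
    (\<integral>\<^sup>+x. ennreal (H (\<Phi> (Complex x y)) * norm (deriv \<Phi> (Complex x y))) \<partial>lborel)
      \<le> ennreal (1 + M) * (\<integral>\<^sup>+u. ennreal (h u) \<partial>lborel))"
  define h where "h = (\<lambda>y. SOME h. Q y h)"
  have Q: "Q y (h y)" if y: "0 < y" for y
  proof -
    obtain h' where "Q y h'"
      by (rule level_curve_substitution[OF y Hr H0]) (unfold Q_def, blast)
    then show ?thesis unfolding h_def by (rule someI[of "Q y"])
  qed
  have h_meas: "h y \<in> borel_measurable borel"
    and h1: "h y (Re (\<Phi> (Complex x y))) = H (\<Phi> (Complex x y))"
    and h2: "u \<notin> range (\<lambda>x. Re (\<Phi> (Complex x y))) \<Longrightarrow> h y u = 0"
    and h3: "(\<integral>\<^sup>+x. ennreal (H (\<Phi> (Complex x y)) * norm (deriv \<Phi> (Complex x y))) \<partial>lborel)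
      \<le> ennreal (1 + M) * (\<integral>\<^sup>+u. ennreal (h y u) \<partial>lborel)" if "0 < y" for x y u
    using Q[OF that] unfolding Q_def by blast+
  define f where "f = hardy_transfer p \<Phi> G"
  have fH: "norm (f (Complex x y)) powr p = H (\<Phi> (Complex x y)) * norm (deriv \<Phi> (Complex x y))" if "0 < y" for x y
    unfolding f_def H_def using norm_hardy_transfer[of "Complex x y" p G] p that by simp
  have hb: "h y u \<le> B / (1 + u\<^sup>2)" if y: "0 < y" for y u
  proof (cases "u \<in> range (\<lambda>x. Re (\<Phi> (Complex x y)))")
    case True
    then obtain x where u: "u = Re (\<Phi> (Complex x y))" by auto
    have "a (Re (\<Phi> (Complex x y))) \<le> Im (\<Phi> (Complex x y))"
      using \<Phi>_region[of "Complex x y"] y by simp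
    from decay[OF this] show ?thesis unfolding u h1[OF y] H_def .
  next
    case False
    then show ?thesis using h2[OF y] B by simp
  qed
  have h0: "0 \<le> h y u" if y: "0 < y" for y u
  proof (cases "u \<in> range (\<lambda>x. Re (\<Phi> (Complex x y)))")
    case True
    then obtain x where "u = Re (\<Phi> (Complex x y))" by blast
    then show ?thesis using h1[OF y, of x] H0 by simp
  next
    case False
    then show ?thesis using h2[OF y] by simp
  qed
  define W where "W = (\<integral>\<^sup>+u. ennreal (B / (1 + u\<^sup>2)) \<partial>lborel)"
  have Wfin: "W < \<infinity>" unfolding W_def by (rule nn_integral_inverse_1_plus_square_finite[OF B])
  have I_le: "line_integral p f y \<le> ennreal (1 + M) * (\<integral>\<^sup>+u. ennreal (h y u) \<partial>lborel)"
    if "0 < y" for y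
    using h3[OF that] by (simp add: fH that)
  have I_W: "line_integral p f y \<le> ennreal (1 + M) * W" if "0 < y" for y
    unfolding W_def
    by (rule order_trans[OF I_le[OF that]]) (intro mult_left_mono nn_integral_mono ennreal_leI hb that, simp)
  \<comment> \<open>the finite bound \<open>K\<close> makes \<open>f\<close> a Hardy function, which is what monotonicity in the height needs\<close>
  define K where "K = enn2real (ennreal (1 + M) * W)"
  have K: "ennreal (1 + M) * W = ennreal K"
    unfolding K_def using Wfin by (intro ennreal_enn2real[symmetric]) (simp add: ennreal_mult_less_top)
  have K0: "0 \<le> K" by (simp add: K_def)
  define ys where "ys = (\<lambda>n. inverse (real (Suc n)))"
  have ys: "0 < ys n" for n by (simp add: ys_def)
  have ys0: "ys \<longlonglongrightarrow> 0" unfolding ys_def by (rule LIMSEQ_inverse_real_of_nat)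
  have lim: "(\<lambda>n. h (ys n) u) \<longlonglongrightarrow> H (Complex u (a u))" for u
  proof -
    have tl: "((\<lambda>w. H w) \<longlongrightarrow> H (Complex u (a u))) (at (Complex u (a u)) within {w. a (Re w) \<le> Im w})"
      using Hc by (simp add: continuous_on_def)
    show ?thesis
    proof (rule tendstoI)
      fix \<delta> :: real assume \<delta>: "0 < \<delta>"
      have "\<forall>\<^sub>F w in at (Complex u (a u)) within {w. a (Re w) \<le> Im w}. dist (H w) (H (Complex u (a u))) < \<delta>"
        using tendstoD[OF tl \<delta>] .
      then obtain d where d: "0 < d" "\<And>w. a (Re w) \<le> Im w \<Longrightarrow> w \<noteq> Complex u (a u) \<Longrightarrow> dist w (Complex u (a u)) < d \<Longrightarrow>
          dist (H w) (H (Complex u (a u))) < \<delta>"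
        by (auto simp: eventually_at)
      obtain y0 where y0: "0 < y0"
        "\<And>y. 0 < y \<Longrightarrow> y < y0 \<Longrightarrow> \<exists>x. Re (\<Phi> (Complex x y)) = u \<and> a u \<le> Im (\<Phi> (Complex x y)) \<and> Im (\<Phi> (Complex x y)) \<le> a u + d/2"
        using level_curve_near_boundary[of "d/2" u] d(1) by auto
      have "\<forall>\<^sub>F n in sequentially. ys n < y0" using order_tendstoD(2)[OF ys0 y0(1)] .
      then show "\<forall>\<^sub>F n in sequentially. dist (h (ys n) u) (H (Complex u (a u))) < \<delta>"
      proof eventually_elim
        case (elim n)
        obtain x where x: "Re (\<Phi> (Complex x (ys n))) = u" "a u \<le> Im (\<Phi> (Complex x (ys n)))"
            "Im (\<Phi> (Complex x (ys n))) \<le> a u + d/2"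
          using y0(2)[OF ys elim] by auto
        define w where "w = \<Phi> (Complex x (ys n))"
        have hw: "h (ys n) u = H w" using h1[OF ys, of n x] x(1) by (simp add: w_def)
        have "dist w (Complex u (a u)) \<le> \<bar>Re w - u\<bar> + \<bar>Im w - a u\<bar>"
          using cmod_le[of "w - Complex u (a u)"] by (simp add: dist_norm)
        then have "dist w (Complex u (a u)) < d" using x d(1) by (simp add: w_def)
        moreover have "a (Re w) \<le> Im w" using x by (simp add: w_def)
        ultimately show ?case
          using d(2)[of w] \<delta> unfolding hw by (cases "w = Complex u (a u)") auto
      qed
    qed
  qed
  have [measurable]: "(\<lambda>u. H (Complex u (a u))) \<in> borel_measurable borel"
    by (rule borel_measurable_LIMSEQ_real[where u = "\<lambda>n. h (ys n)"]) (use lim h_meas ys in auto)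
  have dct: "(\<lambda>n. \<integral>\<^sup>+u. ennreal (h (ys n) u) \<partial>lborel) \<longlonglongrightarrow> (\<integral>\<^sup>+u. ennreal (H (Complex u (a u))) \<partial>lborel)"
  proof (rule nn_integral_dominated_convergence[where w = "\<lambda>u. ennreal (B / (1 + u\<^sup>2))"])
    show "(\<integral>\<^sup>+u. ennreal (B / (1 + u\<^sup>2)) \<partial>lborel) < \<infinity>" using Wfin by (simp add: W_def)
  qed (use h_meas ys hb lim in \<open>auto intro!: ennreal_leI tendsto_ennrealI\<close>)
  have "(\<lambda>n. ennreal (1 + M) * (\<integral>\<^sup>+u. ennreal (h (ys n) u) \<partial>lborel)) \<longlonglongrightarrow> ennreal (1 + M) * (\<integral>\<^sup>+u. ennreal (H (Complex u (a u))) \<partial>lborel)"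
    by (rule ennreal_tendsto_cmult[OF _ dct]) simp
  then have "line_integral p f y \<le> ennreal (1 + M) * (\<integral>\<^sup>+u. ennreal (H (Complex u (a u))) \<partial>lborel)"
  proof (rule LIMSEQ_le_const)
    obtain N where N: "\<And>n. N \<le> n \<Longrightarrow> ys n < y"
      using order_tendstoD(2)[OF ys0 y] by (auto simp: eventually_sequentially)
    have "line_integral p f y \<le> ennreal (1 + M) * (\<integral>\<^sup>+u. ennreal (h (ys n) u) \<partial>lborel)"
      if "N \<le> n" for n
    proof (rule order_trans[OF _ I_le[OF ys]])
      show "line_integral p f y \<le> line_integral p f (ys n)"
        by (rule hardy_line_integral_antimono[where K = K])
          (use hardy_transfer_holomorphic[OF G] hardy_transfer_measurable[OF G] p K0 I_W K ys N[OF that] in \<open>auto simp: f_def\<close>)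
    qed
    then show "\<exists>N. \<forall>n\<ge>N. line_integral p f y \<le> ennreal (1 + M) * (\<integral>\<^sup>+u. ennreal (h (ys n) u) \<partial>lborel)"
      by blast
  qed
  then show ?thesis by (simp add: f_def H_def)
qed

end

text \<open>
  \<open>G n\<close> is \<open>F\<close> shifted upwards by \<open>1 / N\<close>, so that it is bounded and continuous up to the boundary,
  times a quadratically decaying factor \<open>\<eta> n\<close> with a pole below the region.  The factors are bounded
  by \<open>D\<close> uniformly in \<open>n\<close> and tend to \<open>1\<close>, so Fatou's lemma passes the bound on to \<open>F\<close>.
\<close>
lemma (in graph_conformal) hardy_transfer_bound:
  assumes p: "1 < p"
  obtains C where "0 \<le> C" "\<And>F K y. F holomorphic_on region_above a \<Longrightarrow> F \<in> borel_measurable borel \<Longrightarrow> 0 \<le> K \<Longrightarrow>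
    (\<And>\<tau>. 0 < \<tau> \<Longrightarrow> graph_integral p a F \<tau> \<le> ennreal K) \<Longrightarrow> 0 < y \<Longrightarrow>
    line_integral p (hardy_transfer p \<Phi> F) y \<le> ennreal (C * K)"
proof -
  define c where "c = min (1 / 2) (1 / (2 * M))"
  have c: "0 < c" "c \<le> 1 / 2" "c \<le> 1 / (2 * M)" using M_pos by (simp_all add: c_def)
  define D where "D = 1 / c\<^sup>2"
  have D0: "0 < D" using c by (simp add: D_def)
  define C where "C = (1 + M) * D powr p"
  have C0: "0 \<le> C" using M_pos by (simp add: C_def)
  have "line_integral p (hardy_transfer p \<Phi> F) y \<le> ennreal (C * K)"
    if F: "F holomorphic_on region_above a" and F_meas [measurable]: "F \<in> borel_measurable borel" and K0: "0 \<le> K"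
      and K: "\<And>\<tau>. 0 < \<tau> \<Longrightarrow> graph_integral p a F \<tau> \<le> ennreal K"
      and y: "0 < y" for F K y
  proof -
    \<comment> \<open>\<open>Suc\<close> keeps the shift \<open>1 / N n\<close> finite and positive\<close>
    define N where "N = (\<lambda>n. real (Suc n))"
    have N: "0 < N n" for n by (simp add: N_def)
    define Q where "Q = (\<lambda>n w. w - \<i> * of_real (a 0) + \<i> * of_real (N n))"
    define \<eta> where "\<eta> = (\<lambda>n w. (\<i> * of_real (N n) / Q n w)\<^sup>2)"
    define G where "G = (\<lambda>n w. F (w + \<i> * of_real (1 / N n)) * \<eta> n w)"
    have Q1: "c * N n \<le> norm (Q n w)" and Q2: "\<bar>Re w\<bar> \<le> norm (Q n w)" if w: "a (Re w) \<le> Im w" for n w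
    proof -
      have re: "Re (Q n w) = Re w" by (simp add: Q_def)
      show 2: "\<bar>Re w\<bar> \<le> norm (Q n w)" using abs_Re_le_cmod[of "Q n w"] re by simp
      show "c * N n \<le> norm (Q n w)"
      proof (cases "M * \<bar>Re w\<bar> \<le> N n / 2")
        case True
        have "N n / 2 \<le> Im (Q n w)"
          using lipschitz[of "Re w" 0] w True by (simp add: Q_def)
        moreover have "c * N n \<le> N n / 2" using mult_right_mono[OF c(2), of "N n"] N[of n] by simp
        ultimately show ?thesis using abs_Im_le_cmod[of "Q n w"] by simp
      next
        case False
        have "c * N n \<le> 1 / (2 * M) * N n" using N[of n] by (intro mult_right_mono c) auto
        also have "\<dots> \<le> \<bar>Re w\<bar>" using False M_pos by (simp add: field_simps)
        finally show ?thesis using 2 by simp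
      qed
    qed
    have Qne: "Q n w \<noteq> 0" if "a (Re w) \<le> Im w" for n w
      using Q1[OF that, of n] c(1) N[of n] by (auto simp: mult_le_0_iff)
    have n\<eta>: "norm (\<eta> n w) = (N n)\<^sup>2 / (norm (Q n w))\<^sup>2" for n w
      using N[of n] by (simp add: \<eta>_def norm_power norm_divide norm_mult power_divide)
    have \<eta>D: "norm (\<eta> n w) \<le> D" if w: "a (Re w) \<le> Im w" for n w
    proof -
      have "(c * N n)\<^sup>2 \<le> (norm (Q n w))\<^sup>2"
        using c N[of n] by (intro power_mono Q1[OF w]) auto
      then show ?thesis
        using c Qne[OF w, of n] by (simp add: n\<eta> D_def power_mult_distrib field_simps)
    qed
    have \<eta>u: "norm (\<eta> n w) \<le> (D + (N n)\<^sup>2) / (1 + (Re w)\<^sup>2)" if w: "a (Re w) \<le> Im w" for n w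
    proof -
      have "(Re w)\<^sup>2 \<le> (norm (Q n w))\<^sup>2" using power_mono[OF Q2[OF w, of n], of 2] by simp
      then have "norm (\<eta> n w) * (Re w)\<^sup>2 \<le> norm (\<eta> n w) * (norm (Q n w))\<^sup>2"
        by (intro mult_left_mono) auto
      also have "\<dots> = (N n)\<^sup>2" using Qne[OF w, of n] by (simp add: n\<eta>)
      finally have "norm (\<eta> n w) * (1 + (Re w)\<^sup>2) \<le> D + (N n)\<^sup>2"
        using \<eta>D[OF w, of n] by (simp add: algebra_simps)
      then show ?thesis by (subst pos_le_divide_eq) (auto simp: add_pos_nonneg)
    qed
    have sh: "a (Re (w + \<i> * of_real (1 / N n))) < Im (w + \<i> * of_real (1 / N n))" if "a (Re w) \<le> Im w" for n w
    proof -
      have "0 < 1 / N n" using N[of n] by simp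
      moreover have "Re (w + \<i> * of_real (1 / N n)) = Re w" "Im (w + \<i> * of_real (1 / N n)) = Im w + 1 / N n"
        by simp_all
      ultimately show ?thesis using that by (simp only:)
    qed
    have Gh: "G n holomorphic_on region_above a" for n
    proof -
      have "(\<lambda>w. F (w + \<i> * of_real (1 / N n))) holomorphic_on region_above a"
        by (rule holomorphic_on_compose_gen[OF _ F, unfolded o_def])
          (use sh in \<open>auto intro!: holomorphic_intros simp: mem_region simp del: plus_complex.sel\<close>)
      then show ?thesis
        unfolding G_def \<eta>_def Q_def
        by (intro holomorphic_intros) (use Qne in \<open>auto simp: mem_region Q_def\<close>)
    qed
    have Gc: "continuous_on {w. a (Re w) \<le> Im w} (G n)" for n
    proof -
      have "continuous_on {w. a (Re w) \<le> Im w} (\<lambda>w. F (w + \<i> * of_real (1 / N n)))"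
        by (rule continuous_on_compose2[OF holomorphic_on_imp_continuous_on[OF F]])
          (use sh in \<open>auto intro!: continuous_intros simp: mem_region simp del: plus_complex.sel\<close>)
      then show ?thesis
        unfolding G_def \<eta>_def Q_def
        by (intro continuous_intros) (use Qne in \<open>auto simp: Q_def\<close>)
    qed
    have step: "line_integral p (hardy_transfer p \<Phi> (G n)) y \<le> ennreal (C * K)" for n
    proof -
      obtain B where B: "\<And>w. a (Re w) + 1 / N n \<le> Im w \<Longrightarrow> norm (F w) \<le> B"
        by (rule bounded_away_from_boundary[OF F F_meas p K K0, of "1 / N n"]) (use N in auto)
      define B' where "B' = \<bar>B\<bar> powr p * (D powr (p - 1) * (D + (N n)\<^sup>2))"
      have "line_integral p (hardy_transfer p \<Phi> (G n)) y
          \<le> ennreal (1 + M) * (\<integral>\<^sup>+u. ennreal (norm (G n (Complex u (a u))) powr p) \<partial>lborel)"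
      proof (rule hardy_transfer_bound_decaying[OF Gh Gc p _ _ y])
        fix w assume w: "a (Re w) \<le> Im w"
        have "norm (F (w + \<i> * of_real (1 / N n))) \<le> \<bar>B\<bar>"
          using B[of "w + \<i> * of_real (1 / N n)"] w by simp
        then have 1: "norm (F (w + \<i> * of_real (1 / N n))) powr p \<le> \<bar>B\<bar> powr p"
          using p by (intro powr_mono2) auto
        have "norm (\<eta> n w) powr p = norm (\<eta> n w) powr (p - 1) * norm (\<eta> n w)"
          by (simp add: powr_mult_base mult.commute)
        also have "\<dots> \<le> D powr (p - 1) * ((D + (N n)\<^sup>2) / (1 + (Re w)\<^sup>2))"
          using p by (intro mult_mono \<eta>u[OF w] powr_mono2 \<eta>D[OF w]) auto
        finally have 2: "norm (\<eta> n w) powr p \<le> D powr (p - 1) * ((D + (N n)\<^sup>2) / (1 + (Re w)\<^sup>2))" .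
        have "norm (G n w) powr p = norm (F (w + \<i> * of_real (1 / N n))) powr p * norm (\<eta> n w) powr p"
          by (simp add: G_def norm_mult powr_mult)
        also have "\<dots> \<le> \<bar>B\<bar> powr p * (D powr (p - 1) * ((D + (N n)\<^sup>2) / (1 + (Re w)\<^sup>2)))"
          by (intro mult_mono 1 2) auto
        finally show "norm (G n w) powr p \<le> B' / (1 + (Re w)\<^sup>2)"
          by (simp add: B'_def)
      next
        show "0 \<le> B'" using D0 by (simp add: B'_def)
      qed
      also have "(\<integral>\<^sup>+u. ennreal (norm (G n (Complex u (a u))) powr p) \<partial>lborel)
          \<le> (\<integral>\<^sup>+u. ennreal (D powr p) * ennreal (norm (F (Complex u (a u + 1 / N n))) powr p) \<partial>lborel)"
      proof (rule nn_integral_mono)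
        fix u
        have e: "Complex u (a u) + \<i> * of_real (1 / N n) = Complex u (a u + 1 / N n)" by (simp add: complex_eq_iff)
        have "norm (G n (Complex u (a u))) powr p = norm (\<eta> n (Complex u (a u))) powr p * norm (F (Complex u (a u + 1 / N n))) powr p"
          by (simp only: G_def e norm_mult powr_mult norm_ge_zero mult.commute)
        also have "\<dots> \<le> D powr p * norm (F (Complex u (a u + 1 / N n))) powr p"
          using p by (intro mult_right_mono powr_mono2 \<eta>D) auto
        finally show "ennreal (norm (G n (Complex u (a u))) powr p) \<le> ennreal (D powr p) * ennreal (norm (F (Complex u (a u + 1 / N n))) powr p)"
          by (simp add: ennreal_leI flip: ennreal_mult)
      qed
      also have "\<dots> = ennreal (D powr p) * graph_integral p a F (1 / N n)"
        by (rule nn_integral_cmult) measurable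
      also have "\<dots> \<le> ennreal (D powr p) * ennreal K"
        by (intro mult_left_mono K) (use N in auto)
      finally have "line_integral p (hardy_transfer p \<Phi> (G n)) y
          \<le> ennreal (1 + M) * (ennreal (D powr p) * ennreal K)"
        by (simp add: mult_left_mono)
      also have "\<dots> = ennreal (C * K)"
      proof -
        have m: "0 \<le> 1 + M" "0 \<le> D powr p" using M_pos by auto
        show ?thesis unfolding C_def mult.assoc
          using m K0 by (simp only: ennreal_mult mult_nonneg_nonneg)
      qed
      finally show ?thesis .
    qed
    show ?thesis
    proof (rule nn_integral_le_if_tendsto[OF _ _ step])
      show "(\<lambda>x. ennreal (norm (hardy_transfer p \<Phi> (G n) (Complex x y)) powr p)) \<in> borel_measurable lborel" for n
      proof -
        have [measurable]: "hardy_transfer p \<Phi> (G n) \<in> borel_measurable borel"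
          by (rule hardy_transfer_measurable[OF Gh])
        show ?thesis by measurable
      qed
      fix x
      define w where "w = \<Phi> (Complex x y)"
      have w: "a (Re w) < Im w" unfolding w_def by (rule \<Phi>_region) (use y in simp)
      have inv: "(\<lambda>n. 1 / N n) \<longlonglongrightarrow> 0"
        unfolding N_def using LIMSEQ_inverse_real_of_nat by (simp add: inverse_eq_divide)
      have "isCont F w"
        using F open_region w
        by (meson continuous_on_eq_continuous_at holomorphic_on_imp_continuous_on mem_region)
      moreover have "(\<lambda>n. w + \<i> * of_real (1 / N n)) \<longlonglongrightarrow> w + \<i> * of_real 0"
        by (intro tendsto_intros inv)
      ultimately have 1: "(\<lambda>n. F (w + \<i> * of_real (1 / N n))) \<longlonglongrightarrow> F w"
        using isCont_tendsto_compose by fastforce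
      have "\<eta> n w = (\<i> / ((w - \<i> * of_real (a 0)) * of_real (1 / N n) + \<i>))\<^sup>2" for n
      proof -
        have Nne: "complex_of_real (N n) \<noteq> 0" using N[of n] by simp
        have "Q n w = of_real (N n) * ((w - \<i> * of_real (a 0)) * of_real (1 / N n) + \<i>)"
          using Nne by (simp add: Q_def field_simps)
        then show ?thesis using Nne by (simp add: \<eta>_def)
      qed
      moreover have "(\<lambda>n. (\<i> / ((w - \<i> * of_real (a 0)) * of_real (1 / N n) + \<i>))\<^sup>2) \<longlonglongrightarrow> (\<i> / ((w - \<i> * of_real (a 0)) * of_real 0 + \<i>))\<^sup>2"
        by (intro tendsto_intros inv) auto
      ultimately have 2: "(\<lambda>n. \<eta> n w) \<longlonglongrightarrow> 1" by simp
      have "(\<lambda>n. G n w) \<longlonglongrightarrow> F w * 1" unfolding G_def by (intro tendsto_mult 1 2)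
      then have "(\<lambda>n. hardy_transfer p \<Phi> (G n) (Complex x y)) \<longlonglongrightarrow> hardy_transfer p \<Phi> F (Complex x y)"
        using y unfolding hardy_transfer_def w_def[symmetric]
        by (simp add: mem_upper_half_plane tendsto_mult_right del: of_real_divide)
      then show "(\<lambda>n. ennreal (norm (hardy_transfer p \<Phi> (G n) (Complex x y)) powr p))
          \<longlonglongrightarrow> ennreal (norm (hardy_transfer p \<Phi> F (Complex x y)) powr p)"
        using p by (intro tendsto_ennrealI tendsto_powr' tendsto_norm tendsto_const) auto
    qed
  qed
  then show ?thesis using that C0 by blast
qed

section \<open>The angle estimate and boundedness of the inverse\<close>

text \<open>
  The exterior of a downward cone with vertex \<open>0\<close>, turned by a right angle: its opening is
  \<open>\<pi> + 2 arctan M\<close>.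
\<close>
lemma abs_Im_Ln_le_in_cone:
  assumes q: "q \<noteq> 0" and cone: "- M * \<bar>Im q\<bar> \<le> Re q" and M: "0 < M"
  shows "\<bar>Im (Ln q)\<bar> \<le> pi / 2 + arctan M"
proof (cases "0 \<le> Re q")
  case True
  then show ?thesis using Re_Ln_pos_le[OF q] M by (simp add: add_increasing2)
next
  case False
  then have im: "Im q \<noteq> 0" using cone by auto
  define x where "x = Im q / Re q"
  have x: "x \<noteq> 0" using im False by (simp add: x_def)
  have inv: "1 / x = Re q / Im q" by (simp add: x_def)
  have at: "arctan x = sgn x * pi / 2 - arctan (1 / x)"
    using Transcendental.arctan_inverse[OF x] by simp
  show ?thesis
  proof (cases "0 < Im q")
    case True
    then have "x < 0" using False by (simp add: x_def divide_less_0_iff)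
    moreover have "Im (Ln q) = arctan x + pi" using Im_Ln_eq[OF q] True False by (simp add: x_def)
    ultimately have e: "Im (Ln q) = pi / 2 - arctan (1 / x)" using at by simp
    have "- M \<le> 1 / x" using cone True by (simp add: inv field_simps)
    then have "- arctan M \<le> arctan (1 / x)" by (metis arctan_le_iff arctan_minus)
    moreover have "0 < Im (Ln q)" using Im_Ln_pos_lt_imp[OF True] by simp
    ultimately show ?thesis using e by simp
  next
    case neg: False
    then have "x > 0" using False im by (simp add: x_def divide_pos_neg divide_neg_neg)
    moreover have "Im (Ln q) = arctan x - pi" using Im_Ln_eq[OF q] neg False im by (simp add: x_def)
    ultimately have e: "Im (Ln q) = - (pi / 2) - arctan (1 / x)" using at by simp
    have "1 / x \<le> M" using cone neg im by (simp add: inv field_simps)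
    then have "arctan (1 / x) \<le> arctan M" by (simp add: arctan_le_iff)
    moreover have "- (pi / 2) < arctan (1 / x)" by (rule arctan_lbound)
    ultimately show ?thesis using e by simp
  qed
qed

lemma Re_powr_ge_in_cone:
  fixes q :: complex
  assumes q: "q \<noteq> 0" and cone: "- M * \<bar>Im q\<bar> \<le> Re q" and M: "0 < M"
    and \<beta>: "0 \<le> \<beta>" "\<beta> * (pi / 2 + arctan M) \<le> pi"
  shows "cos (\<beta> * (pi / 2 + arctan M)) * norm q powr \<beta> \<le> Re (q powr of_real \<beta>)"
proof -
  have "Re (q powr of_real \<beta>) = norm q powr \<beta> * cos (\<beta> * Im (Ln q))"
    using q by (simp add: powr_def Re_exp)
  also have "cos (\<beta> * Im (Ln q)) = cos (\<beta> * \<bar>Im (Ln q)\<bar>)"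
    using \<beta>(1) by (metis abs_mult abs_of_nonneg cos_abs_real)
  finally have e: "Re (q powr of_real \<beta>) = norm q powr \<beta> * cos (\<beta> * \<bar>Im (Ln q)\<bar>)" .
  have "cos (\<beta> * (pi / 2 + arctan M)) \<le> cos (\<beta> * \<bar>Im (Ln q)\<bar>)"
    using \<beta> abs_Im_Ln_le_in_cone[OF q cone M] by (intro cos_monotone_0_pi_le mult_left_mono) auto
  then show ?thesis unfolding e by (simp add: mult.commute mult_left_mono)
qed

lemma nn_integral_powr_tail:
  fixes c \<gamma> :: real
  assumes c: "0 < c" and \<gamma>: "1 < \<gamma>"
  shows "(\<integral>\<^sup>+x. ennreal ((c / \<bar>x - x0\<bar>) powr \<gamma>) * indicator {x. c \<le> \<bar>x - x0\<bar>} x \<partial>lborel) \<le> ennreal (2 * c / (\<gamma> - 1))"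
proof -
  define f where "f = (\<lambda>x::real. (c / \<bar>x\<bar>) powr \<gamma>)"
  have [measurable]: "f \<in> borel_measurable borel" unfolding f_def by measurable
  define J where "J = (\<integral>\<^sup>+x. ennreal (f x) * indicator {c..} x \<partial>lborel)"
  define F where "F = (\<lambda>x::real. - (c powr \<gamma> / (\<gamma> - 1)) * x powr (1 - \<gamma>))"
  have "J = ennreal (0 - F c)"
    unfolding J_def
  proof (rule nn_integral_FTC_atLeast)
    fix x assume x: "c \<le> x"
    have "(F has_real_derivative - (c powr \<gamma> / (\<gamma> - 1)) * ((1 - \<gamma>) * x powr (1 - \<gamma> - 1))) (at x)"
      unfolding F_def using x c by (intro DERIV_cmult has_real_derivative_powr) auto
    also have "- (c powr \<gamma> / (\<gamma> - 1)) * ((1 - \<gamma>) * x powr (1 - \<gamma> - 1)) = f x"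
      using x c \<gamma> by (simp add: f_def powr_divide powr_minus_divide field_simps)
    finally show "(F has_real_derivative f x) (at x)" .
    show "0 \<le> f x" by (simp add: f_def)
  next
    have "((\<lambda>x. x powr (1 - \<gamma>)) \<longlongrightarrow> 0) at_top"
      by (rule tendsto_neg_powr) (use \<gamma> in \<open>auto simp: filterlim_ident\<close>)
    then show "(F \<longlongrightarrow> 0) at_top"
      unfolding F_def by (rule tendsto_mult_right_zero)
  qed simp
  also have "0 - F c = c / (\<gamma> - 1)"
    using c \<gamma> by (simp add: F_def flip: powr_add)
  finally have J: "J = ennreal (c / (\<gamma> - 1))" .
  have aff: "(\<integral>\<^sup>+x. ennreal (f (x - x0)) * indicator {c..} (k * (x - x0)) \<partial>lborel) = J" if k: "k = 1 \<or> k = -1" for k :: real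
  proof -
    have "(\<integral>\<^sup>+x. ennreal (f (x - x0)) * indicator {c..} (k * (x - x0)) \<partial>lborel)
       = ennreal \<bar>k\<bar> * (\<integral>\<^sup>+x. ennreal (f ((x0 + k * x) - x0)) * indicator {c..} (k * ((x0 + k * x) - x0)) \<partial>lborel)"
      by (rule nn_integral_real_affine[where f = "\<lambda>x. ennreal (f (x - x0)) * indicator {c..} (k * (x - x0))"])
        (use k in auto)
    also have "\<dots> = J" using k by (auto simp: J_def f_def)
    finally show ?thesis .
  qed
  have "(\<integral>\<^sup>+x. ennreal ((c / \<bar>x - x0\<bar>) powr \<gamma>) * indicator {x. c \<le> \<bar>x - x0\<bar>} x \<partial>lborel)
      \<le> (\<integral>\<^sup>+x. ennreal (f (x - x0)) * indicator {c..} (1 * (x - x0)) + ennreal (f (x - x0)) * indicator {c..} ((-1) * (x - x0)) \<partial>lborel)"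
    by (rule nn_integral_mono) (auto simp: f_def indicator_def abs_if split: if_splits)
  also have "\<dots> = J + J"
    by (subst nn_integral_add) (use aff[of 1] aff[of "-1"] in auto)
  also have "\<dots> = ennreal (2 * c / (\<gamma> - 1))"
    using c \<gamma> by (simp add: J flip: ennreal_plus)
  finally show ?thesis .
qed

context graph_conformal
begin

text \<open>
  With \<open>\<theta> = Arg (\<Psi> w - t)\<close>, the left-hand side is \<open>sin \<theta>\<close> at \<open>w = u + i (a(u) + \<tau>)\<close>.  Suppose
  \<open>u > u0\<close>.  Near \<open>\<zeta> = u + i a(u)\<close>, up to the distance \<open>\<rho> = \<bar>u - u0\<bar> / 2\<close>, the harmonic function \<open>\<theta>\<close>
  vanishes on the graph, and it never exceeds \<open>\<pi>\<close>.  The barrier \<open>b Re (q\<^sup>\<beta>)\<close>, where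
  \<open>q = -i (w - \<zeta>)\<close>, is nonnegative on the graph and at least \<open>\<pi>\<close> at distance \<open>\<rho>\<close>, because the region
  lies in a cone on which \<open>Re (q\<^sup>\<beta>)\<close> is at least \<open>\<kappa> \<bar>q\<bar>\<^sup>\<beta>\<close>.  So \<open>\<theta>\<close> is below the barrier, whose value at
  \<open>w\<close> is \<open>b \<tau>\<^sup>\<beta>\<close>.  For \<open>u < u0\<close> the same argument applies to \<open>\<pi> - \<theta>\<close>; the sign \<open>s\<close> covers both cases.
\<close>
lemma sin_angle_le:
  assumes t: "\<Phi> (of_real t) = Complex u0 (a u0)" and u: "2 * \<tau> < \<bar>u - u0\<bar>" and \<tau>: "0 < \<tau>"
    and \<beta>: "0 < \<beta>" "\<beta> * (pi / 2 + arctan M) < pi / 2"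
  shows "Im (\<Psi> (Complex u (a u + \<tau>))) / norm (\<Psi> (Complex u (a u + \<tau>)) - of_real t)
    \<le> pi / cos (\<beta> * (pi / 2 + arctan M)) * (2 * \<tau> / \<bar>u - u0\<bar>) powr \<beta>"
proof -
  define \<kappa> where "\<kappa> = cos (\<beta> * (pi / 2 + arctan M))"
  have am: "0 < arctan M" using M_pos by simp
  have \<kappa>: "0 < \<kappa>" unfolding \<kappa>_def
    by (rule cos_gt_zero_pi) (use \<beta> am in \<open>auto intro!: less_le_trans[OF _ mult_nonneg_nonneg]\<close>)
  define \<zeta> where "\<zeta> = Complex u (a u)"
  define \<rho> where "\<rho> = \<bar>u - u0\<bar> / 2"
  have \<rho>: "0 < \<rho>" "\<tau> < \<rho>" using u \<tau> by (simp_all add: \<rho>_def)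
  define s where "s = (if u0 < u then 1 else -1 :: real)"
  have s: "s = 1 \<or> s = -1" by (simp add: s_def)
  define b where "b = pi / (\<kappa> * \<rho> powr \<beta>)"
  have b: "0 < b" using \<kappa> \<rho> by (simp add: b_def)
  define q where "q = (\<lambda>w. - \<i> * (w - \<zeta>))"
  \<comment> \<open>the rotation makes \<open>Im (L w) = \<theta> - \<pi> / 2\<close> continuous up to the boundary\<close>
  define L where "L = (\<lambda>w. Ln (- \<i> * (\<Psi> w - of_real t)))"
  \<comment> \<open>\<open>ln \<bar>E\<bar> + \<pi> / 2\<close> is the angle minus the barrier, so the maximum modulus principle compares the two\<close>
  define E where "E = (\<lambda>w. exp (- of_real s * \<i> * L w - of_real b * q w powr of_real \<beta>))"
  define R where "R = region_above a \<inter> ball \<zeta> \<rho>"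
  define C where "C = {w. a (Re w) \<le> Im w} \<inter> cball \<zeta> \<rho>"
  have t_eq: "\<Psi> (Complex u0 (a u0)) = of_real t" using \<Psi>_\<Phi>[of "of_real t"] t by simp
  have RC: "closure R \<subseteq> C"
  proof (rule closure_minimal)
    have "closed {w. a (Re w) \<le> Im w}" by (intro closed_Collect_le continuous_intros)
    then show "closed C" unfolding C_def by (intro closed_Int) auto
  qed (auto simp: R_def C_def mem_region)
  have oR: "open R" unfolding R_def by (intro open_Int open_region open_ball)
  have near: "\<bar>Re w - u\<bar> \<le> \<rho>" if "w \<in> C" for w
  proof -
    have "\<bar>Re (w - \<zeta>)\<bar> \<le> norm (w - \<zeta>)" by (rule abs_Re_le_cmod)
    then show ?thesis using that by (simp add: C_def \<zeta>_def dist_norm norm_minus_commute)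
  qed
  have Imnn: "0 \<le> Im (\<Psi> w)" if w: "a (Re w) \<le> Im w" for w
  proof (cases "a (Re w) = Im w")
    case True
    then have "w = Complex (Re w) (a (Re w))" by (simp add: complex_eq_iff)
    then show ?thesis by (metis \<Psi>_graph Im_complex_of_real order_refl)
  next
    case False
    then show ?thesis using w Im_\<Psi>_pos[of w] by simp
  qed
  have net: "\<Psi> w \<noteq> of_real t" if w: "w \<in> C" for w
  proof
    assume "\<Psi> w = of_real t"
    then have "w = Complex u0 (a u0)" using \<Phi>_\<Psi>[of w] w t by (simp add: C_def)
    then show False using near[OF w] \<rho> by (simp add: \<rho>_def abs_minus_commute)
  qed
  have nonpos: "- \<i> * (\<Psi> w - of_real t) \<notin> \<real>\<^sub>\<le>\<^sub>0" if w: "w \<in> C" for w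
    using Imnn[of w] net[OF w] w by (auto simp: complex_nonpos_Reals_iff C_def complex_eq_iff)
  have cone: "- M * \<bar>Im (q w)\<bar> \<le> Re (q w)" if "a (Re w) \<le> Im w" for w
    using lipschitz[of "Re w" u] that by (simp add: q_def \<zeta>_def abs_minus_commute)
  have \<beta>pi: "\<beta> * (pi / 2 + arctan M) \<le> pi" using \<beta> pi_gt_zero by linarith
  have qlow: "\<kappa> * norm (w - \<zeta>) powr \<beta> \<le> Re (q w powr of_real \<beta>)" if "a (Re w) \<le> Im w" for w
  proof (cases "q w = 0")
    case False
    have "norm (q w) = norm (w - \<zeta>)" by (simp add: q_def norm_mult)
    then show ?thesis
      using Re_powr_ge_in_cone[OF False cone[OF that] M_pos _ \<beta>pi] \<beta> by (simp add: \<kappa>_def)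
  next
    case True
    then have "w = \<zeta>" by (simp add: q_def)
    then show ?thesis using True by simp
  qed
  have sL: "s * Im (L w) \<le> pi / 2" if w: "w \<in> C" for w
  proof -
    have "\<bar>Im (L w)\<bar> \<le> pi / 2"
      unfolding L_def by (subst Re_Ln_pos_le) (use Imnn[of w] net[OF w] w in \<open>auto simp: C_def\<close>)
    then show ?thesis using s by auto
  qed
  have normE: "norm (E w) = exp (s * Im (L w) - b * Re (q w powr of_real \<beta>))" for w
    by (simp add: E_def norm_exp_eq_Re)
  have bd: "norm (E w) \<le> exp (- pi / 2)" if w: "w \<in> frontier R" for w
  proof -
    have wC: "w \<in> C" using w RC by (auto simp: frontier_def)
    have wr: "a (Re w) \<le> Im w" using wC by (simp add: C_def)
    have wR: "w \<notin> R" using w oR by (simp add: frontier_def interior_open)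
    have "s * Im (L w) - b * Re (q w powr of_real \<beta>) \<le> - pi / 2"
    proof (cases "norm (w - \<zeta>) = \<rho>")
      case True
      have "pi = b * (\<kappa> * norm (w - \<zeta>) powr \<beta>)" using \<kappa> \<rho> by (simp add: True b_def)
      also have "\<dots> \<le> b * Re (q w powr of_real \<beta>)" using b by (intro mult_left_mono qlow[OF wr]) auto
      finally show ?thesis using sL[OF wC] by simp
    next
      case False
      then have "norm (w - \<zeta>) < \<rho>" using wC by (simp add: C_def dist_norm norm_minus_commute)
      then have "a (Re w) = Im w"
        using wR wr by (auto simp: R_def mem_region dist_norm norm_minus_commute)
      then have weq: "w = Complex (Re w) (a (Re w))" by (simp add: complex_eq_iff)
      obtain x where x: "\<Psi> (Complex (Re w) (a (Re w))) = of_real x" "\<Phi> (of_real x) = Complex (Re w) (a (Re w))"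
        by (rule \<Psi>_graph)
      have \<Psi>w: "\<Psi> w = of_real x" using x(1) weq by simp
      have rx: "Re (\<Phi> (of_real x)) = Re w" "Re (\<Phi> (of_real t)) = u0" using x(2) t by simp_all
      have "0 < s * (x - t)"
      proof (cases "u0 < u")
        case True
        then have "u0 < Re w" using near[OF wC] \<rho> by (auto simp: \<rho>_def abs_if split: if_splits)
        then have "t < x" using strict_mono_less[OF increasing, of t x] rx by simp
        then show ?thesis using True by (simp add: s_def)
      next
        case False
        then have "Re w < u0" using near[OF wC] \<rho> u \<tau> by (auto simp: \<rho>_def abs_if split: if_splits)
        then have "x < t" using strict_mono_less[OF increasing, of x t] rx by simp
        then show ?thesis using False by (simp add: s_def)
      qed
      moreover have "L w = Ln (Complex 0 (-(x - t)))"
        unfolding L_def \<Psi>w by (rule arg_cong[of _ _ Ln]) (simp add: complex_eq_iff)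
      ultimately have "s * Im (L w) = - pi / 2"
        using s by (auto simp: Im_Ln_eq complex_eq_iff)
      moreover have "0 \<le> b * Re (q w powr of_real \<beta>)"
        using b \<kappa> by (intro mult_nonneg_nonneg order_trans[OF _ qlow[OF wr]]) auto
      ultimately show ?thesis by simp
    qed
    then show ?thesis unfolding normE by simp
  qed
  have qcont: "continuous_on C (\<lambda>w. q w powr of_real \<beta>)"
  proof (rule continuous_on_powr_complex)
    show "C \<subseteq> {z. 0 \<le> Re (q z) \<or> Im (q z) \<noteq> 0}"
      using cone by (fastforce simp: C_def)
    show "continuous_on C q" unfolding q_def by (intro continuous_intros)
  qed (use \<beta> in auto)
  have Lcont: "continuous_on C L"
    unfolding L_def
    by (intro continuous_on_Ln' continuous_intros continuous_on_subset[OF continuous_on_\<Psi>] nonpos) (auto simp: C_def)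
  define w where "w = Complex u (a u + \<tau>)"
  have wR: "w \<in> R" using \<tau> \<rho> by (simp add: w_def R_def mem_region \<zeta>_def dist_norm cmod_def)
  then have wC: "w \<in> C" by (auto simp: R_def C_def mem_region)
  have "norm (E w) \<le> exp (- pi / 2)"
  proof (rule maximum_modulus_frontier[of E R])
    have Rr: "R \<subseteq> region_above a" by (simp add: R_def)
    have RC': "R \<subseteq> C" using RC closure_subset by blast
    have qne: "q z \<notin> \<real>\<^sub>\<le>\<^sub>0" if z: "z \<in> R" for z
    proof
      assume "q z \<in> \<real>\<^sub>\<le>\<^sub>0"
      then have "Im (q z) = 0" "Re (q z) \<le> 0" by (auto simp: complex_nonpos_Reals_iff)
      then show False using z by (auto simp: q_def \<zeta>_def R_def mem_region)
    qed
    have hq: "(\<lambda>w. q w powr of_real \<beta>) holomorphic_on R"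
      using qne unfolding q_def by (intro holomorphic_on_powr holomorphic_intros) auto
    have hL: "L holomorphic_on R"
      unfolding L_def
      by (intro holomorphic_on_Ln' holomorphic_intros holomorphic_on_subset[OF \<Psi>_holomorphic Rr]) (use nonpos RC' in auto)
    have "E holomorphic_on R"
      unfolding E_def
      by (intro holomorphic_on_exp' holomorphic_on_diff holomorphic_on_mult holomorphic_on_const hq hL)
    then show "E holomorphic_on interior R" using oR by (simp add: interior_open)
    show "continuous_on (closure R) E"
      unfolding E_def
      by (intro continuous_on_exp continuous_on_diff continuous_on_mult continuous_on_const
          continuous_on_subset[OF Lcont RC] continuous_on_subset[OF qcont RC])
    show "bounded R" unfolding R_def by (intro bounded_Int) auto
  qed (use bd wR in auto)
  then have key: "s * Im (L w) + pi / 2 \<le> b * Re (q w powr of_real \<beta>)"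
    unfolding normE by simp
  have "Re (q w powr of_real \<beta>) \<le> norm (q w powr of_real \<beta>)" by (rule complex_Re_le_cmod)
  also have "\<dots> = \<tau> powr \<beta>"
  proof -
    have "q w = of_real \<tau>" by (simp add: q_def w_def \<zeta>_def complex_eq_iff)
    then show ?thesis using \<tau> by (simp add: norm_powr_of_real)
  qed
  finally have "b * Re (q w powr of_real \<beta>) \<le> b * \<tau> powr \<beta>" using b by simp
  also have "\<dots> = pi / \<kappa> * (\<tau> / \<rho>) powr \<beta>"
    using \<tau> \<rho> by (simp add: b_def powr_divide)
  finally have fin: "s * Im (L w) + pi / 2 \<le> pi / \<kappa> * (\<tau> / \<rho>) powr \<beta>"
    using key by simp
  define v where "v = - \<i> * (\<Psi> w - of_real t)"
  have v0: "v \<noteq> 0" using net[OF wC] by (simp add: v_def)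
  have absL: "\<bar>Im (Ln v)\<bar> \<le> pi / 2"
    using sL[OF wC] by (subst Re_Ln_pos_le[OF v0]) (use wC Imnn[of w] in \<open>simp add: v_def C_def\<close>)
  have "Im (\<Psi> w) / norm (\<Psi> w - of_real t) = Re v / norm v"
    by (simp add: v_def norm_mult)
  also have "\<dots> = cos (Im (Ln v))"
  proof -
    have "Re v = Re (exp (Ln v))" using v0 by simp
    also have "\<dots> = norm v * cos (Im (Ln v))" using v0 by (simp only: Re_exp Re_Ln) simp
    finally show ?thesis using v0 by simp
  qed
  also have "\<dots> = sin (s * Im (Ln v) + pi / 2)"
    using s by (auto simp: sin_add)
  also have "\<dots> \<le> s * Im (Ln v) + pi / 2"
    by (rule sin_x_le_x) (use absL s in auto)
  also have "\<dots> \<le> pi / \<kappa> * (\<tau> / \<rho>) powr \<beta>" using fin by (simp add: L_def v_def)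
  also have "\<tau> / \<rho> = 2 * \<tau> / \<bar>u - u0\<bar>" by (simp add: \<rho>_def)
  finally show ?thesis by (simp add: w_def \<kappa>_def)
qed

end

context graph_conformal
begin

lemma continuous_on_\<Psi>_above_graph:
  assumes "0 < \<tau>"
  shows "continuous_on A (\<lambda>u. \<Psi> (Complex u (a u + \<tau>)))"
    and "continuous_on A (\<lambda>u. deriv \<Psi> (Complex u (a u + \<tau>)))"
proof -
  have c: "continuous_on A (\<lambda>u. Complex u (a u + \<tau>))"
    unfolding Complex_eq by (intro continuous_intros)
  show "continuous_on A (\<lambda>u. \<Psi> (Complex u (a u + \<tau>)))"
    by (rule continuous_on_compose2[OF continuous_on_\<Psi> c]) (use assms in auto)
  show "continuous_on A (\<lambda>u. deriv \<Psi> (Complex u (a u + \<tau>)))"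
    by (rule continuous_on_compose2[OF holomorphic_on_imp_continuous_on[OF holomorphic_deriv[OF \<Psi>_holomorphic open_region]] c])
      (use assms in \<open>auto simp: mem_region\<close>)
qed

abbreviation pulled_kernel :: "real \<Rightarrow> real \<Rightarrow> real \<Rightarrow> real" where
  "pulled_kernel t \<tau> u \<equiv>
    poisson_kernel (\<Psi> (Complex u (a u + \<tau>))) t * norm (deriv \<Psi> (Complex u (a u + \<tau>)))"

text \<open>
  The Poisson kernel at \<open>\<Psi> w\<close> is \<open>(sin \<theta>)\<^sup>2 / (\<pi> Im (\<Psi> w))\<close>, and by Schwarz-Pick on the disc of radius
  \<open>\<tau> / (1 + M)\<close> the quotient \<open>\<bar>\<Psi>' w\<bar> / Im (\<Psi> w)\<close> is at most \<open>2 (1 + M) / \<tau>\<close>.  The factor \<open>1 / \<tau>\<close>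
  cancels against the integral of \<open>(sin \<theta>)\<^sup>2\<close>, which is \<open>O(\<tau>)\<close> by the angle estimate with
  \<open>2 \<beta> > 1\<close>.
\<close>
lemma poisson_pullback_integral_bound:
  obtains C where "0 \<le> C" "\<And>t \<tau>. 0 < \<tau> \<Longrightarrow>
    (\<integral>\<^sup>+u. ennreal (pulled_kernel t \<tau> u) \<partial>lborel) \<le> ennreal C"
proof -
  define A where "A = pi / 2 + arctan M"
  have A: "pi / 2 < A" "A < pi" using M_pos arctan_ubound[of M] by (simp_all add: A_def)
  have A0: "0 < A" using A pi_gt_zero by linarith
  \<comment> \<open>the midpoint of the admissible interval for \<open>\<beta>\<close>, nonempty because \<open>A < \<pi>\<close>\<close>
  define \<beta> where "\<beta> = (1 / 2 + pi / (2 * A)) / 2"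
  have "1 / 2 < pi / (2 * A)" using A A0 by (simp add: field_simps)
  then have \<beta>: "1 / 2 < \<beta>" "\<beta> < pi / (2 * A)" by (simp_all add: \<beta>_def)
  then have \<beta>A: "\<beta> * A < pi / 2" using A0 by (simp add: field_simps)
  define \<kappa> where "\<kappa> = cos (\<beta> * A)"
  define k where "k = (pi / \<kappa>)\<^sup>2"
  have k0: "0 \<le> k" by (simp add: k_def)
  define C where "C = 2 * (1 + M) / pi * (4 + k * (4 / (2 * \<beta> - 1)))"
  have C0: "0 \<le> C" using M_pos \<beta> k0 by (simp add: C_def)
  have "(\<integral>\<^sup>+u. ennreal (pulled_kernel t \<tau> u) \<partial>lborel) \<le> ennreal C"
    if \<tau>: "0 < \<tau>" for t \<tau>
  proof -
    define u0 where "u0 = Re (\<Phi> (of_real t))"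
    have t: "\<Phi> (of_real t) = Complex u0 (a u0)" unfolding u0_def by (rule \<Phi>_of_real)
    define c where "c = 2 * (1 + M) / (pi * \<tau>)"
    have c0: "0 \<le> c" using M_pos \<tau> by (simp add: c_def)
    define m where "m = (\<lambda>u. (indicator {u0 - 2 * \<tau>..u0 + 2 * \<tau>} u :: ennreal)
      + ennreal k * (ennreal ((2 * \<tau> / \<bar>u - u0\<bar>) powr (2 * \<beta>)) * indicator {u. 2 * \<tau> \<le> \<bar>u - u0\<bar>} u))"
    have pw: "ennreal (pulled_kernel t \<tau> u) \<le> ennreal c * m u" for u
    proof -
      define w where "w = Complex u (a u + \<tau>)"
      have w: "a (Re w) < Im w" using \<tau> by (simp add: w_def)
      define y where "y = Im (\<Psi> w)"
      define d where "d = norm (\<Psi> w - of_real t)"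
      have y: "0 < y" unfolding y_def by (rule Im_\<Psi>_pos[OF w])
      have yd: "y \<le> d" using abs_Im_le_cmod[of "\<Psi> w - of_real t"] by (simp add: y_def d_def)
      have d: "0 < d" using y yd by simp
      define r where "r = \<tau> / (1 + M)"
      have r: "0 < r" using \<tau> M_pos by (simp add: r_def)
      have sub: "ball w r \<subseteq> region_above a"
        by (rule ball_subset_region) (use M_pos in \<open>simp add: r_def w_def\<close>)
      have "norm (deriv \<Psi> w) * r \<le> 2 * y"
        unfolding y_def
        by (rule schwarz_pick_deriv[OF holomorphic_on_subset[OF \<Psi>_holomorphic sub] r])
          (use sub Im_\<Psi>_pos in \<open>auto simp: mem_region\<close>)
      then have dl: "norm (deriv \<Psi> w) \<le> 2 * y * (1 + M) / \<tau>"
        using \<tau> M_pos by (simp add: r_def field_simps)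
      have "poisson_kernel (\<Psi> w) t * norm (deriv \<Psi> w) = y / (pi * d\<^sup>2) * norm (deriv \<Psi> w)"
        by (simp add: poisson_kernel_def y_def d_def norm_minus_commute)
      also have "\<dots> \<le> y / (pi * d\<^sup>2) * (2 * y * (1 + M) / \<tau>)"
        using y d by (intro mult_left_mono dl) auto
      also have "\<dots> = c * (y / d)\<^sup>2"
      proof -
        have "y / (pi * d\<^sup>2) * (2 * y * A / \<tau>) = 2 * A / (pi * \<tau>) * (y / d)\<^sup>2" for A
          by (simp add: power2_eq_square mult_ac)
        then show ?thesis by (simp only: c_def)
      qed
      finally have 1: "poisson_kernel (\<Psi> w) t * norm (deriv \<Psi> w) \<le> c * (y / d)\<^sup>2" .
      have 2: "ennreal ((y / d)\<^sup>2) \<le> m u"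
      proof (cases "\<bar>u - u0\<bar> \<le> 2 * \<tau>")
        case True
        have "(y / d)\<^sup>2 \<le> 1"
          by (rule power_le_one) (use y yd d in auto)
        then have "ennreal ((y / d)\<^sup>2) \<le> 1"
          by (metis ennreal_1 ennreal_leI)
        also have "1 \<le> m u"
        proof -
          have "indicator {u0 - 2 * \<tau>..u0 + 2 * \<tau>} u = (1::ennreal)"
            using True by (subst indicator_simps(1)) auto
          then show ?thesis unfolding m_def by (simp only: add_increasing2 order_refl zero_le)
        qed
        finally show ?thesis .
      next
        case False
        have "y / d \<le> pi / \<kappa> * (2 * \<tau> / \<bar>u - u0\<bar>) powr \<beta>"
          unfolding y_def d_def w_def \<kappa>_def A_def
          by (rule sin_angle_le[OF t _ \<tau>]) (use False \<beta> \<beta>A in \<open>auto simp: A_def\<close>)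
        then have "(y / d)\<^sup>2 \<le> (pi / \<kappa> * (2 * \<tau> / \<bar>u - u0\<bar>) powr \<beta>)\<^sup>2"
          using y d by (intro power_mono) auto
        also have "\<dots> = k * (2 * \<tau> / \<bar>u - u0\<bar>) powr (2 * \<beta>)"
          unfolding k_def power_mult_distrib
          by (simp only: power2_eq_square powr_add[symmetric] mult_2[symmetric])
        finally have "ennreal ((y / d)\<^sup>2) \<le> ennreal (k * (2 * \<tau> / \<bar>u - u0\<bar>) powr (2 * \<beta>))"
          by (rule ennreal_leI)
        also have "\<dots> = ennreal k * (ennreal ((2 * \<tau> / \<bar>u - u0\<bar>) powr (2 * \<beta>)) * 1)"
          unfolding mult_1_right by (rule ennreal_mult) (use k0 in auto)
        also have "1 = (indicator {u. 2 * \<tau> \<le> \<bar>u - u0\<bar>} u :: ennreal)"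
          using False by (subst indicator_simps(1)) auto
        also have "ennreal k * (ennreal ((2 * \<tau> / \<bar>u - u0\<bar>) powr (2 * \<beta>)) * indicator {u. 2 * \<tau> \<le> \<bar>u - u0\<bar>} u) \<le> m u"
          unfolding m_def by (simp only: add_increasing order_refl zero_le)
        finally show ?thesis .
      qed
      have "ennreal (poisson_kernel (\<Psi> w) t * norm (deriv \<Psi> w)) \<le> ennreal c * ennreal ((y / d)\<^sup>2)"
        using ennreal_leI[OF 1] unfolding ennreal_mult[OF c0 zero_le_power2] .
      also have "\<dots> \<le> ennreal c * m u" by (rule mult_left_mono[OF 2]) simp
      finally show ?thesis unfolding w_def .
    qed
    have "(\<integral>\<^sup>+u. ennreal (pulled_kernel t \<tau> u) \<partial>lborel)
        \<le> (\<integral>\<^sup>+u. ennreal c * m u \<partial>lborel)"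
      by (rule nn_integral_mono) (rule pw)
    also have "\<dots> = ennreal c * (ennreal (4 * \<tau>) + ennreal k *
        (\<integral>\<^sup>+u. ennreal ((2 * \<tau> / \<bar>u - u0\<bar>) powr (2 * \<beta>)) * indicator {u. 2 * \<tau> \<le> \<bar>u - u0\<bar>} u \<partial>lborel))"
      using \<tau> unfolding m_def by (simp add: nn_integral_cmult nn_integral_add)
    also have "\<dots> \<le> ennreal c * (ennreal (4 * \<tau>) + ennreal k * ennreal (2 * (2 * \<tau>) / (2 * \<beta> - 1)))"
      by (intro mult_left_mono add_left_mono nn_integral_powr_tail) (use \<tau> \<beta> in auto)
    also have "\<dots> = ennreal (c * (4 * \<tau> + k * (2 * (2 * \<tau>) / (2 * \<beta> - 1))))"
    proof -
      have X: "0 \<le> 2 * (2 * \<tau>) / (2 * \<beta> - 1)" "0 \<le> 4 * \<tau>" using \<tau> \<beta> by auto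
      show ?thesis
        using c0 k0 X by (simp only: ennreal_mult ennreal_plus mult_nonneg_nonneg add_nonneg_nonneg)
    qed
    also have "c * (4 * \<tau> + k * (2 * (2 * \<tau>) / (2 * \<beta> - 1))) = (c * \<tau>) * (4 + k * (4 / (2 * \<beta> - 1)))"
      by (simp add: algebra_simps)
    also have "c * \<tau> = 2 * (1 + M) / pi" using \<tau> by (simp add: c_def)
    also have "2 * (1 + M) / pi * (4 + k * (4 / (2 * \<beta> - 1))) = C" by (simp only: C_def)
    finally show ?thesis .
  qed
  then show ?thesis using that C0 by blast
qed

definition hardy_pullback :: "real \<Rightarrow> (complex \<Rightarrow> complex) \<Rightarrow> complex \<Rightarrow> complex" where
  "hardy_pullback p f w =
    (if w \<in> region_above a then f (\<Psi> w) / deriv \<Phi> (\<Psi> w) powr complex_of_real (1 / p) else 0)"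

lemma hardy_pullback_holomorphic:
  assumes f: "f holomorphic_on upper_half_plane"
  shows "hardy_pullback p f holomorphic_on region_above a"
proof -
  have im: "\<Psi> ` region_above a \<subseteq> upper_half_plane"
    using Im_\<Psi>_pos by (auto simp: mem_region mem_upper_half_plane)
  have "deriv \<Phi> holomorphic_on upper_half_plane"
    by (rule holomorphic_deriv[OF holo open_upper_half_plane])
  then have 1: "(\<lambda>w. deriv \<Phi> (\<Psi> w)) holomorphic_on region_above a"
    using holomorphic_on_compose_gen[OF \<Psi>_holomorphic _ im] by (simp add: o_def)
  have 2: "(\<lambda>w. f (\<Psi> w)) holomorphic_on region_above a"
    using holomorphic_on_compose_gen[OF \<Psi>_holomorphic f im] by (simp add: o_def)
  have ne: "deriv \<Phi> (\<Psi> w) \<notin> \<real>\<^sub>\<le>\<^sub>0" "deriv \<Phi> (\<Psi> w) \<noteq> 0" if "w \<in> region_above a" for w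
    using Re_deriv_\<Phi>_pos[of "\<Psi> w"] Im_\<Psi>_pos[of w] that by (auto simp: complex_nonpos_Reals_iff mem_region)
  have "(\<lambda>w. f (\<Psi> w) / deriv \<Phi> (\<Psi> w) powr complex_of_real (1 / p)) holomorphic_on region_above a"
    by (intro holomorphic_on_divide 2 holomorphic_on_powr 1 holomorphic_on_const) (use ne in auto)
  then show ?thesis
    by (rule holomorphic_transform) (simp add: hardy_pullback_def)
qed

lemma norm_hardy_pullback:
  assumes w: "a (Re w) < Im w" and p: "0 < p"
  shows "norm (hardy_pullback p f w) powr p = norm (f (\<Psi> w)) powr p * norm (deriv \<Psi> w)"
proof -
  have ne: "deriv \<Phi> (\<Psi> w) \<noteq> 0" using deriv_\<Phi>_\<Psi>[OF w] by auto
  have "norm (deriv \<Phi> (\<Psi> w)) * norm (deriv \<Psi> w) = 1"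
    using deriv_\<Phi>_\<Psi>[OF w] by (metis norm_mult norm_one)
  then have "norm (deriv \<Psi> w) = 1 / norm (deriv \<Phi> (\<Psi> w))" using ne by (simp add: field_simps)
  then show ?thesis
    using w p ne by (simp add: hardy_pullback_def mem_region norm_divide norm_powr_of_real powr_divide powr_powr del: of_real_divide)
qed

lemma hardy_transfer_pullback:
  assumes "\<And>z. z \<notin> upper_half_plane \<Longrightarrow> f z = 0"
  shows "hardy_transfer p \<Phi> (hardy_pullback p f) = f"
proof
  fix z
  show "hardy_transfer p \<Phi> (hardy_pullback p f) z = f z"
  proof (cases "z \<in> upper_half_plane")
    case True
    then have z: "0 < Im z" by (simp add: mem_upper_half_plane)
    have "deriv \<Phi> z \<noteq> 0" using Re_deriv_\<Phi>_pos[OF z] by auto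
    then show ?thesis
      using True z \<Phi>_region[OF z] by (simp add: hardy_transfer_def hardy_pullback_def mem_region \<Psi>_\<Phi> del: of_real_divide)
  next
    case False
    then show ?thesis using assms by (simp add: hardy_transfer_def)
  qed
qed

lemma inj_on_hardy_transfer:
  assumes V: "\<And>F w. F \<in> V \<Longrightarrow> w \<notin> region_above a \<Longrightarrow> F w = 0"
  shows "inj_on (hardy_transfer p \<Phi>) V"
proof (rule inj_onI, rule ext)
  fix F G w assume FG: "F \<in> V" "G \<in> V" "hardy_transfer p \<Phi> F = hardy_transfer p \<Phi> G"
  show "F w = G w"
  proof (cases "w \<in> region_above a")
    case True
    then have w: "a (Re w) < Im w" by (simp add: mem_region)
    have "deriv \<Phi> (\<Psi> w) \<noteq> 0" using deriv_\<Phi>_\<Psi>[OF w] by auto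
    then show ?thesis
      using fun_cong[OF FG(3), of "\<Psi> w"] Im_\<Psi>_pos[OF w] \<Phi>_\<Psi>[of w] w
      by (simp add: hardy_transfer_def mem_upper_half_plane del: of_real_divide)
  next
    case False
    then show ?thesis using V[OF FG(1)] V[OF FG(2)] by simp
  qed
qed

text \<open>
  Apply the Poisson bound to \<open>f\<close> shifted upwards by \<open>\<epsilon>\<close>, interchange the integrals, and let \<open>\<epsilon>\<close> tend
  to \<open>0\<close>.
\<close>
lemma hardy_pullback_bound:
  assumes p: "1 < p"
  obtains C where "0 \<le> C" "\<And>f K \<tau>. f holomorphic_on upper_half_plane \<Longrightarrow> f \<in> borel_measurable borel \<Longrightarrow> 0 \<le> K \<Longrightarrow>
    (\<And>y. 0 < y \<Longrightarrow> line_integral p f y \<le> ennreal K) \<Longrightarrow> 0 < \<tau> \<Longrightarrow>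
    graph_integral p a (hardy_pullback p f) \<tau> \<le> ennreal (C * K)"
proof -
  obtain C where C: "0 \<le> C" "\<And>t \<tau>. 0 < \<tau> \<Longrightarrow>
    (\<integral>\<^sup>+u. ennreal (pulled_kernel t \<tau> u) \<partial>lborel) \<le> ennreal C"
    by (rule poisson_pullback_integral_bound) blast
  have "graph_integral p a (hardy_pullback p f) \<tau> \<le> ennreal (C * K)"
    if f: "f holomorphic_on upper_half_plane" and [measurable]: "f \<in> borel_measurable borel" and K0: "0 \<le> K"
      and K: "\<And>y. 0 < y \<Longrightarrow> line_integral p f y \<le> ennreal K"
      and \<tau>: "0 < \<tau>" for f K \<tau>
  proof -
    define Z where "Z = (\<lambda>u. \<Psi> (Complex u (a u + \<tau>)))"
    define D where "D = (\<lambda>u. norm (deriv \<Psi> (Complex u (a u + \<tau>))))"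
    have [measurable]: "Z \<in> borel_measurable borel" "D \<in> borel_measurable borel"
      unfolding Z_def D_def
      by (intro borel_measurable_continuous_onI continuous_on_norm continuous_on_\<Psi>_above_graph[OF \<tau>])+
    have ZI: "0 < Im (Z u)" for u unfolding Z_def by (rule Im_\<Psi>_pos) (use \<tau> in simp)
    define \<epsilon> where "\<epsilon> = (\<lambda>n. inverse (real (Suc n)))"
    have \<epsilon>: "0 < \<epsilon> n" for n by (simp add: \<epsilon>_def)
    have [measurable]: "(\<lambda>(u, t). poisson_kernel (Z u) t) \<in> borel_measurable (borel \<Otimes>\<^sub>M borel)"
      unfolding poisson_kernel_def by measurable
    have step: "(\<integral>\<^sup>+u. ennreal (norm (f (Z u + \<i> * of_real (\<epsilon> n))) powr p * D u) \<partial>lborel) \<le> ennreal (C * K)" for n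
    proof -
      have "(\<integral>\<^sup>+u. ennreal (norm (f (Z u + \<i> * of_real (\<epsilon> n))) powr p * D u) \<partial>lborel)
          \<le> (\<integral>\<^sup>+u. \<integral>\<^sup>+t. ennreal (poisson_kernel (Z u) t * D u) * ennreal (norm (f (Complex t (\<epsilon> n))) powr p) \<partial>lborel \<partial>lborel)"
      proof (rule nn_integral_mono)
        fix u
        have "ennreal (norm (f (Z u + \<i> * of_real (\<epsilon> n))) powr p * D u)
            = ennreal (norm (f (Z u + \<i> * of_real (\<epsilon> n))) powr p) * ennreal (D u)"
          by (simp add: ennreal_mult D_def)
        also have "\<dots> \<le> (\<integral>\<^sup>+t. ennreal (poisson_kernel (Z u) t * norm (f (Complex t (\<epsilon> n))) powr p) \<partial>lborel) * ennreal (D u)"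
          by (intro mult_right_mono hardy_le_poisson_integral[OF f _ p K0 K \<epsilon> ZI]) auto
        also have "\<dots> = (\<integral>\<^sup>+t. ennreal (poisson_kernel (Z u) t * norm (f (Complex t (\<epsilon> n))) powr p) * ennreal (D u) \<partial>lborel)"
          by (rule nn_integral_multc[symmetric]) measurable
        also have "\<dots> = (\<integral>\<^sup>+t. ennreal (poisson_kernel (Z u) t * D u) * ennreal (norm (f (Complex t (\<epsilon> n))) powr p) \<partial>lborel)"
          using ZI[of u] by (intro nn_integral_cong)
            (simp add: D_def poisson_kernel_nonneg mult_ac flip: ennreal_mult)
        finally show "ennreal (norm (f (Z u + \<i> * of_real (\<epsilon> n))) powr p * D u)
          \<le> (\<integral>\<^sup>+t. ennreal (poisson_kernel (Z u) t * D u) * ennreal (norm (f (Complex t (\<epsilon> n))) powr p) \<partial>lborel)" .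
      qed
      also have "\<dots> = (\<integral>\<^sup>+t. \<integral>\<^sup>+u. ennreal (poisson_kernel (Z u) t * D u) * ennreal (norm (f (Complex t (\<epsilon> n))) powr p) \<partial>lborel \<partial>lborel)"
        by (rule lborel_pair.Fubini'[symmetric]) measurable
      also have "\<dots> = (\<integral>\<^sup>+t. (\<integral>\<^sup>+u. ennreal (poisson_kernel (Z u) t * D u) \<partial>lborel) * ennreal (norm (f (Complex t (\<epsilon> n))) powr p) \<partial>lborel)"
        by (intro nn_integral_cong nn_integral_multc) measurable
      also have "\<dots> \<le> (\<integral>\<^sup>+t. ennreal C * ennreal (norm (f (Complex t (\<epsilon> n))) powr p) \<partial>lborel)"
        unfolding Z_def D_def by (intro nn_integral_mono mult_right_mono C(2) \<tau>) auto
      also have "\<dots> = ennreal C * (\<integral>\<^sup>+t. ennreal (norm (f (Complex t (\<epsilon> n))) powr p) \<partial>lborel)"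
        by (rule nn_integral_cmult) measurable
      also have "\<dots> \<le> ennreal C * ennreal K" by (intro mult_left_mono K \<epsilon>) auto
      finally show ?thesis using C K0 by (simp add: ennreal_mult)
    qed
    have "(\<integral>\<^sup>+u. ennreal (norm (f (Z u)) powr p * D u) \<partial>lborel) \<le> ennreal (C * K)"
    proof (rule nn_integral_le_if_tendsto[OF _ _ step])
      fix u
      have "isCont f (Z u)"
        using f open_upper_half_plane ZI[of u]
        by (meson continuous_on_eq_continuous_at holomorphic_on_imp_continuous_on mem_upper_half_plane)
      moreover have "(\<lambda>n. Z u + \<i> * of_real (\<epsilon> n)) \<longlonglongrightarrow> Z u + \<i> * of_real 0"
        unfolding \<epsilon>_def by (intro tendsto_intros LIMSEQ_inverse_real_of_nat)
      ultimately have "(\<lambda>n. f (Z u + \<i> * of_real (\<epsilon> n))) \<longlonglongrightarrow> f (Z u)"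
        using isCont_tendsto_compose by fastforce
      then show "(\<lambda>n. ennreal (norm (f (Z u + \<i> * of_real (\<epsilon> n))) powr p * D u)) \<longlonglongrightarrow> ennreal (norm (f (Z u)) powr p * D u)"
        using p by (intro tendsto_ennrealI tendsto_mult tendsto_const tendsto_powr' tendsto_norm) auto
    qed measurable
    then show ?thesis
      using \<tau> p by (simp add: Z_def D_def norm_hardy_pullback)
  qed
  then show ?thesis using that C(1) by blast
qed

end
section \<open>Arc length on a Lipschitz graph\<close>

text \<open>
  The Cauchy criterion for the difference quotients.  By continuity rational increments suffice,
  which makes the set of points of differentiability a Borel set.
\<close>
lemma has_derivative_iff_rational_Cauchy:
  fixes f :: "real \<Rightarrow> real"
  assumes f: "continuous_on UNIV f"
  shows "(\<exists>l. (f has_real_derivative l) (at x)) \<longleftrightarrow>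
    (\<forall>k::nat. \<exists>n::nat. \<forall>r\<in>\<rat> - {0}. \<forall>s\<in>\<rat> - {0}. \<bar>r\<bar> < 1 / Suc n \<longrightarrow> \<bar>s\<bar> < 1 / Suc n \<longrightarrow>
      \<bar>(f (x + r) - f x) / r - (f (x + s) - f x) / s\<bar> \<le> 1 / Suc k)"
    (is "_ \<longleftrightarrow> (\<forall>k. \<exists>n. ?P k n)")
proof
  define q where "q = (\<lambda>h. (f (x + h) - f x) / h)"
  assume "\<exists>l. (f has_real_derivative l) (at x)"
  then obtain l where "(q \<longlongrightarrow> l) (at 0)" by (auto simp: DERIV_def q_def)
  show "\<forall>k. \<exists>n. ?P k n"
  proof
    fix k :: nat
    define e where "e = 1 / (2 * real (Suc k))"
    have e: "0 < e" "e + e = 1 / real (Suc k)" by (simp_all add: e_def field_simps)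
    have "\<forall>\<^sub>F h in at 0. dist (q h) l < e"
      using \<open>(q \<longlongrightarrow> l) (at 0)\<close> e(1) by (rule tendstoD)
    then obtain d where d: "0 < d" "\<And>h. h \<noteq> 0 \<Longrightarrow> \<bar>h\<bar> < d \<Longrightarrow> \<bar>q h - l\<bar> < e"
      by (auto simp: eventually_at dist_real_def)
    obtain n where n: "1 / Suc n < d" using nat_approx_posE[OF d(1)] by blast
    have "\<bar>q r - q s\<bar> \<le> 1 / Suc k" if "r \<noteq> 0" "s \<noteq> 0" "\<bar>r\<bar> < 1 / Suc n" "\<bar>s\<bar> < 1 / Suc n" for r s
    proof -
      have "\<bar>q r - l\<bar> < e" "\<bar>q s - l\<bar> < e"
        using d(2)[of r] d(2)[of s] that n by linarith+
      then have "\<bar>q r - q s\<bar> \<le> e + e" by linarith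
      then show ?thesis unfolding e(2) .
    qed
    note * = this[unfolded q_def]
    show "\<exists>n. ?P k n"
      by (rule exI[of _ n], intro ballI impI, rule *) simp_all
  qed
next
  define q where "q = (\<lambda>h. (f (x + h) - f x) / h)"
  assume P: "\<forall>k. \<exists>n. ?P k n"
  have cq: "isCont q h" if "h \<noteq> 0" for h
  proof -
    have "isCont f (x + h)" using f by (simp add: continuous_on_eq_continuous_at)
    then have "isCont (\<lambda>h. f (x + h)) h" by (intro isCont_o2[of h "\<lambda>h. x + h" f]) simp_all
    then show ?thesis unfolding q_def using that by (intro isCont_divide isCont_diff) simp_all
  qed
  have real: "\<exists>n. \<forall>r s. r \<noteq> 0 \<longrightarrow> s \<noteq> 0 \<longrightarrow> \<bar>r\<bar> < 1 / Suc n \<longrightarrow> \<bar>s\<bar> < 1 / Suc n \<longrightarrow> \<bar>q r - q s\<bar> \<le> 1 / Suc k" for k :: nat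
  proof -
    obtain n where n: "?P k n" using P by blast
    have "\<bar>q r - q s\<bar> \<le> 1 / Suc k" if rs: "r \<noteq> 0" "s \<noteq> 0" "\<bar>r\<bar> < 1 / Suc n" "\<bar>s\<bar> < 1 / Suc n" for r s
    proof -
      have app: "\<exists>X. (\<forall>i::nat. X i \<in> \<rat>) \<and> X \<longlonglongrightarrow> r" for r :: real
        using closure_sequential[of r \<rat>] Rats_closure_real by simp
      obtain X Y where X: "\<And>i::nat. X i \<in> \<rat>" "X \<longlonglongrightarrow> r" and Y: "\<And>i::nat. Y i \<in> \<rat>" "Y \<longlonglongrightarrow> s"
        using app[of r] app[of s] by blast
      have "\<forall>\<^sub>F i in sequentially. X i \<noteq> 0" "\<forall>\<^sub>F i in sequentially. Y i \<noteq> 0"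
        using tendsto_imp_eventually_ne X(2) Y(2) rs by blast+
      moreover have "\<forall>\<^sub>F i in sequentially. \<bar>X i\<bar> < 1 / Suc n" "\<forall>\<^sub>F i in sequentially. \<bar>Y i\<bar> < 1 / Suc n"
        using order_tendstoD(2)[OF tendsto_rabs[OF X(2)] rs(3)] order_tendstoD(2)[OF tendsto_rabs[OF Y(2)] rs(4)] by auto
      ultimately have ev: "\<forall>\<^sub>F i in sequentially. \<bar>q (X i) - q (Y i)\<bar> \<le> 1 / Suc k"
      proof eventually_elim
        case (elim i)
        have XY: "X i \<in> \<rat> - {0}" "Y i \<in> \<rat> - {0}" using X(1) Y(1) elim by auto
        show ?case unfolding q_def by (rule n[rule_format, OF XY elim(3,4)])
      qed
      have "(\<lambda>i. \<bar>q (X i) - q (Y i)\<bar>) \<longlonglongrightarrow> \<bar>q r - q s\<bar>"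
        by (intro tendsto_rabs tendsto_diff isCont_tendsto_compose[OF cq] X Y rs)
      then show ?thesis using ev by (rule tendsto_upperbound) simp
    qed
    then show ?thesis by blast
  qed
  define h where "h = (\<lambda>i. inverse (real (Suc i)))"
  have h: "h i \<noteq> 0" "h \<longlonglongrightarrow> 0" for i
    unfolding h_def using LIMSEQ_inverse_real_of_nat by auto
  have hsmall: "\<forall>\<^sub>F i in sequentially. \<bar>h i\<bar> < 1 / Suc n" for n :: nat
    using order_tendstoD(2)[OF tendsto_rabs_zero[OF h(2)], of "1 / Suc n"] by simp
  have "Cauchy (\<lambda>i. q (h i))"
  proof (rule metric_CauchyI)
    fix e :: real assume "0 < e"
    then obtain k where k: "1 / Suc k < e" by (rule nat_approx_posE)
    obtain n where n: "\<And>r s. r \<noteq> 0 \<Longrightarrow> s \<noteq> 0 \<Longrightarrow> \<bar>r\<bar> < 1 / Suc n \<Longrightarrow> \<bar>s\<bar> < 1 / Suc n \<Longrightarrow> \<bar>q r - q s\<bar> \<le> 1 / Suc k"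
      using real[of k] by blast
    obtain i0 where i0: "\<And>i. i0 \<le> i \<Longrightarrow> \<bar>h i\<bar> < 1 / Suc n" using hsmall[of n] by (auto simp: eventually_sequentially)
    have "dist (q (h i)) (q (h j)) < e" if "i0 \<le> i" "i0 \<le> j" for i j
      using n[OF h(1) h(1) i0[OF that(1)] i0[OF that(2)]] k unfolding dist_real_def by (rule le_less_trans)
    then show "\<exists>M. \<forall>m\<ge>M. \<forall>n\<ge>M. dist (q (h m)) (q (h n)) < e" by blast
  qed
  then obtain l where l: "(\<lambda>i. q (h i)) \<longlonglongrightarrow> l" by (auto simp: Cauchy_convergent_iff convergent_def)
  have "(q \<longlongrightarrow> l) (at 0)"
  proof (rule tendstoI)
    fix e :: real assume "0 < e"
    then obtain k where k: "1 / Suc k < e" by (rule nat_approx_posE)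
    obtain n where n: "\<And>r s. r \<noteq> 0 \<Longrightarrow> s \<noteq> 0 \<Longrightarrow> \<bar>r\<bar> < 1 / Suc n \<Longrightarrow> \<bar>s\<bar> < 1 / Suc n \<Longrightarrow> \<bar>q r - q s\<bar> \<le> 1 / Suc k"
      using real[of k] by blast
    have "\<bar>q r - l\<bar> < e" if r: "r \<noteq> 0" "\<bar>r\<bar> < 1 / Suc n" for r
    proof -
      have "(\<lambda>i. \<bar>q r - q (h i)\<bar>) \<longlonglongrightarrow> \<bar>q r - l\<bar>" by (intro tendsto_intros l)
      moreover have "\<forall>\<^sub>F i in sequentially. \<bar>q r - q (h i)\<bar> \<le> 1 / Suc k"
        using hsmall[of n] by eventually_elim (rule n[OF r(1) h(1) r(2)])
      ultimately have "\<bar>q r - l\<bar> \<le> 1 / Suc k" by (rule tendsto_upperbound) simp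
      then show ?thesis using k by simp
    qed
    then show "\<forall>\<^sub>F r in at 0. dist (q r) l < e"
      by (auto simp: eventually_at dist_real_def intro!: exI[of _ "1 / Suc n"])
  qed
  then show "\<exists>l. (f has_real_derivative l) (at x)" by (auto simp: DERIV_def q_def)
qed

text \<open>
  At the points where \<open>f\<close> is not differentiable, \<open>deriv f\<close> has one fixed value, that of the choice
  operator for the empty predicate; elsewhere it is a limit of difference quotients, which are bounded
  by \<open>M\<close>.
\<close>
lemma deriv_measurable_and_bounded:
  fixes f :: "real \<Rightarrow> real"
  assumes f: "continuous_on UNIV f" and lip: "\<And>u v. \<bar>f u - f v\<bar> \<le> M * \<bar>u - v\<bar>"
  shows "deriv f \<in> borel_measurable borel" and "\<exists>L. \<forall>u. \<bar>deriv f u\<bar> \<le> L"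
proof -
  define D where "D = {x. \<exists>l. (f has_real_derivative l) (at x)}"
  define d where "d = (SOME l::real. False)"
  have [measurable]: "f \<in> borel_measurable borel" using f by (rule borel_measurable_continuous_onI)
  have ball: "(\<forall>r\<in>\<rat> - {0}. \<forall>s\<in>\<rat> - {0}. c r \<longrightarrow> c s \<longrightarrow> P r s) \<longleftrightarrow>
      (\<forall>r\<in>{r\<in>\<rat>. r \<noteq> 0 \<and> c r}. \<forall>s\<in>{s\<in>\<rat>. s \<noteq> 0 \<and> c s}. P r s)" for c :: "real \<Rightarrow> bool" and P
    by blast
  have Dset: "D = (\<Inter>k::nat. \<Union>n::nat. \<Inter>r\<in>{r\<in>\<rat>. r \<noteq> 0 \<and> \<bar>r\<bar> < 1 / Suc n}. \<Inter>s\<in>{s\<in>\<rat>. s \<noteq> 0 \<and> \<bar>s\<bar> < 1 / Suc n}.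
      {x. \<bar>(f (x + r) - f x) / r - (f (x + s) - f x) / s\<bar> \<le> 1 / Suc k})"
    unfolding D_def has_derivative_iff_rational_Cauchy[OF f] ball
    by (simp only: set_eq_iff mem_Collect_eq INT_iff UN_iff UNIV_I ball_UNIV bex_UNIV) simp
  have [measurable]: "D \<in> sets borel"
  proof -
    have cr: "countable {r\<in>\<rat>. r \<noteq> 0 \<and> \<bar>r\<bar> < 1 / Suc n}" for n
      by (rule countable_subset[OF _ countable_rat]) auto
    have ne: "{r\<in>\<rat>. r \<noteq> 0 \<and> \<bar>r\<bar> < 1 / real (Suc n)} \<noteq> {}" for n :: nat
    proof -
      obtain r where "r \<in> \<rat>" "0 < r" "r < 1 / real (Suc n)" using Rats_dense_in_real[of 0 "1 / real (Suc n)"] by auto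
      then show ?thesis by auto
    qed
    show ?thesis unfolding Dset
      by (intro sets.countable_INT'' sets.countable_UN'' sets.countable_INT' ne cr) measurable
  qed
  have dD: "(f has_real_derivative deriv f x) (at x)" if "x \<in> D" for x
    using that by (auto simp: D_def DERIV_imp_deriv)
  have dN: "deriv f x = d" if "x \<notin> D" for x
    using that by (simp add: deriv_def d_def D_def)
  define h where "h = (\<lambda>i. inverse (real (Suc i)))"
  define g where "g = (\<lambda>i x. if x \<in> D then (f (x + h i) - f x) / h i else d)"
  have lim: "(\<lambda>i. g i x) \<longlonglongrightarrow> deriv f x" for x
  proof (cases "x \<in> D")
    case True
    have "h \<longlonglongrightarrow> 0" "\<forall>i. h i \<noteq> 0" unfolding h_def using LIMSEQ_inverse_real_of_nat by auto
    then have "(\<lambda>i. (f (x + h i) - f x) / h i) \<longlonglongrightarrow> deriv f x"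
      using dD[OF True] unfolding DERIV_def tendsto_at_iff_sequentially by (auto simp: o_def)
    then show ?thesis using True by (simp add: g_def)
  qed (simp add: g_def dN)
  have gm: "g i \<in> borel_measurable borel" for i unfolding g_def by measurable
  show "deriv f \<in> borel_measurable borel"
    by (rule borel_measurable_LIMSEQ_real[where u = g]) (use lim gm in auto)
  have "\<bar>deriv f x\<bar> \<le> max M \<bar>d\<bar>" for x
  proof (rule LIMSEQ_le_const2[OF tendsto_rabs[OF lim]], intro exI allI impI)
    fix i
    have hi: "0 < h i" by (simp add: h_def)
    have "\<bar>(f (x + h i) - f x) / h i\<bar> \<le> M"
      using lip[of "x + h i" x] hi by (simp add: field_simps)
    then show "\<bar>g i x\<bar> \<le> max M \<bar>d\<bar>" by (auto simp: g_def)
  qed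
  then show "\<exists>L. \<forall>u. \<bar>deriv f u\<bar> \<le> L" by blast
qed

context lipschitz_graph
begin

lemma nn_integral_arc_length:
  assumes g [measurable]: "g \<in> borel_measurable borel"
  shows "(\<integral>\<^sup>+\<zeta>. g \<zeta> \<partial>arc_length_measure a)
    = (\<integral>\<^sup>+u. ennreal (sqrt (1 + (deriv a u)\<^sup>2)) * g (Complex u (a u)) \<partial>lborel)"
proof -
  have [measurable]: "deriv a \<in> borel_measurable borel"
    by (rule deriv_measurable_and_bounded(1)[of a M]) (auto intro!: continuous_intros lipschitz)
  have T: "(\<lambda>u. Complex u (a u)) \<in> measurable (density lborel (\<lambda>u. ennreal (sqrt (1 + (deriv a u)\<^sup>2)))) (restrict_space borel (graph_curve a))"
    by (rule measurable_restrict_space2) (auto simp: graph_curve_def)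
  have "(\<integral>\<^sup>+\<zeta>. g \<zeta> \<partial>arc_length_measure a)
      = (\<integral>\<^sup>+u. g (Complex u (a u)) \<partial>density lborel (\<lambda>u. ennreal (sqrt (1 + (deriv a u)\<^sup>2))))"
    unfolding arc_length_measure_def
    by (rule nn_integral_distr[OF T]) (use measurable_restrict_space1[OF g] in simp)
  also have "\<dots> = (\<integral>\<^sup>+u. ennreal (sqrt (1 + (deriv a u)\<^sup>2)) * g (Complex u (a u)) \<partial>lborel)"
    by (rule nn_integral_density) measurable
  finally show ?thesis .
qed

text \<open>
  The density \<open>sqrt (1 + (deriv a u)\<^sup>2)\<close> lies between \<open>1\<close> and a constant.
\<close>
lemma arc_length_comparable:
  obtains W where "0 \<le> W"
    "\<And>F \<tau>. F \<in> borel_measurable borel \<Longrightarrow> graph_integral p a F \<tau> \<le> arc_integral p a F \<tau>"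
    "\<And>F \<tau>. F \<in> borel_measurable borel \<Longrightarrow> arc_integral p a F \<tau> \<le> ennreal W * graph_integral p a F \<tau>"
proof -
  obtain L where L: "\<And>u. \<bar>deriv a u\<bar> \<le> L"
    using deriv_measurable_and_bounded(2)[OF continuous_on_a[OF continuous_on_id] lipschitz] by blast
  define W where "W = sqrt (1 + L\<^sup>2)"
  show ?thesis
  proof
    show "0 \<le> W" by (simp add: W_def)
    fix F :: "complex \<Rightarrow> complex" and \<tau> :: real
    assume [measurable]: "F \<in> borel_measurable borel"
    define g where "g = (\<lambda>\<zeta>. ennreal (norm (F (\<zeta> + \<i> * of_real \<tau>)) powr p))"
    have g [measurable]: "g \<in> borel_measurable borel" unfolding g_def by measurable
    have "Complex u (a u) + \<i> * of_real \<tau> = Complex u (a u + \<tau>)" for u by (simp add: complex_eq_iff)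
    then have gu: "g (Complex u (a u)) = ennreal (norm (F (Complex u (a u + \<tau>))) powr p)" for u
      by (simp only: g_def)
    have arc: "arc_integral p a F \<tau> = (\<integral>\<^sup>+u. ennreal (sqrt (1 + (deriv a u)\<^sup>2)) * g (Complex u (a u)) \<partial>lborel)"
      using nn_integral_arc_length[OF g] by (simp add: g_def)
    show "graph_integral p a F \<tau> \<le> arc_integral p a F \<tau>"
      unfolding arc gu[symmetric]
    proof (rule nn_integral_mono)
      fix u
      have "1 \<le> ennreal (sqrt (1 + (deriv a u)\<^sup>2))" using ennreal_leI[of 1 "sqrt (1 + (deriv a u)\<^sup>2)"] by simp
      then have "1 * g (Complex u (a u)) \<le> ennreal (sqrt (1 + (deriv a u)\<^sup>2)) * g (Complex u (a u))"
        by (rule mult_right_mono) simp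
      then show "g (Complex u (a u)) \<le> ennreal (sqrt (1 + (deriv a u)\<^sup>2)) * g (Complex u (a u))" by simp
    qed
    have "arc_integral p a F \<tau> \<le> (\<integral>\<^sup>+u. ennreal W * g (Complex u (a u)) \<partial>lborel)"
      unfolding arc
    proof (intro nn_integral_mono mult_right_mono ennreal_leI)
      fix u
      have "(deriv a u)\<^sup>2 \<le> L\<^sup>2" using L[of u] by (metis abs_le_square_iff abs_of_nonneg abs_ge_zero order_trans)
      then show "sqrt (1 + (deriv a u)\<^sup>2) \<le> W" by (simp add: W_def)
    qed simp
    also have "\<dots> = ennreal W * (\<integral>\<^sup>+u. g (Complex u (a u)) \<partial>lborel)"
      by (rule nn_integral_cmult) measurable
    finally show "arc_integral p a F \<tau> \<le> ennreal W * graph_integral p a F \<tau>"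
      unfolding gu .
  qed
qed

end

section \<open>Hardy spaces and their norms\<close>

lemma (in lipschitz_graph) function_subspace_hardy_class:
  assumes p: "1 < p"
  shows "function_subspace {F. F holomorphic_on region_above a \<and> (\<forall>z. z \<notin> region_above a \<longrightarrow> F z = 0) \<and>
    (\<exists>K\<ge>0. \<forall>\<tau>>0. graph_integral p a F \<tau> \<le> ennreal K)}"
    (is "function_subspace {F. ?H F}")
  unfolding function_subspace_def
proof (intro conjI ballI allI)
  show "(\<lambda>z. 0) \<in> {F. ?H F}" using p by (auto intro!: exI[of _ 0])
next
  fix F G assume "F \<in> {F. ?H F}" "G \<in> {F. ?H F}"
  then have FG: "F holomorphic_on region_above a" "\<And>z. z \<notin> region_above a \<Longrightarrow> F z = 0"
    "G holomorphic_on region_above a" "\<And>z. z \<notin> region_above a \<Longrightarrow> G z = 0" by auto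
  obtain K L where K: "0 \<le> K" "\<And>\<tau>. 0 < \<tau> \<Longrightarrow> graph_integral p a F \<tau> \<le> ennreal K"
    and L: "0 \<le> L" "\<And>\<tau>. 0 < \<tau> \<Longrightarrow> graph_integral p a G \<tau> \<le> ennreal L"
    using \<open>F \<in> {F. ?H F}\<close> \<open>G \<in> {F. ?H F}\<close> by blast
  have [measurable]: "F \<in> borel_measurable borel" "G \<in> borel_measurable borel"
    using borel_measurable_holomorphic_zero_outside[OF _ open_region] FG by blast+
  have "(\<integral>\<^sup>+u. ennreal (norm (F (Complex u (a u + \<tau>)) + G (Complex u (a u + \<tau>))) powr p) \<partial>lborel) \<le> ennreal (2 powr p * (K + L))"
    if \<tau>: "0 < \<tau>" for \<tau>
  proof -
    have "(\<integral>\<^sup>+u. ennreal (norm (F (Complex u (a u + \<tau>)) + G (Complex u (a u + \<tau>))) powr p) \<partial>lborel)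
        \<le> (\<integral>\<^sup>+u. ennreal (2 powr p) * (ennreal (norm (F (Complex u (a u + \<tau>))) powr p) + ennreal (norm (G (Complex u (a u + \<tau>))) powr p)) \<partial>lborel)"
    proof (rule nn_integral_mono)
      fix u
      define v w where "v = F (Complex u (a u + \<tau>))" and "w = G (Complex u (a u + \<tau>))"
      have "norm (v + w) powr p \<le> (2 * max (norm v) (norm w)) powr p"
        using p norm_triangle_ineq[of v w] by (intro powr_mono2) auto
      also have "\<dots> = 2 powr p * max (norm v) (norm w) powr p" by (rule powr_mult)
      also have "\<dots> \<le> 2 powr p * (norm v powr p + norm w powr p)"
        by (intro mult_left_mono) (auto simp: max_def)
      finally show "ennreal (norm (v + w) powr p) \<le> ennreal (2 powr p) * (ennreal (norm v powr p) + ennreal (norm w powr p))"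
        by (simp add: ennreal_leI flip: ennreal_mult ennreal_plus)
    qed
    also have "\<dots> = ennreal (2 powr p) * (graph_integral p a F \<tau>
        + graph_integral p a G \<tau>)"
      by (simp add: nn_integral_cmult nn_integral_add)
    also have "\<dots> \<le> ennreal (2 powr p) * (ennreal K + ennreal L)"
      by (intro mult_left_mono add_mono K L \<tau>) auto
    finally show ?thesis using K L by (simp add: ennreal_mult ennreal_plus)
  qed
  moreover have "0 \<le> 2 powr p * (K + L)" using K L by simp
  ultimately show "(\<lambda>z. F z + G z) \<in> {F. ?H F}"
    using FG by (auto intro!: holomorphic_intros)
next
  fix c F assume "F \<in> {F. ?H F}"
  then obtain K where F: "F holomorphic_on region_above a" "\<And>z. z \<notin> region_above a \<Longrightarrow> F z = 0"
    and K: "0 \<le> K" "\<And>\<tau>. 0 < \<tau> \<Longrightarrow> graph_integral p a F \<tau> \<le> ennreal K"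
    by blast
  have [measurable]: "F \<in> borel_measurable borel"
    using borel_measurable_holomorphic_zero_outside[OF _ open_region] F by blast
  have "(\<integral>\<^sup>+u. ennreal (norm (c * F (Complex u (a u + \<tau>))) powr p) \<partial>lborel) \<le> ennreal (norm c powr p * K)"
    if \<tau>: "0 < \<tau>" for \<tau>
  proof -
    have "(\<integral>\<^sup>+u. ennreal (norm (c * F (Complex u (a u + \<tau>))) powr p) \<partial>lborel)
        = ennreal (norm c powr p) * graph_integral p a F \<tau>"
      by (simp add: norm_mult powr_mult ennreal_mult nn_integral_cmult)
    also have "\<dots> \<le> ennreal (norm c powr p) * ennreal K" by (intro mult_left_mono K \<tau>) simp
    finally show ?thesis using K by (simp add: ennreal_mult)
  qed
  moreover have "0 \<le> norm c powr p * K" using K by simp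
  ultimately show "(\<lambda>z. c * F z) \<in> {F. ?H F}"
    using F by (auto intro!: holomorphic_intros)
qed

lemma ennreal_root_le_iff:
  assumes p: "0 < p" and n: "0 \<le> n"
  shows "ennreal_root p x \<le> ennreal n \<longleftrightarrow> x \<le> ennreal (n powr p)"
proof (cases x)
  case (real r)
  have "r powr (1 / p) \<le> n \<longleftrightarrow> r \<le> n powr p"
  proof
    assume "r powr (1 / p) \<le> n"
    then have "(r powr (1 / p)) powr p \<le> n powr p" using p by (intro powr_mono2) auto
    then show "r \<le> n powr p" using p real by (simp add: powr_powr)
  next
    assume "r \<le> n powr p"
    then have "r powr (1 / p) \<le> (n powr p) powr (1 / p)" using p real by (intro powr_mono2) auto
    then show "r powr (1 / p) \<le> n" using p n by (simp add: powr_powr)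
  qed
  then show ?thesis using real n by (simp add: ennreal_root_def)
qed (use n in \<open>simp add: ennreal_root_def top_unique\<close>)

lemma hardy_norm_above_le_iff:
  assumes "0 < p" "0 \<le> n"
  shows "hardy_norm_above p a F \<le> ennreal n \<longleftrightarrow>
    (\<forall>\<tau>>0. arc_integral p a F \<tau> \<le> ennreal (n powr p))"
  unfolding hardy_norm_above_def SUP_le_iff by (auto simp: ennreal_root_le_iff assms)

lemma hardy_norm_uhp_le_iff:
  assumes "0 < p" "0 \<le> n"
  shows "hardy_norm_uhp p f \<le> ennreal n \<longleftrightarrow>
    (\<forall>y>0. line_integral p f y \<le> ennreal (n powr p))"
  unfolding hardy_norm_uhp_def SUP_le_iff by (auto simp: ennreal_root_le_iff assms)

lemma ennreal_finite_iff_le_powr: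
  assumes p: "0 < p" and le_iff: "\<And>n. 0 \<le> n \<Longrightarrow> N \<le> ennreal n \<longleftrightarrow> P (n powr p)"
  shows "N < \<infinity> \<longleftrightarrow> (\<exists>K\<ge>0. P K)"
proof
  assume "N < \<infinity>"
  then obtain n where n: "0 \<le> n" "N = ennreal n" by (cases N) auto
  then have "P (n powr p)" using le_iff[of n] by simp
  then show "\<exists>K\<ge>0. P K" by (intro exI[of _ "n powr p"]) simp
next
  assume "\<exists>K\<ge>0. P K"
  then obtain K where K: "0 \<le> K" "P K" by blast
  have "(K powr (1 / p)) powr p = K" using p K by (simp add: powr_powr)
  then have "N \<le> ennreal (K powr (1 / p))" using le_iff[of "K powr (1 / p)"] K by simp
  then show "N < \<infinity>" by (simp add: le_less_trans)
qed

text \<open>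
  The passage from estimates of \<open>p\<close>-th powers to estimates of norms: \<open>P K\<close> and \<open>P' K\<close> say that the
  \<open>p\<close>-th power of the norm is at most \<open>K\<close>.
\<close>
lemma norm_le_from_powr_bound:
  assumes p: "0 < p" and C: "0 \<le> C" and N: "N < \<infinity>"
    and le_iff: "\<And>n. 0 \<le> n \<Longrightarrow> N \<le> ennreal n \<longleftrightarrow> P (n powr p)"
    and le_iff': "\<And>n. 0 \<le> n \<Longrightarrow> N' \<le> ennreal n \<longleftrightarrow> P' (n powr p)"
    and imp: "\<And>K. 0 \<le> K \<Longrightarrow> P K \<Longrightarrow> P' (C * K)"
  shows "N' \<le> ennreal (C powr (1 / p)) * N"
proof -
  obtain n where n: "0 \<le> n" "N = ennreal n" using N by (cases N) auto
  then have "P (n powr p)" using le_iff[of n] by simp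
  then have "P' (C * n powr p)" by (rule imp[rotated]) simp
  also have "C * n powr p = (C powr (1 / p) * n) powr p"
    using p C n by (simp add: powr_mult powr_powr)
  finally have "N' \<le> ennreal (C powr (1 / p) * n)"
    using le_iff'[of "C powr (1 / p) * n"] n by simp
  then show ?thesis using n by (simp add: ennreal_mult)
qed

text \<open>
  Membership in the Hardy space can be tested with \<open>du\<close> in place of arc length.
\<close>
lemma (in lipschitz_graph) hardy_above_eq:
  assumes p: "1 < p"
  shows "hardy_above p a = {F. F holomorphic_on region_above a \<and> (\<forall>z. z \<notin> region_above a \<longrightarrow> F z = 0) \<and>
    (\<exists>K\<ge>0. \<forall>\<tau>>0. graph_integral p a F \<tau> \<le> ennreal K)}"
proof (rule set_eqI)
  fix F
  obtain W where W: "0 \<le> W"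
    "\<And>F \<tau>. F \<in> borel_measurable borel \<Longrightarrow> graph_integral p a F \<tau> \<le> arc_integral p a F \<tau>"
    "\<And>F \<tau>. F \<in> borel_measurable borel \<Longrightarrow> arc_integral p a F \<tau> \<le> ennreal W * graph_integral p a F \<tau>"
    by (rule arc_length_comparable) blast
  show "F \<in> hardy_above p a \<longleftrightarrow> F \<in> {F. F holomorphic_on region_above a \<and> (\<forall>z. z \<notin> region_above a \<longrightarrow> F z = 0) \<and>
    (\<exists>K\<ge>0. \<forall>\<tau>>0. graph_integral p a F \<tau> \<le> ennreal K)}"
  proof (cases "F holomorphic_on region_above a \<and> (\<forall>z. z \<notin> region_above a \<longrightarrow> F z = 0)")
    case True
    then have [measurable]: "F \<in> borel_measurable borel"
      using borel_measurable_holomorphic_zero_outside[OF _ open_region] by blast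
    define I where "I = graph_integral p a F"
    define A where "A = arc_integral p a F"
    have IA: "I \<tau> \<le> A \<tau>" "A \<tau> \<le> ennreal W * I \<tau>" for \<tau>
      using W(2,3)[of F \<tau>] by (simp_all add: I_def A_def)
    have "hardy_norm_above p a F < \<infinity> \<longleftrightarrow> (\<exists>K\<ge>0. \<forall>\<tau>>0. A \<tau> \<le> ennreal K)"
      unfolding A_def by (rule ennreal_finite_iff_le_powr[where p = p]) (use p in \<open>auto simp: hardy_norm_above_le_iff\<close>)
    also have "\<dots> \<longleftrightarrow> (\<exists>K\<ge>0. \<forall>\<tau>>0. I \<tau> \<le> ennreal K)"
    proof
      assume "\<exists>K\<ge>0. \<forall>\<tau>>0. A \<tau> \<le> ennreal K"
      then show "\<exists>K\<ge>0. \<forall>\<tau>>0. I \<tau> \<le> ennreal K" using IA(1) order_trans by blast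
    next
      assume "\<exists>K\<ge>0. \<forall>\<tau>>0. I \<tau> \<le> ennreal K"
      then obtain K where K: "0 \<le> K" "\<And>\<tau>. 0 < \<tau> \<Longrightarrow> I \<tau> \<le> ennreal K" by blast
      have "A \<tau> \<le> ennreal (W * K)" if "0 < \<tau>" for \<tau>
      proof -
        have "A \<tau> \<le> ennreal W * ennreal K" by (rule order_trans[OF IA(2)]) (intro mult_left_mono K that, simp)
        then show ?thesis using W(1) K(1) by (simp add: ennreal_mult)
      qed
      then show "\<exists>K\<ge>0. \<forall>\<tau>>0. A \<tau> \<le> ennreal K" using W(1) K(1) by (intro exI[of _ "W * K"]) auto
    qed
    finally show ?thesis using True by (simp add: hardy_above_def I_def)
  qed (auto simp: hardy_above_def)
qed

lemma hardy_uhp_eq: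
  assumes p: "1 < p"
  shows "hardy_uhp p = {f. f holomorphic_on upper_half_plane \<and> (\<forall>z. z \<notin> upper_half_plane \<longrightarrow> f z = 0) \<and>
    (\<exists>K\<ge>0. \<forall>y>0. line_integral p f y \<le> ennreal K)}"
proof -
  have "hardy_norm_uhp p f < \<infinity> \<longleftrightarrow> (\<exists>K\<ge>0. \<forall>y>0. line_integral p f y \<le> ennreal K)" for f
    by (rule ennreal_finite_iff_le_powr[where p = p]) (use p in \<open>auto simp: hardy_norm_uhp_le_iff\<close>)
  then show ?thesis by (simp add: hardy_uhp_def)
qed

lemma function_subspace_hardy_uhp: "1 < p \<Longrightarrow> function_subspace (hardy_uhp p)"
  using flat.function_subspace_hardy_class[of p] by (simp add: hardy_uhp_eq upper_half_plane_eq)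

section \<open>The isomorphism of the Hardy spaces\<close>

theorem theorem2p1:
  fixes a :: "real \<Rightarrow> real" and M p :: real and \<Phi> :: "complex \<Rightarrow> complex"
  assumes M_pos: "0 < M"
    and lipschitz: "\<And>u1 u2. \<bar>a u1 - a u2\<bar> \<le> M * \<bar>u1 - u2\<bar>"
    and p_gt_1: "1 < p"
    and holo: "\<Phi> holomorphic_on upper_half_plane"
    and conformal: "bij_betw \<Phi> upper_half_plane (region_above a)"
    and homeo: "\<exists>\<Psi>. homeomorphism (closure upper_half_plane) (closure (region_above a)) \<Phi> \<Psi>"
    and boundary: "(\<lambda>x. \<Phi> (complex_of_real x)) ` UNIV = graph_curve a"
    and increasing: "strict_mono (\<lambda>x. Re (\<Phi> (complex_of_real x)))"
  shows "hardy_transfer p \<Phi> ` hardy_above p a \<subseteq> hardy_uhp p \<and>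
    linear_between (hardy_above p a) (hardy_uhp p) (hardy_transfer p \<Phi>) \<and>
    inj_on (hardy_transfer p \<Phi>) (hardy_above p a) \<and>
    hardy_transfer p \<Phi> ` hardy_above p a = hardy_uhp p \<and>
    bounded_between (hardy_above p a) (hardy_norm_above p a) (hardy_norm_uhp p)
      (hardy_transfer p \<Phi>) \<and>
    bounded_between (hardy_uhp p) (hardy_norm_uhp p) (hardy_norm_above p a)
      (inv_into (hardy_above p a) (hardy_transfer p \<Phi>))"
proof -
  interpret graph_conformal a M \<Phi>
    by unfold_locales (fact assms)+
  have p0: "0 < p" using p_gt_1 by simp
  let ?T = "hardy_transfer p \<Phi>" and ?V = "hardy_above p a" and ?W = "hardy_uhp p"
  obtain W where W: "0 \<le> W"
    "\<And>F \<tau>. F \<in> borel_measurable borel \<Longrightarrow> graph_integral p a F \<tau> \<le> arc_integral p a F \<tau>"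
    "\<And>F \<tau>. F \<in> borel_measurable borel \<Longrightarrow> arc_integral p a F \<tau> \<le> ennreal W * graph_integral p a F \<tau>"
    by (rule arc_length_comparable) blast
  obtain C1 where C1: "0 \<le> C1" "\<And>F K y. F holomorphic_on region_above a \<Longrightarrow> F \<in> borel_measurable borel \<Longrightarrow> 0 \<le> K \<Longrightarrow>
    (\<And>\<tau>. 0 < \<tau> \<Longrightarrow> graph_integral p a F \<tau> \<le> ennreal K) \<Longrightarrow> 0 < y \<Longrightarrow>
    line_integral p (hardy_transfer p \<Phi> F) y \<le> ennreal (C1 * K)"
    by (rule hardy_transfer_bound[OF p_gt_1]) blast
  obtain C2 where C2: "0 \<le> C2" "\<And>f K \<tau>. f holomorphic_on upper_half_plane \<Longrightarrow> f \<in> borel_measurable borel \<Longrightarrow> 0 \<le> K \<Longrightarrow>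
    (\<And>y. 0 < y \<Longrightarrow> line_integral p f y \<le> ennreal K) \<Longrightarrow> 0 < \<tau> \<Longrightarrow>
    graph_integral p a (hardy_pullback p f) \<tau> \<le> ennreal (C2 * K)"
    by (rule hardy_pullback_bound[OF p_gt_1]) blast
  have V_meas: "F \<in> borel_measurable borel" if "F \<in> ?V" for F
    by (rule borel_measurable_holomorphic_zero_outside[OF _ open_region]) (use that in \<open>auto simp: hardy_above_def\<close>)
  have W_meas: "f \<in> borel_measurable borel" if "f \<in> ?W" for f
    by (rule borel_measurable_holomorphic_zero_outside[OF _ open_upper_half_plane]) (use that in \<open>auto simp: hardy_uhp_def\<close>)
  have T_in: "?T F \<in> ?W" if F: "F \<in> ?V" for F
  proof -
    obtain K where "0 \<le> K" "\<And>\<tau>. 0 < \<tau> \<Longrightarrow> graph_integral p a F \<tau> \<le> ennreal K"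
      using F unfolding hardy_above_eq[OF p_gt_1] by blast
    moreover have "F holomorphic_on region_above a" using F by (simp add: hardy_above_def)
    ultimately show ?thesis
      unfolding hardy_uhp_eq[OF p_gt_1]
      using C1(1) C1(2)[OF _ V_meas[OF F]] hardy_transfer_holomorphic[of F p]
      by (auto simp: hardy_transfer_def intro!: exI[of _ "C1 * K"])
  qed
  have P_in: "hardy_pullback p f \<in> ?V" if f: "f \<in> ?W" for f
  proof -
    obtain K where "0 \<le> K" "\<And>y. 0 < y \<Longrightarrow> line_integral p f y \<le> ennreal K"
      using f unfolding hardy_uhp_eq[OF p_gt_1] by blast
    moreover have "f holomorphic_on upper_half_plane" using f by (simp add: hardy_uhp_def)
    ultimately show ?thesis
      unfolding hardy_above_eq[OF p_gt_1]
      using C2(1) C2(2)[OF _ W_meas[OF f]] hardy_pullback_holomorphic[of f p]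
      by (auto simp: hardy_pullback_def intro!: exI[of _ "C2 * K"])
  qed
  have TP: "?T (hardy_pullback p f) = f" if f: "f \<in> ?W" for f
    by (rule hardy_transfer_pullback) (use f in \<open>simp add: hardy_uhp_def\<close>)
  have sub: "?T ` ?V \<subseteq> ?W" using T_in by blast
  have onto: "?T ` ?V = ?W" using sub P_in TP by (metis image_eqI subsetI subset_antisym)
  have inj: "inj_on ?T ?V"
    by (rule inj_on_hardy_transfer) (simp add: hardy_above_def)
  have inv: "inv_into ?V ?T f = hardy_pullback p f" if f: "f \<in> ?W" for f
    using inv_into_f_f[OF inj P_in[OF f]] TP[OF f] by simp
  have lin: "linear_between ?V ?W ?T"
    unfolding linear_between_def
    using sub function_subspace_hardy_class[OF p_gt_1] function_subspace_hardy_uhp[OF p_gt_1]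
    by (auto simp: hardy_above_eq[OF p_gt_1] hardy_transfer_def fun_eq_iff algebra_simps)
  have bT: "bounded_between ?V (hardy_norm_above p a) (hardy_norm_uhp p) ?T"
    unfolding bounded_between_def
  proof (intro exI conjI ballI)
    fix F assume F: "F \<in> ?V"
    show "hardy_norm_uhp p (?T F) \<le> ennreal (C1 powr (1 / p)) * hardy_norm_above p a F"
    proof (rule norm_le_from_powr_bound[OF p0 C1(1) _ hardy_norm_above_le_iff[OF p0] hardy_norm_uhp_le_iff[OF p0]])
      show "hardy_norm_above p a F < \<infinity>" using F by (simp add: hardy_above_def)
      fix K :: real assume K: "0 \<le> K"
        "\<forall>\<tau>>0. arc_integral p a F \<tau> \<le> ennreal K"
      have "graph_integral p a F \<tau> \<le> ennreal K" if "0 < \<tau>" for \<tau>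
        by (rule order_trans[OF W(2)[OF V_meas[OF F]] K(2)[rule_format, OF that]])
      then show "\<forall>y>0. line_integral p (?T F) y \<le> ennreal (C1 * K)"
        using C1(2)[OF _ V_meas[OF F] K(1)] F by (simp add: hardy_above_def)
    qed
  qed simp
  have bI: "bounded_between ?W (hardy_norm_uhp p) (hardy_norm_above p a) (inv_into ?V ?T)"
    unfolding bounded_between_def
  proof (intro exI conjI ballI)
    fix f assume f: "f \<in> ?W"
    have WC: "0 \<le> W * C2" using W(1) C2(1) by simp
    show "hardy_norm_above p a (inv_into ?V ?T f) \<le> ennreal ((W * C2) powr (1 / p)) * hardy_norm_uhp p f"
      unfolding inv[OF f]
    proof (rule norm_le_from_powr_bound[OF p0 WC _ hardy_norm_uhp_le_iff[OF p0] hardy_norm_above_le_iff[OF p0]])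
      show "hardy_norm_uhp p f < \<infinity>" using f by (simp add: hardy_uhp_def)
      fix K :: real assume K: "0 \<le> K"
        "\<forall>y>0. line_integral p f y \<le> ennreal K"
      show "\<forall>\<tau>>0. arc_integral p a (hardy_pullback p f) \<tau>
          \<le> ennreal (W * C2 * K)"
      proof (intro allI impI)
        fix \<tau> :: real assume \<tau>: "0 < \<tau>"
        have "graph_integral p a (hardy_pullback p f) \<tau> \<le> ennreal (C2 * K)"
          by (rule C2(2)) (use f W_meas[OF f] K \<tau> in \<open>auto simp: hardy_uhp_def\<close>)
        then have "ennreal W * graph_integral p a (hardy_pullback p f) \<tau> \<le> ennreal W * ennreal (C2 * K)"
          by (rule mult_left_mono) simp
        with W(3)[OF V_meas[OF P_in[OF f]]]
        have "arc_integral p a (hardy_pullback p f) \<tau> \<le> ennreal W * ennreal (C2 * K)"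
          by (rule order_trans)
        then show "arc_integral p a (hardy_pullback p f) \<tau> \<le> ennreal (W * C2 * K)"
          using W(1) C2(1) K(1) by (simp add: ennreal_mult mult.assoc)
      qed
    qed
  qed simp
  show ?thesis using sub lin inj onto bT bI by blast
qed

end
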